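(* Let $N\ge 3$ and $p>p_S$. There exists a positive function $u^*\in C^2(0,\infty)$ satisfying \[ u''+\frac{N-1}{s}u'+f(u)=0\quad (0<s<\infty),\qquad u(s)\to\infty\ \ (s\downarrow 0). \] The function $u^*$ oscillates around $1$; in particular it has infinitely many critical points $0<s_1^*<s_2^*<\cdots\to\infty$. Moreover, $u(s,\gamma)\to u^*(s)$ in $C^0_{loc}(0,\infty)$ as $\gamma\to\infty$.
   Context: $N\ge3$, $p_S:=\frac{N+2}{N-2}$, and $f(u):=-u+u^p$. For $\gamma>0$, $u(s,\gamma)$ denotes the solution of the initial value problem $u''+\frac{N-1}{s}u'+f(u)=0$ ($s>0$), $u(0)=\gamma$, $u'(0)=0$ (it exists, is positive, and is defined for all $s\ge 0$). *)

theory Defs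
  imports "HOL-Analysis.Analysis"
begin

text \<open>Nonlinearity f(u) = -u + u^p (only evaluated at positive u).\<close>
definition fnl :: "real \<Rightarrow> real \<Rightarrow> real" where
  "fnl p u = - u + u powr p"

definition radial_ode :: "nat \<Rightarrow> real \<Rightarrow> (real \<Rightarrow> real) \<Rightarrow> bool" where
  "radial_ode N p u \<longleftrightarrow>
     (\<exists>u'. \<forall>s>0. (u has_real_derivative u' s) (at s) \<and>
        (u' has_real_derivative (- ((real N - 1) / s) * u' s - fnl p (u s))) (at s))"

definition ivp_sol :: "nat \<Rightarrow> real \<Rightarrow> real \<Rightarrow> (real \<Rightarrow> real) \<Rightarrow> bool" where
  "ivp_sol N p \<gamma> u \<longleftrightarrow>
     radial_ode N p u \<and> continuous_on {0..} u \<and> u 0 = \<gamma> \<and>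
     (u has_real_derivative 0) (at 0 within {0..}) \<and> (\<forall>s\<ge>0. u s > 0)"

end

(*
  In the variables v = s^theta u, t = ln s, y = dv/dt with theta = 2/(p-1) the equation becomes
  v'' + a v' - (L + e^(2t)) v + v^p = 0, and p > p_S makes the damping a positive. The energy
  En = y^2/2 + v^(p+1)/(p+1) - (L + e^(2t)) v^2/2 is decreasing and bounds solutions of nonpositive
  energy for all times; as t -> -infinity the equation is a perturbation of an autonomous one whose
  rest point (A, 0), the minimum of the energy, attracts. The distance of two solutions
  that stay near (A, 0) on [t0, T] contracts by a factor exp (- c (T - t0)). Hence the solutions
  that start at (A, 0) at time -n converge as n -> infinity, which gives the singular solution. A
  regular solution u(., gamma) has zero energy at t = -infinity, has lost a fixed amount of it at a
  time of order - ln gamma, and by a strict Lyapunov function comes near (A, 0) a bounded time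
  later; the same contraction then gives the convergence as gamma -> infinity.

  For the oscillation, Riccati's equation for the logarithmic derivative of |u - 1| blows up in
  finite time if u - 1 keeps its sign; the only other possibility, a decreasing u < 1, makes s^N u
  bounded, which contradicts the lower bound on u that comes from the negative energy.
*)
theory Submission
  imports Defs
begin

text \<open>The sign of the energy does double duty. A point with v = 0 has energy y^2 / 2 >= 0, so
  negative energy keeps v positive; it also keeps v below the bound \<open>Vmax t\<close>.
  Positivity and global existence therefore come from one invariant. The term e^(2t) v is negligible
  only for very negative t, so closeness to (A, 0) can be controlled only up to some fixed T <= 0;
  from T to any later time an ordinary Gronwall estimate is enough, because T and the final time are
  fixed while the starting time tends to -infinity. Two solutions that stay near A up to T forget
  their starting values at a rate independent of those values. This one estimate
  (\<open>comparison\<close>) serves both for the Cauchy property of the approximations and for the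
  limit of large initial values. At s = 0 the initial value problem provides a one-sided derivative
  but no continuity of u', so bounds on u' near 0 are obtained along points supplied by the mean
  value theorem.\<close>

text \<open>Picard's operator is a contraction for the sup norm weighted by \<open>exp (- W t)\<close>.\<close>

lemma weighted_picard:
  fixes f :: "real \<Rightarrow> 'a::euclidean_space \<Rightarrow> 'a"
  assumes cont: "\<And>x. continuous_on {t0..} x \<Longrightarrow> continuous_on {t0..} (\<lambda>t. f t (x t))"
    and lip: "\<And>t x y. t0 \<le> t \<Longrightarrow> norm (f t x - f t y) \<le> K t * norm (x - y)"
    and zero: "\<And>t. t0 \<le> t \<Longrightarrow> f t 0 = 0"
    and K0: "\<And>t. t0 \<le> t \<Longrightarrow> 0 \<le> K t"
    and W: "\<And>t. t0 \<le> t \<Longrightarrow> (W has_real_derivative 2 * K t) (at t)"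
  obtains x where "x t0 = x0" "continuous_on {t0..} x"
    "\<And>t. t0 < t \<Longrightarrow> (x has_vector_derivative f t (x t)) (at t)"
proof -
  have Wc: "continuous_on {t0..} W"
    using W by (meson DERIV_isCont atLeast_iff continuous_at_imp_continuous_on)
  have Wmono: "W t0 \<le> W t" if "t0 \<le> t" for t
    by (rule DERIV_nonneg_imp_nondecreasing[OF that]) (use W K0 in fastforce)
  \<comment> \<open>The factor 2 in W' = 2 K is what makes this integral half of D * exp (W t), up
    to a nonpositive constant when D >= 0; it is the source of the contraction factor 1/2.\<close>
  have expW: "((\<lambda>\<tau>. K \<tau> * exp (W \<tau>) * D) has_integral (D / 2 * exp (W t) - D / 2 * exp (W t0))) {t0..t}"
    if "t0 \<le> t" for t D
    by (rule fundamental_theorem_of_calculus[OF that])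
      (auto intro!: derivative_eq_intros has_field_derivative_at_within[OF W]
        simp: has_real_derivative_iff_has_vector_derivative[symmetric])
  \<comment> \<open>The unknown is rescaled as x = exp W * w, with w in the complete space of
    bounded continuous functions.\<close>
  define h where "h w \<tau> = f \<tau> (exp (W \<tau>) *\<^sub>R apply_bcontfun w \<tau>)" for w :: "real \<Rightarrow>\<^sub>C 'a" and \<tau>
  have hc: "continuous_on {t0..} (h w)" for w
    unfolding h_def by (intro cont continuous_intros Wc) auto
  have hi: "h w integrable_on {t0..t}" for w t
    by (rule integrable_continuous_real) (rule continuous_on_subset[OF hc], auto)
  have hder: "((\<lambda>t. integral {t0..t} (h w)) has_vector_derivative h w t) (at t within {t0..})"
    if "t0 \<le> t" for w t
  proof -
    have "((\<lambda>t. integral {t0..t} (h w)) has_vector_derivative h w t) (at t within {t0..t+1})"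
      by (rule integral_has_vector_derivative) (use that in \<open>auto intro: continuous_on_subset[OF hc]\<close>)
    moreover have "at t within {t0..t+1} = at t within {t0..}"
      by (rule at_within_nhd[of t "{..<t+1}"]) auto
    ultimately show ?thesis by simp
  qed
  define J where "J w t = x0 + integral {t0..t} (h w)" for w t
  have Jder: "(J w has_vector_derivative h w t) (at t within {t0..})" if "t0 \<le> t" for w t
    unfolding J_def using hder[OF that, of w] by (auto intro!: derivative_eq_intros)
  have Jc: "continuous_on {t0..} (J w)" for w
    using Jder by (auto simp: continuous_on_eq_continuous_within intro: has_vector_derivative_continuous)
  have Jdiff: "norm (J w t - J w' t) \<le> D / 2 * exp (W t)"
    if t: "t0 \<le> t" and D: "\<And>\<tau>. norm (apply_bcontfun w \<tau> - apply_bcontfun w' \<tau>) \<le> D" for w w' t D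
  proof -
    have D0: "0 \<le> D" using D[of 0] norm_ge_zero order_trans by blast
    have "norm (h w \<tau> - h w' \<tau>) \<le> K \<tau> * exp (W \<tau>) * D" if "\<tau> \<in> {t0..t}" for \<tau>
    proof -
      have "norm (h w \<tau> - h w' \<tau>)
          \<le> K \<tau> * norm (exp (W \<tau>) *\<^sub>R (apply_bcontfun w \<tau> - apply_bcontfun w' \<tau>))"
        unfolding h_def scaleR_diff_right using lip that by auto
      also have "\<dots> = K \<tau> * exp (W \<tau>) * norm (apply_bcontfun w \<tau> - apply_bcontfun w' \<tau>)" by simp
      also have "\<dots> \<le> K \<tau> * exp (W \<tau>) * D"
        using D K0 that by (intro mult_left_mono) auto
      finally show ?thesis .
    qed
    then have "norm (integral {t0..t} (\<lambda>\<tau>. h w \<tau> - h w' \<tau>))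
        \<le> integral {t0..t} (\<lambda>\<tau>. K \<tau> * exp (W \<tau>) * D)"
      using expW[OF t] hi by (intro integral_norm_bound_integral integrable_diff) auto
    also have "\<dots> = D / 2 * exp (W t) - D / 2 * exp (W t0)"
      using expW[OF t] by (rule integral_unique)
    also have "\<dots> \<le> D / 2 * exp (W t)" using D0 by simp
    also have "integral {t0..t} (\<lambda>\<tau>. h w \<tau> - h w' \<tau>) = J w t - J w' t"
      unfolding J_def using hi by (simp add: integral_diff)
    finally show ?thesis .
  qed
  \<comment> \<open>Functions in \<open>bcontfun\<close> live on the whole line;
    \<open>max t0 t\<close> extends the image by its value at \<open>t0\<close> to the left of
    \<open>t0\<close>.\<close>
  define \<Phi> where "\<Phi> w t = exp (- W (max t0 t)) *\<^sub>R J w (max t0 t)" for w t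
  have \<Phi>diff: "norm (\<Phi> w t - \<Phi> w' t) \<le> D / 2"
    if "\<And>\<tau>. norm (apply_bcontfun w \<tau> - apply_bcontfun w' \<tau>) \<le> D" for w w' t D
  proof -
    have "norm (\<Phi> w t - \<Phi> w' t) = exp (- W (max t0 t)) * norm (J w (max t0 t) - J w' (max t0 t))"
      unfolding \<Phi>_def by (simp flip: scaleR_diff_right)
    also have "\<dots> \<le> exp (- W (max t0 t)) * (D / 2 * exp (W (max t0 t)))"
      using Jdiff[OF _ that] by (intro mult_left_mono) auto
    also have "\<dots> = D / 2" by (simp add: exp_minus field_simps)
    finally show ?thesis .
  qed
  have \<Phi>0: "norm (\<Phi> 0 t) \<le> exp (- W t0) * norm x0" for t
  proof -
    have "h 0 \<tau> = 0" if "\<tau> \<in> {t0..max t0 t}" for \<tau>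
      unfolding h_def using zero that by simp
    then have "integral {t0..max t0 t} (h 0) = integral {t0..max t0 t} (\<lambda>_. 0)"
      by (rule integral_cong)
    then show ?thesis
      unfolding \<Phi>_def J_def using Wmono[of "max t0 t"] by (simp add: mult_right_mono)
  qed
  have \<Phi>mem: "\<Phi> w \<in> bcontfun" for w
  proof (rule bcontfun_normI)
    have "continuous_on UNIV (\<lambda>t. W (max t0 t))" "continuous_on UNIV (\<lambda>t. J w (max t0 t))"
      by (rule continuous_on_compose2[OF Wc] continuous_on_compose2[OF Jc],
          auto intro!: continuous_intros)+
    then show "continuous_on UNIV (\<Phi> w)"
      unfolding \<Phi>_def by (intro continuous_intros)
    fix t
    have "norm (\<Phi> w t - \<Phi> 0 t) \<le> norm w / 2"
      by (rule \<Phi>diff) (use norm_bounded[of w] in auto)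
    then show "norm (\<Phi> w t) \<le> norm w / 2 + exp (- W t0) * norm x0"
      using \<Phi>0[of t] norm_triangle_sub[of "\<Phi> w t" "\<Phi> 0 t"] by linarith
  qed
  have "\<exists>!w. Bcontfun (\<Phi> w) = w"
  proof (rule banach_fix_type[of "1/2"])
    show "\<forall>w w'. dist (Bcontfun (\<Phi> w)) (Bcontfun (\<Phi> w')) \<le> 1/2 * dist w w'"
    proof (intro allI dist_bound)
      fix w w' :: "real \<Rightarrow>\<^sub>C 'a" and t
      have "norm (\<Phi> w t - \<Phi> w' t) \<le> dist w w' / 2"
        by (rule \<Phi>diff) (use dist_bounded[of w _ w'] in \<open>simp add: dist_norm\<close>)
      then show "dist (apply_bcontfun (Bcontfun (\<Phi> w)) t) (apply_bcontfun (Bcontfun (\<Phi> w')) t)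
          \<le> 1/2 * dist w w'"
        by (simp add: Bcontfun_inverse \<Phi>mem dist_norm)
    qed
  qed auto
  then obtain w where w: "Bcontfun (\<Phi> w) = w" by blast
  then have "apply_bcontfun w = \<Phi> w" by (metis Bcontfun_inverse \<Phi>mem)
  then have wJ: "exp (W t) *\<^sub>R apply_bcontfun w t = J w t" if "t0 \<le> t" for t
    using that by (simp add: \<Phi>_def max_absorb2 flip: exp_add)
  show thesis
  proof
    show "J w t0 = x0" by (simp add: J_def)
    show "continuous_on {t0..} (J w)" by (rule Jc)
    fix t assume t: "t0 < t"
    then have "h w t = f t (J w t)" unfolding h_def using wJ[of t] by simp
    then show "(J w has_vector_derivative f t (J w t)) (at t)"
      using Jder[of t w] t at_within_nhd[of t "{t0<..}" "{t0..}" UNIV]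
      by (fastforce simp: set_eq_iff)
  qed
qed

section \<open>Powers, differential inequalities and other tools from analysis\<close>

lemma powr_comp_deriv:
  fixes v :: "real \<Rightarrow> real"
  assumes "(v has_real_derivative y) (at t)" "0 < v t"
  shows "((\<lambda>t. v t powr r) has_real_derivative r * v t powr (r - 1) * y) (at t)"
  using DERIV_chain2[OF has_real_derivative_powr[OF assms(2)] assms(1)] .

text \<open>The bound must include the endpoint 0, because the truncated variable in the existence
  proof may vanish; the mean value theorem needs differentiability only inside the interval.\<close>

lemma powr_diff_bound:
  fixes x y :: real
  assumes p: "1 < p" and xy: "0 \<le> x" "x \<le> R" "0 \<le> y" "y \<le> R"
  shows "\<bar>x powr p - y powr p\<bar> \<le> p * R powr (p - 1) * \<bar>x - y\<bar>"
proof -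
  have *: "\<bar>y powr p - x powr p\<bar> \<le> p * R powr (p - 1) * \<bar>y - x\<bar>"
    if "0 \<le> x" "x < y" "y \<le> R" for x y :: real
  proof -
    have "continuous_on {x..y} (\<lambda>z. z powr p)"
      using that p by (intro continuous_on_powr' continuous_intros) auto
    moreover have "((\<lambda>z. z powr p) has_derivative (\<lambda>h. h * (p * z powr (p - 1)))) (at z)"
      if "x < z" for z
      using has_real_derivative_powr[of z p] \<open>0 \<le> x\<close> that
      unfolding has_field_derivative_def by (simp add: mult.commute[of _ "p * z powr (p - 1)"])
    ultimately obtain z where z: "x < z" "z < y" "y powr p - x powr p = (y - x) * (p * z powr (p - 1))"
      using mvt[OF \<open>x < y\<close>, of "\<lambda>z. z powr p" "\<lambda>z h. h * (p * z powr (p - 1))"] by auto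
    have "z powr (p - 1) \<le> R powr (p - 1)"
      using z that p by (intro powr_mono2) auto
    then show ?thesis
      using z p \<open>0 \<le> x\<close> by (simp add: abs_mult mult.commute mult_mono)
  qed
  consider "x < y" | "y < x" | "x = y" by linarith
  then show ?thesis
    using *[of x y] *[of y x] xy by cases (auto simp: abs_minus_commute)
qed

text \<open>The intermediate point is given in closed form bounds so that v = w is allowed; it lies
  near A whenever both v and w do.\<close>

lemma powr_mean_value:
  fixes v w :: real
  assumes "0 < v" "0 < w"
  obtains \<xi> where "min v w \<le> \<xi>" "\<xi> \<le> max v w" "v powr p - w powr p = p * \<xi> powr (p - 1) * (v - w)"
proof -
  have *: "\<exists>\<xi>. x \<le> \<xi> \<and> \<xi> \<le> y \<and> y powr p - x powr p = p * \<xi> powr (p - 1) * (y - x)"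
    if xy: "0 < x" "x < y" for x y :: real
  proof -
    obtain z where "x < z" "z < y" "y powr p - x powr p = (y - x) * (p * z powr (p - 1))"
      using MVT2[OF xy(2), of "\<lambda>z. z powr p" "\<lambda>z. p * z powr (p - 1)"]
        has_real_derivative_powr[of _ p] xy(1) by (metis order_less_le_trans)
    then show ?thesis by (intro exI[of _ z]) (auto simp: mult_ac)
  qed
  consider "v < w" | "w < v" | "v = w" by linarith
  then show thesis
  proof cases
    case 1
    with *[OF assms(1)] obtain \<xi> where \<xi>: "v \<le> \<xi>" "\<xi> \<le> w"
      "w powr p - v powr p = p * \<xi> powr (p - 1) * (w - v)" by blast
    then have "v powr p - w powr p = p * \<xi> powr (p - 1) * (v - w)" by (simp add: algebra_simps)
    with 1 \<xi> show thesis by (intro that[of \<xi>]) auto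
  next
    case 2
    with *[OF assms(2)] obtain \<xi> where "w \<le> \<xi>" "\<xi> \<le> v"
      "v powr p - w powr p = p * \<xi> powr (p - 1) * (v - w)" by blast
    with 2 show thesis by (intro that[of \<xi>]) auto
  qed (use that[of v] in auto)
qed

text \<open>The function exp (- k t) * Q t is nonincreasing. The rate k may have either sign:
  negative for the contraction, positive for continuous dependence.\<close>

lemma differential_gronwall:
  fixes Q :: "real \<Rightarrow> real"
  assumes "t0 \<le> t1" "continuous_on {t0..t1} Q"
    and der: "\<And>t. t0 < t \<Longrightarrow> t < t1 \<Longrightarrow> \<exists>D. (Q has_real_derivative D) (at t) \<and> D \<le> k * Q t"
  shows "Q t1 \<le> exp (k * (t1 - t0)) * Q t0"
proof -
  have "exp (- k * t1) * Q t1 \<le> exp (- k * t0) * Q t0"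
  proof (rule DERIV_nonpos_imp_decreasing_open[OF assms(1)])
    show "continuous_on {t0..t1} (\<lambda>t. exp (- k * t) * Q t)"
      by (intro continuous_intros assms)
    fix t assume "t0 < t" "t < t1"
    then obtain D where D: "(Q has_real_derivative D) (at t)" "D \<le> k * Q t" using der by blast
    have "((\<lambda>t. exp (- k * t) * Q t) has_real_derivative exp (- k * t) * (D - k * Q t)) (at t)"
      using D(1) by (auto intro!: derivative_eq_intros simp: algebra_simps)
    moreover have "exp (- k * t) * (D - k * Q t) \<le> 0"
      using D(2) by (simp add: mult_nonneg_nonpos)
    ultimately show "\<exists>y. ((\<lambda>t. exp (- k * t) * Q t) has_real_derivative y) (at t) \<and> y \<le> 0"
      by blast
  qed
  then have "exp (k * t1) * (exp (- k * t1) * Q t1) \<le> exp (k * t1) * (exp (- k * t0) * Q t0)"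
    by (intro mult_left_mono) auto
  then show ?thesis by (simp add: right_diff_distrib exp_diff exp_minus field_simps)
qed

text \<open>The cross term \<open>\<epsilon> * d * e\<close> makes the energy of the damped oscillator decrease strictly.\<close>

lemma oscillator_decay:
  fixes a \<kappa> \<epsilon> \<mu> d e r :: real
  assumes a: "0 < a" and \<kappa>: "0 < \<kappa>" and \<epsilon>: "0 < \<epsilon>" "\<epsilon> \<le> a / 4" "\<epsilon> * a \<le> \<kappa> / 4"
    and \<mu>: "0 \<le> \<mu>" "\<mu> \<le> \<kappa> / 8" "\<mu>\<^sup>2 \<le> a * \<epsilon> * \<kappa> / 8"
    and r: "\<bar>r\<bar> \<le> \<mu> * \<bar>d\<bar>"
  shows "e * (- a * e - \<kappa> * d + r) + \<kappa> * d * e + \<epsilon> * e\<^sup>2 + \<epsilon> * d * (- a * e - \<kappa> * d + r)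
    \<le> - (a / 4) * e\<^sup>2 - (\<epsilon> * \<kappa> / 2) * d\<^sup>2"
proof -
  \<comment> \<open>Two of the cross terms are split by this inequality at a cost of a/4 * e^2 each,
    and \<epsilon> * e^2 costs another a/4, so a/4 of the damping survives. The d^2 parts consume at
    most half of \<epsilon> * \<kappa> * d^2.\<close>
  have amgm: "x * z \<le> a / 4 * z\<^sup>2 + x\<^sup>2 / a" for x z :: real
  proof -
    have "0 \<le> (a * z / 2 - x)\<^sup>2 / a" using a by simp
    also have "(a * z / 2 - x)\<^sup>2 / a = a / 4 * z\<^sup>2 + x\<^sup>2 / a - x * z"
      using a by (simp add: field_simps power2_eq_square)
    finally show ?thesis by simp
  qed
  have "- (\<epsilon> * a * d) * e \<le> a / 4 * e\<^sup>2 + (- (\<epsilon> * a * d))\<^sup>2 / a" by (rule amgm)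
  also have "(- (\<epsilon> * a * d))\<^sup>2 / a = \<epsilon> * (\<epsilon> * a) * d\<^sup>2"
    using a by (simp add: field_simps power2_eq_square)
  also have "\<dots> \<le> \<epsilon> * (\<kappa> / 4) * d\<^sup>2" using \<epsilon> by (intro mult_right_mono mult_left_mono) auto
  finally have 1: "- (\<epsilon> * a * d) * e \<le> a / 4 * e\<^sup>2 + \<epsilon> * \<kappa> / 4 * d\<^sup>2" by simp
  have r2: "r\<^sup>2 \<le> a * \<epsilon> * \<kappa> / 8 * d\<^sup>2"
  proof -
    have "r\<^sup>2 \<le> (\<mu> * \<bar>d\<bar>)\<^sup>2" using r by (metis abs_ge_zero power2_abs power_mono)
    also have "\<dots> = \<mu>\<^sup>2 * d\<^sup>2" by (simp add: power_mult_distrib)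
    also have "\<dots> \<le> a * \<epsilon> * \<kappa> / 8 * d\<^sup>2" using \<mu> by (intro mult_right_mono) auto
    finally show ?thesis .
  qed
  have "r * e \<le> a / 4 * e\<^sup>2 + r\<^sup>2 / a" by (rule amgm)
  also have "r\<^sup>2 / a \<le> \<epsilon> * \<kappa> / 8 * d\<^sup>2" using r2 a by (simp add: field_simps)
  finally have 2: "r * e \<le> a / 4 * e\<^sup>2 + \<epsilon> * \<kappa> / 8 * d\<^sup>2" by simp
  have "r * d \<le> \<bar>r\<bar> * \<bar>d\<bar>" by (metis abs_ge_self abs_mult)
  also have "\<dots> \<le> \<mu> * \<bar>d\<bar> * \<bar>d\<bar>" using r by (intro mult_right_mono) auto
  also have "\<dots> \<le> \<kappa> / 8 * \<bar>d\<bar> * \<bar>d\<bar>" using \<mu> by (intro mult_right_mono) auto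
  finally have "\<epsilon> * (r * d) \<le> \<epsilon> * (\<kappa> / 8 * d\<^sup>2)"
    using \<epsilon> by (intro mult_left_mono) (auto simp: power2_eq_square mult.assoc)
  moreover have "\<epsilon> * e\<^sup>2 \<le> a / 4 * e\<^sup>2" using \<epsilon> by (intro mult_right_mono) auto
  ultimately show ?thesis using 1 2 by (simp add: algebra_simps power2_eq_square)
qed

text \<open>The energy with cross term is equivalent to d^2 + e^2; completing the square,
  \<epsilon>^2 <= \<kappa>/4 keeps the quadratic form positive definite.\<close>

lemma oscillator_energy_bounds:
  fixes \<kappa> \<epsilon> d e :: real
  assumes \<kappa>: "0 < \<kappa>" and \<epsilon>: "0 < \<epsilon>" "\<epsilon> \<le> 1" "\<epsilon>\<^sup>2 \<le> \<kappa> / 4"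
  shows "e\<^sup>2 / 2 + \<kappa> * d\<^sup>2 / 2 + \<epsilon> * d * e \<le> (1 + \<kappa>) * (d\<^sup>2 + e\<^sup>2)"
    and "min 1 \<kappa> / 4 * (d\<^sup>2 + e\<^sup>2) \<le> e\<^sup>2 / 2 + \<kappa> * d\<^sup>2 / 2 + \<epsilon> * d * e"
proof -
  have gen: "x \<le> (D + E) / 2 \<Longrightarrow> 0 \<le> \<kappa> * D \<Longrightarrow> 0 \<le> \<kappa> * E \<Longrightarrow> 0 \<le> D \<Longrightarrow> 0 \<le> E \<Longrightarrow>
      E / 2 + \<kappa> * D / 2 + x \<le> (1 + \<kappa>) * (D + E)" for x D E :: real
    by (simp add: algebra_simps)
  have "0 \<le> (d - e)\<^sup>2" by simp
  then have "d * e \<le> (d\<^sup>2 + e\<^sup>2) / 2" by (simp add: power2_diff)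
  then have "\<epsilon> * (d * e) \<le> \<epsilon> * ((d\<^sup>2 + e\<^sup>2) / 2)" using \<epsilon> by (intro mult_left_mono) auto
  also have "\<dots> \<le> 1 * ((d\<^sup>2 + e\<^sup>2) / 2)" using \<epsilon> by (intro mult_right_mono) auto
  finally have "\<epsilon> * d * e \<le> (d\<^sup>2 + e\<^sup>2) / 2" by (simp add: mult.assoc)
  moreover have "0 \<le> \<kappa> * d\<^sup>2" "0 \<le> \<kappa> * e\<^sup>2" using \<kappa> by auto
  ultimately show "e\<^sup>2 / 2 + \<kappa> * d\<^sup>2 / 2 + \<epsilon> * d * e \<le> (1 + \<kappa>) * (d\<^sup>2 + e\<^sup>2)"
    using gen[of "\<epsilon> * d * e" "d\<^sup>2" "e\<^sup>2"] by simp
  have "0 \<le> (e / 2 + \<epsilon> * d)\<^sup>2" by simp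
  then have 1: "0 \<le> e\<^sup>2 / 4 + \<epsilon>\<^sup>2 * d\<^sup>2 + \<epsilon> * d * e" by (simp add: power2_eq_square algebra_simps)
  have 2: "\<epsilon>\<^sup>2 * d\<^sup>2 \<le> \<kappa> / 4 * d\<^sup>2" using \<epsilon> by (intro mult_right_mono) auto
  have 3: "min 1 \<kappa> * d\<^sup>2 \<le> \<kappa> * d\<^sup>2" "min 1 \<kappa> * e\<^sup>2 \<le> 1 * e\<^sup>2" by (intro mult_right_mono; simp)+
  show "min 1 \<kappa> / 4 * (d\<^sup>2 + e\<^sup>2) \<le> e\<^sup>2 / 2 + \<kappa> * d\<^sup>2 / 2 + \<epsilon> * d * e"
    using 1 2 3 by (simp add: distrib_left)
qed

text \<open>The n-th approximate solution exists only from time -n on, hence differentiability is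
  assumed only for n >= n0; the proof shifts the sequence by n0.\<close>

lemma deriv_uniform_limit:
  fixes f :: "nat \<Rightarrow> real \<Rightarrow> real"
  assumes t: "t \<in> {\<alpha><..<\<beta>}"
    and der: "\<And>n x. n0 \<le> n \<Longrightarrow> x \<in> {\<alpha><..<\<beta>} \<Longrightarrow> (f n has_real_derivative f' n x) (at x)"
    and unif: "uniform_limit {\<alpha><..<\<beta>} f' g' sequentially"
    and lim: "\<And>x. x \<in> {\<alpha><..<\<beta>} \<Longrightarrow> (\<lambda>n. f n x) \<longlonglongrightarrow> g x"
  shows "(g has_real_derivative g' t) (at t)"
proof -
  let ?S = "{\<alpha><..<\<beta>}"
  have "\<exists>h. \<forall>x\<in>?S. (\<lambda>n. f (n + n0) x) \<longlonglongrightarrow> h x \<and> (h has_derivative (*) (g' x)) (at x within ?S)"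
  proof (rule has_derivative_sequence[where f' = "\<lambda>n x. (*) (f' (n + n0) x)"])
    show "(f (n + n0) has_derivative (*) (f' (n + n0) x)) (at x within ?S)" if "x \<in> ?S" for n x
      using der[of "n + n0" x] that by (auto simp: has_field_derivative_def intro: has_derivative_at_withinI)
    show "\<forall>\<^sub>F n in sequentially. \<forall>x\<in>?S. \<forall>h. norm (f' (n + n0) x * h - g' x * h) \<le> e * norm (h :: real)"
      if "0 < e" for e
    proof -
      have "\<forall>\<^sub>F n in sequentially. \<forall>x\<in>?S. dist (f' (n + n0) x) (g' x) < e"
        using uniform_limitD[OF unif that] by (subst (asm) eventually_sequentially_seg[symmetric, of _ n0])
      then show ?thesis
      proof eventually_elim
        case (elim n)
        show ?case
        proof (intro ballI allI)
          fix x h :: real assume "x \<in> ?S"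
          then have "norm (f' (n + n0) x - g' x) * norm h \<le> e * norm h"
            using elim by (intro mult_right_mono) (auto simp: dist_norm less_imp_le)
          then show "norm (f' (n + n0) x * h - g' x * h) \<le> e * norm h"
            by (simp add: abs_mult flip: left_diff_distrib)
        qed
      qed
    qed
    show "(\<lambda>n. f (n + n0) t) \<longlonglongrightarrow> g t" using lim[OF t] by (rule LIMSEQ_ignore_initial_segment)
  qed (use t in auto)
  then obtain h where h: "\<And>x. x \<in> ?S \<Longrightarrow> (\<lambda>n. f (n + n0) x) \<longlonglongrightarrow> h x"
    "\<And>x. x \<in> ?S \<Longrightarrow> (h has_derivative (*) (g' x)) (at x within ?S)" by blast
  have "h x = g x" if "x \<in> ?S" for x
    using h(1)[OF that] LIMSEQ_ignore_initial_segment[OF lim[OF that]] by (rule LIMSEQ_unique)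
  moreover have "(h has_real_derivative g' t) (at t)"
    using h(2)[OF t] unfolding has_field_derivative_def at_within_open[OF t open_greaterThanLessThan] .
  ultimately show ?thesis
    using has_field_derivative_transform_within_open[OF _ open_greaterThanLessThan t] by blast
qed

text \<open>The quotient q = - z'/z solves q' = Q + q^2 - (k/s) q. For large s this is at least m (1
  + q^2), so arctan q grows at rate m, and over a length pi/m it would leave (-pi/2, pi/2).\<close>

lemma riccati_blowup:
  fixes z z' Q :: "real \<Rightarrow> real" and k c :: real
  assumes z: "\<And>s. T < s \<Longrightarrow> 0 < z s" "\<And>s. T < s \<Longrightarrow> (z has_real_derivative z' s) (at s)"
    "\<And>s. T < s \<Longrightarrow> (z' has_real_derivative - (k / s) * z' s - Q s * z s) (at s)"
    and Q: "\<And>s. T < s \<Longrightarrow> c \<le> Q s" and c: "0 < c"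
  shows False
proof -
  define q where "q s = - z' s / z s" for s
  define m where "m = min c 1 / 2"
  have m: "0 < m" using c by (simp add: m_def)
  \<comment> \<open>Beyond S, (k/s)^2 <= min c 1. The term (k/s) q then costs at most q^2 / 2 + min
    c 1 / 2, and the halves left over give m = min c 1 / 2.\<close>
  define S where "S = max (max T 0 + 1) (\<bar>k\<bar> / sqrt (min c 1))"
  have S: "T < S" "0 < S" by (auto simp: S_def)
  have der: "(q has_real_derivative Q s + (q s)\<^sup>2 - k / s * q s) (at s)" if "T < s" for s
  proof -
    have "(q has_real_derivative ((- (- (k / s) * z' s - Q s * z s)) * z s - (- z' s) * z' s) / (z s * z s)) (at s)"
      unfolding q_def using z(1)[OF that]
      by (intro DERIV_divide DERIV_minus z(2,3)[OF that]) auto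
    then show ?thesis
      by (rule DERIV_cong) (use z(1)[OF that] in \<open>simp add: q_def field_simps power2_eq_square\<close>)
  qed
  have ineq: "m * (1 + (q s)\<^sup>2) \<le> Q s + (q s)\<^sup>2 - k / s * q s" if s: "S \<le> s" for s
  proof -
    have s0: "0 < s" "T < s" using S s by auto
    define r where "r = k / s"
    have "\<bar>k\<bar> / sqrt (min c 1) \<le> s" using s by (simp add: S_def)
    then have "\<bar>k\<bar> \<le> sqrt (min c 1) * s" using c by (simp add: field_simps)
    then have "\<bar>r\<bar> \<le> sqrt (min c 1)" using s0 by (simp add: r_def field_simps)
    then have "r\<^sup>2 \<le> min c 1" using c
      by (metis abs_ge_zero power2_abs power_mono real_sqrt_pow2 min_def less_imp_le zero_le_one)
    moreover have "0 \<le> (q s - r)\<^sup>2" by simp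
    then have "r * q s \<le> (q s)\<^sup>2 / 2 + r\<^sup>2 / 2" by (simp add: power2_diff mult_ac)
    moreover have "min c 1 * (q s)\<^sup>2 \<le> 1 * (q s)\<^sup>2" by (intro mult_right_mono) auto
    moreover have "m * (1 + (q s)\<^sup>2) = min c 1 / 2 + min c 1 * (q s)\<^sup>2 / 2"
      by (simp add: m_def distrib_left)
    moreover have "min c 1 \<le> Q s" using Q[OF s0(2)] by simp
    ultimately have "m * (1 + (q s)\<^sup>2) \<le> Q s + (q s)\<^sup>2 - r * q s" by linarith
    then show ?thesis by (simp only: r_def)
  qed
  define s1 where "s1 = S + pi / m"
  have "arctan (q S) - m * S \<le> arctan (q s1) - m * s1"
  proof (rule DERIV_nonneg_imp_nondecreasing[of S s1 "\<lambda>s. arctan (q s) - m * s"])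
    show "S \<le> s1" using m pi_ge_zero by (simp add: s1_def)
    fix s assume "S \<le> s" "s \<le> s1"
    then have s: "S \<le> s" "T < s" using S by auto
    have "((\<lambda>s. arctan (q s) - m * s) has_real_derivative
        inverse (1 + (q s)\<^sup>2) * (Q s + (q s)\<^sup>2 - k / s * q s) - m * 1) (at s)"
      by (intro DERIV_diff DERIV_chain2[OF DERIV_arctan der[OF s(2)]] DERIV_cmult DERIV_ident)
    moreover have "0 \<le> inverse (1 + (q s)\<^sup>2) * (Q s + (q s)\<^sup>2 - k / s * q s) - m * 1"
    proof -
      have pos: "0 < 1 + (q s)\<^sup>2" by (simp add: add_pos_nonneg)
      have "m = inverse (1 + (q s)\<^sup>2) * (m * (1 + (q s)\<^sup>2))" using pos by simp
      also have "\<dots> \<le> inverse (1 + (q s)\<^sup>2) * (Q s + (q s)\<^sup>2 - k / s * q s)"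
        using ineq[OF s(1)] pos by (intro mult_left_mono) auto
      finally show ?thesis by simp
    qed
    ultimately show "\<exists>y. ((\<lambda>s. arctan (q s) - m * s) has_real_derivative y) (at s) \<and> 0 \<le> y" by blast
  qed
  moreover have "m * s1 = m * S + pi" using m by (simp add: s1_def distrib_left)
  ultimately have "arctan (q S) + pi \<le> arctan (q s1)" by linarith
  then show False using arctan_lbound[of "q S"] arctan_ubound[of "q s1"] by linarith
qed

text \<open>Finiteness below every bound gives each real number a next element of Z. Iterating from
  0 reaches every element, since a finite initial piece cannot contain infinitely many
  iterates.\<close>

lemma enumerate_discrete:
  fixes Z :: "real set"
  assumes pos: "\<And>z. z \<in> Z \<Longrightarrow> 0 < z" and fin: "\<And>b. finite (Z \<inter> {..b})"
    and unb: "\<And>T. \<exists>z\<in>Z. T < z"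
  shows "\<exists>sc :: nat \<Rightarrow> real. strict_mono sc \<and> sc 0 > 0 \<and> filterlim sc at_top sequentially \<and> Z = range sc"
proof -
  have "\<exists>n. n \<in> Z \<and> T < n \<and> (\<forall>z\<in>Z. T < z \<longrightarrow> n \<le> z)" for T
  proof -
    obtain s where s: "s \<in> Z" "T < s" using unb by blast
    let ?F = "Z \<inter> {T<..s}"
    have fF: "finite ?F" by (rule finite_subset[OF _ fin[of s]]) auto
    have "Min ?F \<in> ?F" using s fF by (intro Min_in) auto
    moreover have "Min ?F \<le> z" if "z \<in> Z" "T < z" for z
    proof (cases "z \<le> s")
      case True
      then show ?thesis using that fF by (intro Min_le) auto
    next
      case False
      moreover have "Min ?F \<le> s" using s fF by (intro Min_le) auto
      ultimately show ?thesis by linarith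
    qed
    ultimately show ?thesis by (intro exI[of _ "Min ?F"]) auto
  qed
  then obtain nxt where nxt: "\<And>T. nxt T \<in> Z" "\<And>T. T < nxt T" "\<And>T z. z \<in> Z \<Longrightarrow> T < z \<Longrightarrow> nxt T \<le> z"
    by metis
  \<comment> \<open>The exponent is \<open>Suc n\<close> because the starting point 0 is not in
    Z.\<close>
  define sc where "sc n = (nxt ^^ Suc n) 0" for n
  have sc: "sc 0 = nxt 0" "\<And>n. sc (Suc n) = nxt (sc n)" by (simp_all add: sc_def)
  have mono: "strict_mono sc" using nxt(2) by (intro strict_monoI_Suc) (simp add: sc(2))
  have mem: "sc n \<in> Z" for n using nxt(1) by (cases n) (simp_all add: sc)
  have large: "\<exists>n. b < sc n" for b
  proof (rule ccontr)
    assume "\<not> ?thesis"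
    then have "range sc \<subseteq> Z \<inter> {..b}" using mem by (auto simp: not_less)
    then have "finite (range sc)" using fin finite_subset by blast
    then show False using strict_mono_imp_inj_on[OF mono] finite_imageD by blast
  qed
  have "filterlim sc at_top sequentially"
    unfolding filterlim_at_top
  proof
    fix b
    obtain n where n: "b < sc n" using large by blast
    show "\<forall>\<^sub>F n in sequentially. b \<le> sc n"
      using eventually_ge_at_top[of n]
    proof eventually_elim
      case (elim k)
      then have "sc n \<le> sc k" using mono by (simp add: strict_mono_less_eq)
      then show ?case using n by simp
    qed
  qed
  moreover have "Z = range sc"
  proof
    show "Z \<subseteq> range sc"
    proof
      fix z assume z: "z \<in> Z"
      define n where "n = (LEAST n. z \<le> sc n)"
      obtain n' where "z < sc n'" using large by blast
      then have n: "z \<le> sc n" unfolding n_def using LeastI[of "\<lambda>n. z \<le> sc n" n'] by simp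
      have "sc n \<le> z"
      proof (cases n)
        case 0
        then show ?thesis using nxt(3)[OF z, of 0] pos[OF z] sc by simp
      next
        case (Suc k)
        have "\<not> z \<le> sc k" using not_less_Least[of k "\<lambda>n. z \<le> sc n"] Suc by (simp add: n_def)
        then show ?thesis using nxt(3)[OF z, of "sc k"] Suc sc by simp
      qed
      then show "z \<in> range sc" using n by (metis antisym rangeI)
    qed
  qed (use mem in auto)
  ultimately show ?thesis using mono pos[OF mem[of 0]] by blast
qed

locale supercritical =
  fixes N :: nat and p :: real
  assumes N3: "N \<ge> 3" and p_super: "p > (real N + 2) / (real N - 2)"
begin

subsection \<open>The Emden--Fowler equation\<close>

text \<open>The exponent for which u'' and u^p scale alike: s^(- \<theta>) times a constant can
  solve u'' + (N-1)/s u' + u^p = 0. The constant is \<open>A\<close> below, and \<open>a\<close> and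
  \<open>L\<close> are the coefficients of damping and of the linear term after the change of
  variables.\<close>

definition \<theta> :: real where "\<theta> = 2 / (p - 1)"
definition a :: real where "a = real N - 2 - 2 * \<theta>"
definition L :: real where "L = \<theta> * (real N - 2 - \<theta>)"
definition A :: real where "A = L powr (1 / (p - 1))"

lemma p1: "1 < p"
proof -
  have "1 < (real N + 2) / (real N - 2)" using N3 by (simp add: field_simps)
  then show ?thesis using p_super by linarith
qed

lemma \<theta>_pos: "0 < \<theta>" using p1 by (simp add: \<theta>_def)

text \<open>Given N >= 3 and p > 1, a > 0 says 4 < (p - 1)(N - 2), which is p > p_S
  rearranged.\<close>

lemma a_pos: "0 < a"
proof -
  have "real N + 2 < p * (real N - 2)" using p_super N3 by (simp add: pos_divide_less_eq)
  then have "4 < (p - 1) * (real N - 2)" by (simp add: algebra_simps)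
  then have "4 / (p - 1) < real N - 2" using p1 by (simp add: field_simps)
  then show ?thesis by (simp add: a_def \<theta>_def)
qed

lemma L_pos: "0 < L"
  using a_pos \<theta>_pos by (auto simp: L_def a_def intro!: mult_pos_pos)

lemma A_pos: "0 < A" using L_pos by (simp add: A_def)

lemma A_powr: "A powr (p - 1) = L"
  using p1 L_pos by (simp add: A_def powr_powr)

text \<open>The Emden--Fowler variables \<open>v = s powr \<theta> * u s\<close>, \<open>t = ln s\<close>, \<open>y = dv/dt\<close>.\<close>

definition ef_rhs :: "real \<Rightarrow> real \<Rightarrow> real \<Rightarrow> real" where
  "ef_rhs t v y = - a * y + (L + exp (2 * t)) * v - v powr p"

text \<open>Solutions live on a closed half-line, so that they may start at \<open>t0\<close> with
  prescribed values; at \<open>t0\<close> itself only continuity is demanded.\<close>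

definition ef_sol :: "real \<Rightarrow> (real \<Rightarrow> real) \<Rightarrow> (real \<Rightarrow> real) \<Rightarrow> bool" where
  "ef_sol t0 v y \<longleftrightarrow> continuous_on {t0..} v \<and> continuous_on {t0..} y \<and>
     (\<forall>t\<ge>t0. 0 < v t) \<and>
     (\<forall>t>t0. (v has_real_derivative y t) (at t) \<and>
             (y has_real_derivative ef_rhs t (v t) (y t)) (at t))"

text \<open>The primitive of v^p - L v vanishing at 0: a well with its bottom at
  \<open>A\<close>.\<close>

definition pot :: "real \<Rightarrow> real" where
  "pot v = v powr (p + 1) / (p + 1) - L * v\<^sup>2 / 2"

definition En :: "real \<Rightarrow> real \<Rightarrow> real \<Rightarrow> real" where
  "En t v y = y\<^sup>2 / 2 + pot v - exp (2 * t) * v\<^sup>2 / 2"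

text \<open>The positive zero of v -> \<open>En t v 0\<close>.\<close>

definition Vmax :: "real \<Rightarrow> real" where
  "Vmax t = ((p + 1) / 2 * (L + exp (2 * t))) powr (1 / (p - 1))"

lemma powr_plus1: "0 \<le> v \<Longrightarrow> v powr (p + 1) = v powr (p - 1) * v\<^sup>2"
  using powr_add[of v "p - 1" 2] by (cases "v = 0") (auto simp: powr_numeral add.commute)

lemma powr_p: "0 \<le> v \<Longrightarrow> v powr p = v powr (p - 1) * v"
  using powr_add[of v "p - 1" 1] by (cases "v = 0") (auto simp: add.commute)

lemma pot_eq: "0 \<le> v \<Longrightarrow> pot v = v\<^sup>2 * (v powr (p - 1) / (p + 1) - L / 2)"
  by (simp only: pot_def powr_plus1) (simp add: algebra_simps)

lemma L_exp_pos: "0 < L + exp (2 * t)"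
  using L_pos exp_gt_zero[of "2 * t"] by linarith

lemma Vmax_pos: "0 < Vmax t"
  using p1 L_exp_pos[of t] by (auto simp: Vmax_def)

lemma Vmax_powr: "Vmax t powr (p - 1) = (p + 1) / 2 * (L + exp (2 * t))"
  using p1 L_exp_pos[of t] by (auto simp: Vmax_def powr_powr intro!: mult_pos_pos)

lemma Vmax_mono: "t \<le> t' \<Longrightarrow> Vmax t \<le> Vmax t'"
  unfolding Vmax_def using p1 L_pos
  by (intro powr_mono2 mult_left_mono add_left_mono) (auto intro!: add_nonneg_nonneg)

lemma En_eq: "0 \<le> v \<Longrightarrow> En t v y = y\<^sup>2 / 2 + v\<^sup>2 * (v powr (p - 1) - (p + 1) / 2 * (L + exp (2 * t))) / (p + 1)"
  using p1 by (simp add: En_def pot_eq field_simps)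

lemma En_bounds:
  assumes "0 < v" "En t v y \<le> 0"
  shows "v \<le> Vmax t" "y\<^sup>2 \<le> (L + exp (2 * t)) * v\<^sup>2"
proof -
  have "v\<^sup>2 * (v powr (p - 1) - (p + 1) / 2 * (L + exp (2 * t))) / (p + 1) \<le> 0"
    using assms En_eq[of v t y] zero_le_power2[of y] by linarith
  then have "v powr (p - 1) \<le> Vmax t powr (p - 1)"
    using assms p1 by (auto simp: Vmax_powr divide_le_0_iff mult_le_0_iff)
  then show "v \<le> Vmax t"
    using p1 Vmax_pos[of t] by (meson not_le powr_less_mono2 diff_gt_0_iff_gt order_less_imp_le)
  have "0 \<le> v powr (p + 1) / (p + 1)" using p1 by simp
  then show "y\<^sup>2 \<le> (L + exp (2 * t)) * v\<^sup>2"
    using assms(2) unfolding En_def pot_def by (simp add: algebra_simps)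
qed

lemma En_neg_less_Vmax:
  assumes "0 < v" "En t v y < 0"
  shows "v < Vmax t"
proof (rule ccontr)
  assume "\<not> v < Vmax t"
  then have "v = Vmax t" using En_bounds[of v t y] assms by auto
  then show False using assms(2) En_eq[of v t y] assms(1) Vmax_powr[of t] zero_le_power2[of y] by simp
qed

lemma powr_plus1_deriv:
  assumes "(v has_real_derivative y) (at t)" "0 < v t"
  shows "((\<lambda>t. v t powr (p + 1) / (p + 1)) has_real_derivative v t powr p * y) (at t)"
  using DERIV_cdivide[OF powr_comp_deriv[OF assms, of "p + 1"], of "p + 1"] p1 by simp

text \<open>Both losses are nonpositive: damping contributes - a y^2, and the growth of e^(2t) in
  the energy contributes - e^(2t) v^2.\<close>

lemma ef_En_deriv:
  assumes "0 < v t" "(v has_real_derivative y t) (at t)"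
    "(y has_real_derivative ef_rhs t (v t) (y t)) (at t)"
  shows "((\<lambda>t. En t (v t) (y t)) has_real_derivative - a * (y t)\<^sup>2 - exp (2 * t) * (v t)\<^sup>2) (at t)"
proof -
  have "((\<lambda>t. (y t)\<^sup>2 / 2) has_real_derivative y t * ef_rhs t (v t) (y t)) (at t)"
    "((\<lambda>t. L * (v t)\<^sup>2 / 2) has_real_derivative L * v t * y t) (at t)"
    "((\<lambda>t. exp (2 * t) * (v t)\<^sup>2 / 2) has_real_derivative
       exp (2 * t) * (v t)\<^sup>2 + exp (2 * t) * v t * y t) (at t)"
    using assms by (auto intro!: derivative_eq_intros)
  from DERIV_diff[OF DERIV_add[OF this(1) DERIV_diff[OF powr_plus1_deriv[OF assms(2,1)] this(2)]] this(3)]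
  show ?thesis
    unfolding En_def pot_def
    by (rule DERIV_cong) (simp add: ef_rhs_def algebra_simps power2_eq_square)
qed

text \<open>At the endpoints v need only be nonnegative, because this is applied up to a first exit
  time at which v might vanish.\<close>

lemma En_antimono:
  assumes "t1 \<le> t2" "continuous_on {t1..t2} v" "continuous_on {t1..t2} y"
    and nonneg: "\<And>t. t1 \<le> t \<Longrightarrow> t \<le> t2 \<Longrightarrow> 0 \<le> v t"
    and der: "\<And>t. t1 < t \<Longrightarrow> t < t2 \<Longrightarrow> 0 < v t \<and> (v has_real_derivative y t) (at t) \<and>
       (y has_real_derivative ef_rhs t (v t) (y t)) (at t)"
  shows "En t2 (v t2) (y t2) \<le> En t1 (v t1) (y t1)"
proof (rule DERIV_nonpos_imp_decreasing_open[OF assms(1)])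
  show "continuous_on {t1..t2} (\<lambda>t. En t (v t) (y t))"
    unfolding En_def pot_def using assms p1 by (intro continuous_intros continuous_on_powr') auto
  fix t assume t: "t1 < t" "t < t2"
  have "((\<lambda>t. En t (v t) (y t)) has_real_derivative - a * (y t)\<^sup>2 - exp (2 * t) * (v t)\<^sup>2) (at t)"
    using der[OF t] by (intro ef_En_deriv) auto
  moreover have "- a * (y t)\<^sup>2 - exp (2 * t) * (v t)\<^sup>2 \<le> 0"
  proof -
    have "0 \<le> a * (y t)\<^sup>2" "0 \<le> exp (2 * t) * (v t)\<^sup>2" using a_pos by simp_all
    then show ?thesis by linarith
  qed
  ultimately show "\<exists>z. ((\<lambda>t. En t (v t) (y t)) has_real_derivative z) (at t) \<and> z \<le> 0"
    by blast
qed

lemma ef_sol_pos: "ef_sol t0 v y \<Longrightarrow> t0 \<le> t \<Longrightarrow> 0 < v t"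
  by (simp add: ef_sol_def)

lemma ef_sol_En_antimono:
  assumes "ef_sol t0 v y" "t0 \<le> t1" "t1 \<le> t2"
  shows "En t2 (v t2) (y t2) \<le> En t1 (v t1) (y t1)"
  using assms by (intro En_antimono)
    (auto simp: ef_sol_def intro: continuous_on_subset less_imp_le)

text \<open>Clipping \<open>v\<close> to \<open>[0, Vmax t]\<close> makes the equation Lipschitz; negative energy keeps the solution
  strictly inside that range, where nothing was changed.\<close>

lemma ef_sol_exists:
  assumes v0: "0 < v0" and E0: "En t0 v0 y0 < 0"
  obtains v y where "ef_sol t0 v y" "v t0 = v0" "y t0 = y0"
proof -
  define clip where "clip t v = min (max v 0) (Vmax t)" for t v
  define f where "f t x = (snd x, - a * snd x + (L + exp (2 * t)) * fst x - clip t (fst x) powr p)"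
    for t :: real and x :: "real \<times> real"
  \<comment> \<open>By the choice of \<open>Vmax\<close>, v^p on [0, Vmax t] has Lipschitz constant
    p (p + 1)/2 * (L + e^(2t)); the summand 1 in \<open>c\<close> covers the linear term.
    \<open>W\<close> is a primitive of 2 K.\<close>
  define c where "c = 1 + p * (p + 1) / 2"
  define K where "K t = 1 + a + c * (L + exp (2 * t))" for t
  define W where "W t = 2 * (1 + a + c * L) * t + c * exp (2 * t)" for t
  have clip: "0 \<le> clip t v" "clip t v \<le> Vmax t" "\<bar>clip t v - clip t w\<bar> \<le> \<bar>v - w\<bar>" for t v w
    using Vmax_pos[of t] by (auto simp: clip_def min_def max_def)
  have c0: "0 < c" using p1 by (auto simp: c_def intro!: add_pos_pos)
  obtain x where x: "x t0 = (v0, y0)" "continuous_on {t0..} x"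
    "\<And>t. t0 < t \<Longrightarrow> (x has_vector_derivative f t (x t)) (at t)"
  proof (rule weighted_picard[of t0 f K W "(v0, y0)"])
    show "continuous_on {t0..} (\<lambda>t. f t (x t))" if "continuous_on {t0..} x" for x
    proof -
      have "continuous_on {t0..} Vmax"
        unfolding Vmax_def using p1 L_pos by (intro continuous_intros continuous_on_powr') (auto intro!: add_nonneg_nonneg)
      then have "continuous_on {t0..} (\<lambda>t. clip t (fst (x t)))"
        unfolding clip_def using that by (intro continuous_intros)
      then have "continuous_on {t0..} (\<lambda>t. clip t (fst (x t)) powr p)"
        using clip p1 by (intro continuous_on_powr') auto
      moreover have "continuous_on {t0..} (\<lambda>t. snd (x t))"
          "continuous_on {t0..} (\<lambda>t. - a * snd (x t) + (L + exp (2 * t)) * fst (x t))"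
        using that by (auto intro!: continuous_intros)
      ultimately show ?thesis
        unfolding f_def by (intro continuous_on_Pair continuous_on_diff)
    qed
    show "norm (f t x - f t y) \<le> K t * norm (x - y)" for t x y
    proof -
      define d where "d = x - y"
      have d: "\<bar>fst d\<bar> \<le> norm d" "\<bar>snd d\<bar> \<le> norm d"
        using norm_fst_le[of "fst d" "snd d"] norm_snd_le[of "snd d" "fst d"] by auto
      let ?q = "clip t (fst x) powr p - clip t (fst y) powr p"
      have "\<bar>?q\<bar> \<le> p * Vmax t powr (p - 1) * \<bar>clip t (fst x) - clip t (fst y)\<bar>"
        using clip p1 by (intro powr_diff_bound) auto
      also have "\<dots> \<le> p * Vmax t powr (p - 1) * \<bar>fst x - fst y\<bar>"
        using clip p1 by (intro mult_left_mono) auto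
      also have "\<dots> = p * (p + 1) / 2 * (L + exp (2 * t)) * \<bar>fst d\<bar>"
        by (simp add: Vmax_powr d_def)
      finally have q: "\<bar>?q\<bar> \<le> p * (p + 1) / 2 * (L + exp (2 * t)) * \<bar>fst d\<bar>" .
      have "f t x - f t y = (snd d, - a * snd d + (L + exp (2 * t)) * fst d - ?q)"
        by (simp add: f_def d_def algebra_simps)
      then have "norm (f t x - f t y) \<le> \<bar>snd d\<bar> + \<bar>- a * snd d + (L + exp (2 * t)) * fst d - ?q\<bar>"
        using norm_Pair_le[of "snd d" "- a * snd d + (L + exp (2 * t)) * fst d - ?q"] by simp
      also have "\<dots> \<le> \<bar>snd d\<bar> + (a * \<bar>snd d\<bar> + (L + exp (2 * t)) * \<bar>fst d\<bar> + \<bar>?q\<bar>)"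
      proof -
        have "\<bar>- a * snd d\<bar> = a * \<bar>snd d\<bar>" "\<bar>(L + exp (2 * t)) * fst d\<bar> = (L + exp (2 * t)) * \<bar>fst d\<bar>"
          using a_pos L_pos exp_gt_zero[of "2 * t"] by (auto simp: abs_mult)
        then show ?thesis by linarith
      qed
      also have "\<dots> \<le> (1 + a) * \<bar>snd d\<bar> + c * (L + exp (2 * t)) * \<bar>fst d\<bar>"
        using q by (simp add: c_def algebra_simps)
      also have "\<dots> \<le> (1 + a) * norm d + c * (L + exp (2 * t)) * norm d"
        using d a_pos c0 L_pos exp_gt_zero[of "2 * t"] by (intro add_mono mult_left_mono) auto
      finally show ?thesis by (simp add: K_def d_def algebra_simps)
    qed
    show "f t 0 = 0" for t
      using Vmax_pos[of t] by (simp add: f_def clip_def zero_prod_def)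
    show "0 \<le> K t" for t
      using a_pos c0 L_pos exp_gt_zero[of "2 * t"] by (simp add: K_def)
    show "(W has_real_derivative 2 * K t) (at t)" for t
      unfolding W_def K_def by (auto intro!: derivative_eq_intros simp: algebra_simps)
  qed auto
  define v where "v t = fst (x t)" for t
  define y where "y t = snd (x t)" for t
  have vc: "continuous_on {t0..} v" and yc: "continuous_on {t0..} y"
    unfolding v_def y_def using x(2) by (auto intro: continuous_intros)
  have der: "(v has_real_derivative y t) (at t)"
      "(y has_real_derivative - a * y t + (L + exp (2 * t)) * v t - clip t (v t) powr p) (at t)"
    if "t0 < t" for t
  proof -
    have "(x has_vector_derivative f t (x t)) (at t)" using x(3) that .
    then have "(v has_vector_derivative fst (f t (x t))) (at t)"
        "(y has_vector_derivative snd (f t (x t))) (at t)"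
      unfolding v_def y_def has_vector_derivative_def
      by (auto intro!: derivative_eq_intros)
    then show "(v has_real_derivative y t) (at t)"
      "(y has_real_derivative - a * y t + (L + exp (2 * t)) * v t - clip t (v t) powr p) (at t)"
      by (auto simp: has_real_derivative_iff_has_vector_derivative f_def v_def y_def)
  qed
  have Vc: "continuous_on {t0..} (\<lambda>t. Vmax t - v t)"
    unfolding Vmax_def using p1 L_pos
    by (intro continuous_intros continuous_on_powr' vc) (auto intro!: add_nonneg_nonneg)
  have inside: "0 < v t \<and> v t < Vmax t" if "t0 \<le> t" for t
  proof (rule ccontr)
    assume out: "\<not> (0 < v t \<and> v t < Vmax t)"
    \<comment> \<open>The times at which the open range is left. Before the infimum T the truncation
      is inactive, so the true equation holds and the energy at T is still negative.\<close>
    define S where "S = ({t0..} \<inter> v -` {..0}) \<union> ({t0..} \<inter> (\<lambda>\<tau>. Vmax \<tau> - v \<tau>) -` {..0})"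
    have "closed S"
      unfolding S_def
      by (intro closed_Un continuous_closed_preimage vc Vc) auto
    moreover have "t \<in> S" using out that by (auto simp: S_def)
    moreover have bdd: "bdd_below S" by (auto simp: S_def intro!: bdd_belowI[of _ t0])
    ultimately have "Inf S \<in> S" using closed_contains_Inf by blast
    define T where "T = Inf S"
    with \<open>Inf S \<in> S\<close> have T: "T \<in> S" by simp
    then have "t0 \<le> T" by (auto simp: S_def)
    have v0': "v t0 = v0" "y t0 = y0" using x(1) by (auto simp: v_def y_def)
    have "v0 < Vmax t0" using En_neg_less_Vmax assms by blast
    then have "t0 \<notin> S" using v0 v0' by (auto simp: S_def)
    then have T0: "t0 < T" using T \<open>t0 \<le> T\<close> by (cases "T = t0") auto
    have before: "0 < v \<tau> \<and> v \<tau> < Vmax \<tau>" if "t0 \<le> \<tau>" "\<tau> < T" for \<tau>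
    proof (rule ccontr)
      assume "\<not> ?thesis"
      then have "\<tau> \<in> S" using that by (auto simp: S_def)
      then show False using cInf_lower[OF _ bdd] that by (fastforce simp: T_def)
    qed
    have vT: "0 \<le> v T"
    proof (rule tendsto_lowerbound)
      show "(v \<longlongrightarrow> v T) (at_left T)"
        using der(1)[OF T0] by (meson DERIV_isCont continuous_within filterlim_at_split)
      show "\<forall>\<^sub>F \<tau> in at_left T. 0 \<le> v \<tau>"
        using eventually_at_left_real[OF T0] by eventually_elim (use before in \<open>auto simp: less_imp_le\<close>)
    qed auto
    have "En T (v T) (y T) \<le> En t0 (v t0) (y t0)"
    proof (rule En_antimono)
      show "0 \<le> v \<tau>" if "t0 \<le> \<tau>" "\<tau> \<le> T" for \<tau>
        using before[of \<tau>] that vT by (cases "\<tau> = T") auto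
      show "0 < v \<tau> \<and> (v has_real_derivative y \<tau>) (at \<tau>) \<and>
         (y has_real_derivative ef_rhs \<tau> (v \<tau>) (y \<tau>)) (at \<tau>)" if "t0 < \<tau>" "\<tau> < T" for \<tau>
      proof -
        have "clip \<tau> (v \<tau>) = v \<tau>" using before[of \<tau>] that by (auto simp: clip_def)
        then show ?thesis using der[OF that(1)] before[of \<tau>] that by (auto simp: ef_rhs_def)
      qed
    qed (use T0 in \<open>auto intro: continuous_on_subset[OF vc] continuous_on_subset[OF yc]\<close>)
    then have ET: "En T (v T) (y T) < 0" using E0 v0' by simp
    \<comment> \<open>At v = 0 the energy is y^2 / 2, which is not negative; the other exit, through
      \<open>Vmax T\<close>, is excluded by \<open>En_neg_less_Vmax\<close>.\<close>
    have "v T \<noteq> 0"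
    proof
      assume "v T = 0"
      then have "En T (v T) (y T) = (y T)\<^sup>2 / 2" by (simp add: En_def pot_def)
      with ET show False by simp
    qed
    then have "0 < v T" using vT by simp
    then show False using En_neg_less_Vmax[OF _ ET] T by (auto simp: S_def)
  qed
  have "ef_sol t0 v y"
    unfolding ef_sol_def
  proof (intro conjI allI impI vc yc)
    fix t assume t: "t0 < t"
    have "clip t (v t) = v t" using inside[of t] t by (auto simp: clip_def)
    then show "(v has_real_derivative y t) (at t)" "(y has_real_derivative ef_rhs t (v t) (y t)) (at t)"
      using der[OF t] by (auto simp: ef_rhs_def)
  qed (use inside in auto)
  then show thesis using that x(1) by (auto simp: v_def y_def)
qed

subsection \<open>Contraction towards the rest point\<close>

lemma ef_sol_mono: "ef_sol t0 v y \<Longrightarrow> t0 \<le> t1 \<Longrightarrow> ef_sol t1 v y"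
  by (auto simp: ef_sol_def intro: continuous_on_subset)

lemma pot_deriv:
  assumes "0 < v"
  shows "(pot has_real_derivative v powr p - L * v) (at v)"
  unfolding pot_def using powr_plus1_deriv[of "\<lambda>v. v" 1 v] assms p1
  by (auto intro!: derivative_eq_intros)

lemma pot_cont: "continuous_on {0..} pot"
  unfolding pot_def using p1 by (intro continuous_intros continuous_on_powr') auto

lemma powr_A_less: "A < v \<Longrightarrow> L * v < v powr p"
  using powr_less_mono2[of "p - 1" A v] p1 A_pos by (simp add: A_powr powr_p)

lemma powr_less_A: "0 < v \<Longrightarrow> v < A \<Longrightarrow> v powr p < L * v"
  using powr_less_mono2[of "p - 1" v A] p1 by (simp add: A_powr powr_p)

lemma pot_increasing:
  assumes "A \<le> v" "v < w" shows "pot v < pot w"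
proof (rule DERIV_pos_imp_increasing_open[OF assms(2)])
  fix x assume "v < x" "x < w"
  then show "\<exists>z. (pot has_real_derivative z) (at x) \<and> z > 0"
    using pot_deriv[of x] powr_A_less[of x] assms A_pos by (intro exI[of _ "x powr p - L * x"]) auto
qed (use assms A_pos in \<open>auto intro: continuous_on_subset[OF pot_cont]\<close>)

lemma pot_decreasing:
  assumes "0 \<le> v" "v < w" "w \<le> A" shows "pot w < pot v"
proof (rule DERIV_neg_imp_decreasing_open[OF assms(2)])
  fix x assume "v < x" "x < w"
  then show "\<exists>z. (pot has_real_derivative z) (at x) \<and> z < 0"
    using pot_deriv[of x] powr_less_A[of x] assms by (intro exI[of _ "x powr p - L * x"]) auto
qed (use assms in \<open>auto intro: continuous_on_subset[OF pot_cont]\<close>)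

lemma pot_A_neg: "pot A < 0"
  using pot_decreasing[of 0 A] A_pos by (simp add: pot_def)

text \<open>\<open>pot\<close> decreases before \<open>A\<close> and increases after it, so its
  values at A - \<rho> and A + \<rho> fix the admissible depth.\<close>

lemma pot_well:
  assumes "0 < \<rho>" "\<rho> < A"
  obtains \<delta> where "0 < \<delta>" "\<And>v. 0 \<le> v \<Longrightarrow> pot v < pot A + \<delta> \<Longrightarrow> \<bar>v - A\<bar> < \<rho>"
proof
  define \<delta> where "\<delta> = min (pot (A - \<rho>) - pot A) (pot (A + \<rho>) - pot A)"
  show "0 < \<delta>" using assms pot_decreasing[of "A - \<rho>" A] pot_increasing[of A "A + \<rho>"]
    by (auto simp: \<delta>_def)
  fix v assume v: "0 \<le> v" "pot v < pot A + \<delta>"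
  have "\<not> A + \<rho> \<le> v" using v assms pot_increasing[of "A + \<rho>" v] by (cases "v = A + \<rho>") (auto simp: \<delta>_def)
  moreover have "\<not> v \<le> A - \<rho>" using v assms pot_decreasing[of v "A - \<rho>"] by (cases "v = A - \<rho>") (auto simp: \<delta>_def)
  ultimately show "\<bar>v - A\<bar> < \<rho>" by auto
qed

text \<open>Without the e^(2t) term the energy need not decrease, but it can gain at most the size
  of that term, and v is bounded by \<open>Vmax\<close>.\<close>

lemma pot_growth:
  assumes "ef_sol t0 v y" "En t0 (v t0) (y t0) \<le> 0" "t0 \<le> t"
  shows "(y t)\<^sup>2 / 2 + pot (v t) \<le> (y t0)\<^sup>2 / 2 + pot (v t0) + exp (2 * t) * (Vmax t)\<^sup>2 / 2"
proof -
  have 1: "En t (v t) (y t) \<le> En t0 (v t0) (y t0)" using ef_sol_En_antimono assms by blast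
  have "0 < v t" "v t \<le> Vmax t" using ef_sol_pos En_bounds(1)[of "v t" t "y t"] 1 assms by force+
  then have "exp (2 * t) * (v t)\<^sup>2 \<le> exp (2 * t) * (Vmax t)\<^sup>2"
    by (intro mult_left_mono power_mono) auto
  moreover have "0 \<le> exp (2 * t0) * (v t0)\<^sup>2" by simp
  ultimately show ?thesis using 1 unfolding En_def by linarith
qed

lemma exp_small:
  fixes m :: real
  assumes "0 < m"
  obtains T where "T \<le> 0" "\<And>t. t \<le> T \<Longrightarrow> exp (2 * t) \<le> m"
proof
  show "min 0 (ln m / 2) \<le> 0" by simp
  fix t assume "t \<le> min 0 (ln m / 2)"
  then have "exp (2 * t) \<le> exp (ln m)" by (subst exp_le_cancel_iff) auto
  then show "exp (2 * t) \<le> m" using assms by simp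
qed

text \<open>\<delta> and T are independent of the starting time and of the solution; this uniformity
  lets the starting time tend to -infinity.\<close>

lemma trapping:
  assumes "0 < \<rho>" "\<rho> < A"
  obtains \<delta> T where "0 < \<delta>" "T \<le> 0"
    "\<And>t0 v y t. ef_sol t0 v y \<Longrightarrow> En t0 (v t0) (y t0) \<le> 0 \<Longrightarrow>
       (y t0)\<^sup>2 / 2 + pot (v t0) < pot A + \<delta> \<Longrightarrow> t0 \<le> t \<Longrightarrow> t \<le> T \<Longrightarrow> \<bar>v t - A\<bar> < \<rho>"
proof -
  obtain \<delta> where \<delta>: "0 < \<delta>" "\<And>v. 0 \<le> v \<Longrightarrow> pot v < pot A + \<delta> \<Longrightarrow> \<bar>v - A\<bar> < \<rho>"
    using pot_well assms by blast
  have m: "0 < \<delta> / (Vmax 0)\<^sup>2" using \<delta> Vmax_pos[of 0] by simp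
  obtain T where T: "T \<le> 0" "\<And>t. t \<le> T \<Longrightarrow> exp (2 * t) \<le> \<delta> / (Vmax 0)\<^sup>2"
    using exp_small[OF m] by blast
  show thesis
  \<comment> \<open>Half of the depth \<delta> is left for the initial energy, the other half for
    the growth from \<open>pot_growth\<close>.\<close>
  proof (rule that[of "\<delta> / 2" T])
    fix t0 v y t
    assume *: "ef_sol t0 v y" "En t0 (v t0) (y t0) \<le> 0" "(y t0)\<^sup>2 / 2 + pot (v t0) < pot A + \<delta> / 2"
      "t0 \<le> t" "t \<le> T"
    have "exp (2 * t) * (Vmax t)\<^sup>2 \<le> \<delta> / (Vmax 0)\<^sup>2 * (Vmax 0)\<^sup>2"
      using T * Vmax_mono[of t 0] Vmax_pos[of t] \<delta>(1) by (intro mult_mono power_mono) auto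
    also have "\<dots> = \<delta>" using Vmax_pos[of 0] by simp
    finally have "pot (v t) < pot A + \<delta>"
      using pot_growth[OF *(1,2,4)] *(3) zero_le_power2[of "y t"] by linarith
    then show "\<bar>v t - A\<bar> < \<rho>" using \<delta>(2) ef_sol_pos[OF *(1,4)] by simp
  qed (use \<delta> T in auto)
qed

section \<open>Distance of two solutions in the phase plane\<close>

definition gap :: "(real \<Rightarrow> real) \<Rightarrow> (real \<Rightarrow> real) \<Rightarrow> (real \<Rightarrow> real) \<Rightarrow> (real \<Rightarrow> real) \<Rightarrow> real \<Rightarrow> real"
  where "gap v y w z t = (v t - w t)\<^sup>2 + (y t - z t)\<^sup>2"

lemma gap_nonneg: "0 \<le> gap v y w z t" by (simp add: gap_def)

text \<open>The difference d of two solutions near A satisfies a damped oscillator equation with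
  stiffness \<kappa> and a remainder r. The remainder is at most \<mu> |d| when both are close to A
  and e^(2t) is small, so the oscillator energy decays exponentially.\<close>

lemma contraction:
  obtains \<rho> T c K where "0 < \<rho>" "\<rho> < A" "0 < c" "0 < K"
    "\<And>t0 t v y w z. ef_sol t0 v y \<Longrightarrow> ef_sol t0 w z \<Longrightarrow> t0 \<le> t \<Longrightarrow> t \<le> T \<Longrightarrow>
       (\<And>\<tau>. t0 \<le> \<tau> \<Longrightarrow> \<tau> \<le> t \<Longrightarrow> \<bar>v \<tau> - A\<bar> < \<rho>) \<Longrightarrow>
       (\<And>\<tau>. t0 \<le> \<tau> \<Longrightarrow> \<tau> \<le> t \<Longrightarrow> \<bar>w \<tau> - A\<bar> < \<rho>) \<Longrightarrow>
       gap v y w z t \<le> K * exp (- c * (t - t0)) * gap v y w z t0"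
proof -
  define \<kappa> where "\<kappa> = (p - 1) * L"
  \<comment> \<open>(p - 1) L is the derivative of v^p - L v at A, because A^(p-1) = L.\<close>
  have \<kappa>: "0 < \<kappa>" using p1 L_pos by (simp add: \<kappa>_def)
  \<comment> \<open>The entries are the upper bounds on \<epsilon> demanded by
    \<open>oscillator_decay\<close> and \<open>oscillator_energy_bounds\<close>.\<close>
  define \<epsilon> where "\<epsilon> = Min {1, a / 4, \<kappa> / (4 * a), sqrt \<kappa> / 2}"
  have \<epsilon>: "0 < \<epsilon>" "\<epsilon> \<le> 1" "\<epsilon> \<le> a / 4" "\<epsilon> \<le> \<kappa> / (4 * a)" "\<epsilon> \<le> sqrt \<kappa> / 2"
    using \<kappa> a_pos by (auto simp: \<epsilon>_def)
  have \<epsilon>a: "\<epsilon> * a \<le> \<kappa> / 4" using \<epsilon>(4) a_pos by (simp add: field_simps)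
  have \<epsilon>2: "\<epsilon>\<^sup>2 \<le> \<kappa> / 4"
    using power_mono[OF \<epsilon>(5), of 2] \<epsilon>(1) \<kappa> by (simp add: power_divide)
  \<comment> \<open>The largest remainder tolerated by \<open>oscillator_decay\<close>; half of it
    is granted to the variation of p x^(p-1) near A and half to e^(2t).\<close>
  define \<mu> where "\<mu> = min (\<kappa> / 8) (sqrt (a * \<epsilon> * \<kappa> / 8))"
  have \<mu>: "0 < \<mu>" "\<mu> \<le> \<kappa> / 8" "\<mu> \<le> sqrt (a * \<epsilon> * \<kappa> / 8)"
    using \<kappa> \<epsilon> a_pos by (auto simp: \<mu>_def)
  have \<mu>2: "\<mu>\<^sup>2 \<le> a * \<epsilon> * \<kappa> / 8"
    using power_mono[OF \<mu>(3), of 2] \<mu>(1) \<kappa> \<epsilon> a_pos by simp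
  have "isCont (\<lambda>x. p * x powr (p - 1)) A" using A_pos by (intro continuous_intros) auto
  then obtain \<rho>' where \<rho>': "0 < \<rho>'" "\<And>x. \<bar>x - A\<bar> < \<rho>' \<Longrightarrow> \<bar>p * x powr (p - 1) - p * L\<bar> < \<mu> / 2"
    using \<mu>(1) unfolding continuous_at_eps_delta
    by (metis A_powr dist_real_def half_gt_zero)
  define \<rho> where "\<rho> = min \<rho>' (A / 2)"
  have \<rho>: "0 < \<rho>" "\<rho> < A" "\<rho> \<le> \<rho>'" using \<rho>'(1) A_pos by (auto simp: \<rho>_def)
  obtain T where T: "T \<le> 0" "\<And>t. t \<le> T \<Longrightarrow> exp (2 * t) \<le> \<mu> / 2"
    using exp_small[of "\<mu> / 2"] \<mu>(1) by auto
  define c0 where "c0 = min (a / 4) (\<epsilon> * \<kappa> / 2)"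
  have c0: "0 < c0" using a_pos \<epsilon> \<kappa> by (simp add: c0_def)
  define c where "c = c0 / (1 + \<kappa>)"
  define b where "b = min 1 \<kappa> / 4"
  have b: "0 < b" using \<kappa> by (simp add: b_def)
  show thesis
  proof (rule that[of \<rho> c "(1 + \<kappa>) / b" T])
    fix t0 t v y w z
    assume *: "ef_sol t0 v y" "ef_sol t0 w z" "t0 \<le> t" "t \<le> T"
      and near: "\<And>\<tau>. t0 \<le> \<tau> \<Longrightarrow> \<tau> \<le> t \<Longrightarrow> \<bar>v \<tau> - A\<bar> < \<rho>"
        "\<And>\<tau>. t0 \<le> \<tau> \<Longrightarrow> \<tau> \<le> t \<Longrightarrow> \<bar>w \<tau> - A\<bar> < \<rho>"
    define d where "d \<tau> = v \<tau> - w \<tau>" for \<tau>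
    define e where "e \<tau> = y \<tau> - z \<tau>" for \<tau>
    define Q where "Q \<tau> = (e \<tau>)\<^sup>2 / 2 + \<kappa> * (d \<tau>)\<^sup>2 / 2 + \<epsilon> * d \<tau> * e \<tau>" for \<tau>
    have gap: "gap v y w z \<tau> = (d \<tau>)\<^sup>2 + (e \<tau>)\<^sup>2" for \<tau> by (simp add: gap_def d_def e_def)
    have Qub: "Q \<tau> \<le> (1 + \<kappa>) * gap v y w z \<tau>" and Qlb: "b * gap v y w z \<tau> \<le> Q \<tau>" for \<tau>
      unfolding Q_def gap b_def by (rule oscillator_energy_bounds[OF \<kappa> \<epsilon>(1,2) \<epsilon>2])+
    have "Q t \<le> exp (- c * (t - t0)) * Q t0"
    proof (rule differential_gronwall[OF *(3)])
      show "continuous_on {t0..t} Q"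
        unfolding Q_def d_def e_def using *(1,2)
        by (intro continuous_intros) (auto simp: ef_sol_def intro: continuous_on_subset)
      fix \<tau> assume \<tau>: "t0 < \<tau>" "\<tau> < t"
      have pos: "0 < v \<tau>" "0 < w \<tau>" using * \<tau> by (auto intro: ef_sol_pos)
      then obtain \<xi> where \<xi>: "min (v \<tau>) (w \<tau>) \<le> \<xi>" "\<xi> \<le> max (v \<tau>) (w \<tau>)"
        "v \<tau> powr p - w \<tau> powr p = p * \<xi> powr (p - 1) * d \<tau>"
        unfolding d_def by (rule powr_mean_value)
      have "\<bar>\<xi> - A\<bar> < \<rho>'" using \<xi> near[of \<tau>] \<tau> \<rho>(3) by (auto simp: min_def max_def split: if_splits)
      then have q: "\<bar>p * \<xi> powr (p - 1) - p * L\<bar> < \<mu> / 2" by (rule \<rho>'(2))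
      define r where "r = (exp (2 * \<tau>) - (p * \<xi> powr (p - 1) - p * L)) * d \<tau>"
      have "\<bar>exp (2 * \<tau>) - (p * \<xi> powr (p - 1) - p * L)\<bar> \<le> \<mu>"
        using q T(2)[of \<tau>] \<tau> *(4) exp_gt_zero[of "2 * \<tau>"] by linarith
      then have r: "\<bar>r\<bar> \<le> \<mu> * \<bar>d \<tau>\<bar>" unfolding r_def abs_mult by (intro mult_right_mono) auto
      have dd: "(d has_real_derivative e \<tau>) (at \<tau>)"
        unfolding d_def e_def using * \<tau> by (auto simp: ef_sol_def intro!: derivative_eq_intros)
      have "(e has_real_derivative ef_rhs \<tau> (v \<tau>) (y \<tau>) - ef_rhs \<tau> (w \<tau>) (z \<tau>)) (at \<tau>)"
        unfolding e_def using * \<tau> by (auto simp: ef_sol_def intro!: derivative_eq_intros)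
      also have "ef_rhs \<tau> (v \<tau>) (y \<tau>) - ef_rhs \<tau> (w \<tau>) (z \<tau>) = - a * e \<tau> - \<kappa> * d \<tau> + r"
        using \<xi>(3) by (simp add: ef_rhs_def r_def \<kappa>_def d_def e_def algebra_simps)
      finally have de: "(e has_real_derivative - a * e \<tau> - \<kappa> * d \<tau> + r) (at \<tau>)" .
      define D where "D = e \<tau> * (- a * e \<tau> - \<kappa> * d \<tau> + r) + \<kappa> * d \<tau> * e \<tau> + \<epsilon> * (e \<tau>)\<^sup>2
          + \<epsilon> * d \<tau> * (- a * e \<tau> - \<kappa> * d \<tau> + r)"
      have "((\<lambda>\<tau>. (e \<tau>)\<^sup>2 / 2) has_real_derivative e \<tau> * (- a * e \<tau> - \<kappa> * d \<tau> + r)) (at \<tau>)"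
        "((\<lambda>\<tau>. \<kappa> * (d \<tau>)\<^sup>2 / 2) has_real_derivative \<kappa> * d \<tau> * e \<tau>) (at \<tau>)"
        "((\<lambda>\<tau>. \<epsilon> * d \<tau> * e \<tau>) has_real_derivative
           \<epsilon> * (e \<tau>)\<^sup>2 + \<epsilon> * d \<tau> * (- a * e \<tau> - \<kappa> * d \<tau> + r)) (at \<tau>)"
        by (rule derivative_eq_intros dd de refl | simp add: power2_eq_square)+
      from DERIV_add[OF DERIV_add[OF this(1,2)] this(3)]
      have "(Q has_real_derivative D) (at \<tau>)"
        unfolding Q_def D_def by (simp add: add.assoc)
      moreover have "D \<le> - c * Q \<tau>"
      proof -
        have "D \<le> - (a / 4) * (e \<tau>)\<^sup>2 - (\<epsilon> * \<kappa> / 2) * (d \<tau>)\<^sup>2"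
          unfolding D_def by (rule oscillator_decay[OF a_pos \<kappa> \<epsilon>(1,3) \<epsilon>a _ \<mu>(2) \<mu>2 r]) (use \<mu> in auto)
        also have "\<dots> \<le> - (c0 * gap v y w z \<tau>)"
        proof -
          have "c0 * (e \<tau>)\<^sup>2 \<le> a / 4 * (e \<tau>)\<^sup>2" "c0 * (d \<tau>)\<^sup>2 \<le> \<epsilon> * \<kappa> / 2 * (d \<tau>)\<^sup>2"
            by (intro mult_right_mono; simp add: c0_def)+
          then show ?thesis by (simp add: gap distrib_left)
        qed
        also have "\<dots> \<le> - c * Q \<tau>"
        proof -
          have "c * Q \<tau> \<le> c * ((1 + \<kappa>) * gap v y w z \<tau>)"
            using Qub[of \<tau>] c0 \<kappa> by (intro mult_left_mono) (auto simp: c_def)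
          also have "\<dots> = c0 * gap v y w z \<tau>" using \<kappa> by (simp add: c_def)
          finally show ?thesis by simp
        qed
        finally show ?thesis .
      qed
      ultimately show "\<exists>D. (Q has_real_derivative D) (at \<tau>) \<and> D \<le> - c * Q \<tau>" by blast
    qed
    also have "\<dots> \<le> exp (- c * (t - t0)) * ((1 + \<kappa>) * gap v y w z t0)"
      using Qub by (intro mult_left_mono) auto
    finally have "b * gap v y w z t \<le> exp (- c * (t - t0)) * ((1 + \<kappa>) * gap v y w z t0)"
      using Qlb[of t] by linarith
    then show "gap v y w z t \<le> (1 + \<kappa>) / b * exp (- c * (t - t0)) * gap v y w z t0"
      using b by (simp add: field_simps)
  qed (use \<rho> c0 \<kappa> b in \<open>auto simp: c_def\<close>)
qed

lemma ef_rhs_diff: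
  assumes "t \<le> b" "0 < v" "v \<le> Vmax b" "0 < w" "w \<le> Vmax b"
  shows "\<bar>((L + exp (2 * t)) * v - v powr p) - ((L + exp (2 * t)) * w - w powr p)\<bar>
    \<le> (L + exp (2 * b) + p * Vmax b powr (p - 1)) * \<bar>v - w\<bar>"
proof -
  have "\<bar>v powr p - w powr p\<bar> \<le> p * Vmax b powr (p - 1) * \<bar>v - w\<bar>"
    using assms p1 by (intro powr_diff_bound) auto
  moreover have "\<bar>(L + exp (2 * t)) * (v - w)\<bar> \<le> (L + exp (2 * b)) * \<bar>v - w\<bar>"
    unfolding abs_mult using L_exp_pos[of t] assms(1) by (intro mult_right_mono) auto
  moreover have "((L + exp (2 * t)) * v - v powr p) - ((L + exp (2 * t)) * w - w powr p)
      = (L + exp (2 * t)) * (v - w) - (v powr p - w powr p)" by (simp add: algebra_simps)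
  ultimately show ?thesis unfolding distrib_right by linarith
qed

text \<open>Nonpositive energy bounds both solutions by \<open>Vmax b\<close> up to time b, hence
  one Lipschitz constant, and C depends on b alone.\<close>

lemma continuous_dependence:
  obtains C where "\<And>T t v y w z. ef_sol T v y \<Longrightarrow> ef_sol T w z \<Longrightarrow> En T (v T) (y T) \<le> 0 \<Longrightarrow>
    En T (w T) (z T) \<le> 0 \<Longrightarrow> T \<le> t \<Longrightarrow> t \<le> b \<Longrightarrow> gap v y w z t \<le> exp (C * (t - T)) * gap v y w z T"
proof -
  define M where "M = L + exp (2 * b) + p * Vmax b powr (p - 1)"
  show thesis
  proof (rule that[of "1 + M"])
    fix T t v y w z
    assume *: "ef_sol T v y" "ef_sol T w z" "En T (v T) (y T) \<le> 0" "En T (w T) (z T) \<le> 0" "T \<le> t" "t \<le> b"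
    show "gap v y w z t \<le> exp ((1 + M) * (t - T)) * gap v y w z T"
    proof (rule differential_gronwall[OF *(5)])
      show "continuous_on {T..t} (gap v y w z)"
        unfolding gap_def using *(1,2)
        by (intro continuous_intros) (auto simp: ef_sol_def intro: continuous_on_subset)
      fix \<tau> assume \<tau>: "T < \<tau>" "\<tau> < t"
      define d where "d = v \<tau> - w \<tau>"
      define e where "e = y \<tau> - z \<tau>"
      have bd: "0 < u \<tau> \<and> u \<tau> \<le> Vmax b" if "ef_sol T u x" "En T (u T) (x T) \<le> 0" for u x
      proof -
        have "En \<tau> (u \<tau>) (x \<tau>) \<le> 0" using ef_sol_En_antimono[OF that(1) order_refl, of \<tau>] that(2) \<tau> by simp
        then show ?thesis
          using ef_sol_pos[OF that(1), of \<tau>] En_bounds(1)[of "u \<tau>" \<tau> "x \<tau>"] Vmax_mono[of \<tau> b] \<tau> *(6) by auto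
      qed
      define h where "h = ((L + exp (2 * \<tau>)) * v \<tau> - v \<tau> powr p) - ((L + exp (2 * \<tau>)) * w \<tau> - w \<tau> powr p)"
      define D where "D = 2 * d * e + 2 * e * (- a * e + h)"
      have "(gap v y w z has_real_derivative 2 * d * e + 2 * e * (ef_rhs \<tau> (v \<tau>) (y \<tau>) - ef_rhs \<tau> (w \<tau>) (z \<tau>))) (at \<tau>)"
        unfolding gap_def d_def e_def using *(1,2) \<tau>
        by (auto simp: ef_sol_def algebra_simps intro!: derivative_eq_intros)
      then have "(gap v y w z has_real_derivative D) (at \<tau>)"
        by (simp add: D_def ef_rhs_def d_def e_def h_def algebra_simps)
      moreover have "D \<le> (1 + M) * gap v y w z \<tau>"
      proof -
        have "\<bar>h\<bar> \<le> M * \<bar>d\<bar>"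
          unfolding h_def M_def d_def
          using bd[OF *(1,3)] bd[OF *(2,4)] \<tau> *(6) by (intro ef_rhs_diff) auto
        then have "\<bar>e\<bar> * \<bar>h\<bar> \<le> \<bar>e\<bar> * (M * \<bar>d\<bar>)"
          by (intro mult_left_mono) auto
        moreover have "e * h \<le> \<bar>e\<bar> * \<bar>h\<bar>"
          by (metis abs_ge_self abs_mult)
        ultimately have 1: "e * h \<le> M * (\<bar>d\<bar> * \<bar>e\<bar>)" by (simp add: mult_ac)
        have 2: "d * e \<le> \<bar>d\<bar> * \<bar>e\<bar>" by (metis abs_ge_self abs_mult)
        have 3: "0 \<le> a * e\<^sup>2" using a_pos by simp
        have M0: "0 \<le> M" using L_pos p1 by (simp add: M_def)
        have "0 \<le> (\<bar>d\<bar> - \<bar>e\<bar>)\<^sup>2" by simp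
        then have 4: "2 * (\<bar>d\<bar> * \<bar>e\<bar>) \<le> d\<^sup>2 + e\<^sup>2" by (simp add: power2_diff)
        have "D = 2 * (d * e) + 2 * (e * h) - 2 * (a * e\<^sup>2)"
          by (simp add: D_def power2_eq_square algebra_simps)
        also have "\<dots> \<le> (1 + M) * (2 * (\<bar>d\<bar> * \<bar>e\<bar>))" using 1 2 3 unfolding distrib_right by linarith
        also have "\<dots> \<le> (1 + M) * (d\<^sup>2 + e\<^sup>2)" using 4 M0 by (intro mult_left_mono) auto
        finally show ?thesis by (simp add: gap_def d_def e_def)
      qed
      ultimately show "\<exists>D. (gap v y w z has_real_derivative D) (at \<tau>) \<and> D \<le> (1 + M) * gap v y w z \<tau>"
        by blast
    qed
  qed
qed

definition trapped :: "real \<Rightarrow> real \<Rightarrow> real \<Rightarrow> (real \<Rightarrow> real) \<Rightarrow> (real \<Rightarrow> real) \<Rightarrow> bool" where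
  "trapped \<rho> T t0 v y \<longleftrightarrow> ef_sol t0 v y \<and> En t0 (v t0) (y t0) \<le> 0 \<and> t0 \<le> T \<and>
     (\<forall>\<tau>\<in>{t0..T}. \<bar>v \<tau> - A\<bar> < \<rho>)"

text \<open>The contraction acts on [t0, T], continuous dependence on [T, b]. K depends on T and b
  but not on t0, so the bound tends to 0 as t0 tends to -infinity.\<close>

lemma comparison:
  obtains \<rho> T0 c where "0 < \<rho>" "\<rho> < A" "0 < c" "T0 \<le> 0"
    "\<And>T b. T \<le> T0 \<Longrightarrow> \<exists>K>0. \<forall>t0 v y w z t. trapped \<rho> T t0 v y \<longrightarrow> trapped \<rho> T t0 w z \<longrightarrow> t \<in> {T..b} \<longrightarrow>
       gap v y w z t \<le> K * exp (- c * (T - t0))"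
proof -
  obtain \<rho> T1 c K1 where \<rho>: "0 < \<rho>" "\<rho> < A" "0 < c" "0 < K1"
    and ctr: "\<And>t0 t v y w z. ef_sol t0 v y \<Longrightarrow> ef_sol t0 w z \<Longrightarrow> t0 \<le> t \<Longrightarrow> t \<le> T1 \<Longrightarrow>
       (\<And>\<tau>. t0 \<le> \<tau> \<Longrightarrow> \<tau> \<le> t \<Longrightarrow> \<bar>v \<tau> - A\<bar> < \<rho>) \<Longrightarrow>
       (\<And>\<tau>. t0 \<le> \<tau> \<Longrightarrow> \<tau> \<le> t \<Longrightarrow> \<bar>w \<tau> - A\<bar> < \<rho>) \<Longrightarrow>
       gap v y w z t \<le> K1 * exp (- c * (t - t0)) * gap v y w z t0"
    using contraction by metis
  show thesis
  proof (rule that[of \<rho> c "min 0 T1"])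
    fix T b assume T: "T \<le> min 0 T1"
    obtain C where C: "\<And>T t v y w z. ef_sol T v y \<Longrightarrow> ef_sol T w z \<Longrightarrow> En T (v T) (y T) \<le> 0 \<Longrightarrow>
      En T (w T) (z T) \<le> 0 \<Longrightarrow> T \<le> t \<Longrightarrow> t \<le> b \<Longrightarrow> gap v y w z t \<le> exp (C * (t - T)) * gap v y w z T"
      using continuous_dependence[of b] by metis
    \<comment> \<open>Bounds every initial gap: v and w lie in (0, 2A), and nonpositive energy with
      t0 <= 0 gives y^2, z^2 <= (L + 1)(2A)^2.\<close>
    define B where "B = (2 * A)\<^sup>2 + 4 * ((L + 1) * (2 * A)\<^sup>2)"
    have B: "0 < B" using A_pos L_pos by (simp add: B_def add_pos_pos)
    define K where "K = exp (\<bar>C\<bar> * (\<bar>b\<bar> + \<bar>T\<bar>)) * (K1 * B)"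
    have "gap v y w z t \<le> K * exp (- c * (T - t0))"
      if tr: "trapped \<rho> T t0 v y" "trapped \<rho> T t0 w z" and tT: "t \<in> {T..b}" for t0 v y w z t
    proof -
      have *: "ef_sol t0 v y" "ef_sol t0 w z" "En t0 (v t0) (y t0) \<le> 0" "En t0 (w t0) (z t0) \<le> 0" "t0 \<le> T"
        "\<And>\<tau>. t0 \<le> \<tau> \<Longrightarrow> \<tau> \<le> T \<Longrightarrow> \<bar>v \<tau> - A\<bar> < \<rho> \<and> \<bar>w \<tau> - A\<bar> < \<rho>" "T \<le> t" "t \<le> b"
        using tr tT by (auto simp: trapped_def)
      have small: "0 < u t0 \<and> u t0 < 2 * A \<and> (x t0)\<^sup>2 \<le> (L + 1) * (2 * A)\<^sup>2"
        if "ef_sol t0 u x" "En t0 (u t0) (x t0) \<le> 0" "\<bar>u t0 - A\<bar> < \<rho>" for u x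
      proof -
        have u: "0 < u t0" "u t0 < 2 * A" using ef_sol_pos[OF that(1)] that(3) \<rho>(2) by auto
        have "(x t0)\<^sup>2 \<le> (L + exp (2 * t0)) * (u t0)\<^sup>2" using En_bounds(2) u(1) that(2) by blast
        also have "\<dots> \<le> (L + 1) * (2 * A)\<^sup>2"
          using u L_pos *(5) T by (intro mult_mono power_mono add_left_mono) auto
        finally show ?thesis using u by blast
      qed
      have sv: "0 < v t0 \<and> v t0 < 2 * A \<and> (y t0)\<^sup>2 \<le> (L + 1) * (2 * A)\<^sup>2"
        and sw: "0 < w t0 \<and> w t0 < 2 * A \<and> (z t0)\<^sup>2 \<le> (L + 1) * (2 * A)\<^sup>2"
        using small *(1-5) *(6)[of t0] by auto
      have "(y t0 - z t0)\<^sup>2 \<le> 2 * (y t0)\<^sup>2 + 2 * (z t0)\<^sup>2"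
        using zero_le_power2[of "y t0 + z t0"] by (simp add: power2_eq_square algebra_simps)
      moreover have "(v t0 - w t0)\<^sup>2 \<le> (2 * A)\<^sup>2" using sv sw by (intro power2_le_iff_abs_le[THEN iffD2]) auto
      ultimately have g0: "gap v y w z t0 \<le> B" using sv sw unfolding gap_def B_def by linarith
      have ET: "En T (v T) (y T) \<le> 0" "En T (w T) (z T) \<le> 0"
        using ef_sol_En_antimono[OF *(1) order_refl *(5)] ef_sol_En_antimono[OF *(2) order_refl *(5)] *(3,4) by auto
      have "gap v y w z T \<le> K1 * exp (- c * (T - t0)) * gap v y w z t0"
        using * T by (intro ctr) auto
      also have "\<dots> \<le> K1 * exp (- c * (T - t0)) * B"
        using g0 \<rho>(4) by (intro mult_left_mono) auto
      finally have gT: "gap v y w z T \<le> K1 * exp (- c * (T - t0)) * B" .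
      have "gap v y w z t \<le> exp (C * (t - T)) * gap v y w z T"
        using * ET by (intro C) (auto intro: ef_sol_mono)
      also have "\<dots> \<le> exp (\<bar>C\<bar> * (\<bar>b\<bar> + \<bar>T\<bar>)) * gap v y w z T"
      proof -
        have "C * (t - T) \<le> \<bar>C\<bar> * (t - T)" using *(7) by (intro mult_right_mono) auto
        also have "\<dots> \<le> \<bar>C\<bar> * (\<bar>b\<bar> + \<bar>T\<bar>)" using *(7,8) by (intro mult_left_mono) auto
        finally show ?thesis by (intro mult_right_mono gap_nonneg) simp
      qed
      also have "\<dots> \<le> exp (\<bar>C\<bar> * (\<bar>b\<bar> + \<bar>T\<bar>)) * (K1 * exp (- c * (T - t0)) * B)"
        using gT by (intro mult_left_mono) auto
      finally show ?thesis by (simp add: K_def mult_ac)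
    qed
    moreover have "0 < K" using B \<rho>(4) by (simp add: K_def)
    ultimately show "\<exists>K>0. \<forall>t0 v y w z t. trapped \<rho> T t0 v y \<longrightarrow> trapped \<rho> T t0 w z \<longrightarrow> t \<in> {T..b} \<longrightarrow>
       gap v y w z t \<le> K * exp (- c * (T - t0))"
      by blast
  qed (use \<rho> in auto)
qed

subsection \<open>The singular solution\<close>

lemma pot_A_le: "0 \<le> v \<Longrightarrow> pot A \<le> pot v"
  using pot_increasing[of A v] pot_decreasing[of v A] by (cases "v = A"; cases "v < A") (auto simp: less_imp_le)

lemma En_A0: "En t A 0 < pot A"
  using A_pos by (simp add: En_def)

lemma approximations:
  obtains X Y where "\<And>n. ef_sol (- real n) (X n) (Y n)" "\<And>n. X n (- real n) = A" "\<And>n. Y n (- real n) = 0"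
proof -
  have "\<exists>v y. ef_sol (- real n) v y \<and> v (- real n) = A \<and> y (- real n) = 0" for n
  proof -
    have "En (- real n) A 0 < 0" using En_A0 pot_A_neg by (rule less_trans)
    from ef_sol_exists[OF A_pos this] show ?thesis by metis
  qed
  then show thesis using that by metis
qed

text \<open>For m >= n the solution started at -m is, at time -n, already trapped near A, so
  \<open>comparison\<close> with t0 = -n makes the approximations a Cauchy sequence on every [T, b].
  The energy bound \<open>pot A\<close> passes to the limit.\<close>

lemma singular_ef_sol:
  obtains v y where "\<And>t0. ef_sol t0 v y" "\<And>t. En t (v t) (y t) \<le> pot A"
proof -
  obtain X Y where XY: "\<And>n. ef_sol (- real n) (X n) (Y n)" "\<And>n. X n (- real n) = A" "\<And>n. Y n (- real n) = 0"
    using approximations by blast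
  obtain \<rho> T0 c where \<rho>: "0 < \<rho>" "\<rho> < A" "0 < c" "T0 \<le> 0" and
    cmp: "\<And>T b. T \<le> T0 \<Longrightarrow> \<exists>K>0. \<forall>t0 v y w z t. trapped \<rho> T t0 v y \<longrightarrow> trapped \<rho> T t0 w z \<longrightarrow> t \<in> {T..b} \<longrightarrow>
       gap v y w z t \<le> K * exp (- c * (T - t0))"
    by (rule comparison) blast
  obtain \<delta> T1 where \<delta>: "0 < \<delta>" "T1 \<le> 0" and
    trap: "\<And>t0 v y t. ef_sol t0 v y \<Longrightarrow> En t0 (v t0) (y t0) \<le> 0 \<Longrightarrow>
       (y t0)\<^sup>2 / 2 + pot (v t0) < pot A + \<delta> \<Longrightarrow> t0 \<le> t \<Longrightarrow> t \<le> T1 \<Longrightarrow> \<bar>v t - A\<bar> < \<rho>"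
    using trapping[OF \<rho>(1,2)] by metis
  define T2 where "T2 = min T0 T1"
  have En: "En t (X n t) (Y n t) \<le> pot A" if "- real n \<le> t" for n t
  proof -
    have "En t (X n t) (Y n t) \<le> En (- real n) (X n (- real n)) (Y n (- real n))"
      by (rule ef_sol_En_antimono[OF XY(1) order_refl that])
    also have "\<dots> \<le> pot A" using En_A0 by (simp add: XY less_imp_le)
    finally show ?thesis .
  qed
  have En0: "En t (X n t) (Y n t) \<le> 0" if "- real n \<le> t" for n t
    using En[OF that] pot_A_neg by simp
  have pos: "0 < X n t" if "- real n \<le> t" for n t using XY(1) that by (rule ef_sol_pos)
  have near: "\<bar>X n t - A\<bar> < \<rho>" if "- real n \<le> t" "t \<le> T2" for n t
    using trap[OF XY(1) En0[OF order_refl], of n t] that \<delta> by (simp add: XY T2_def)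
  have gap_small: "\<exists>M. \<forall>m\<ge>M. \<forall>n\<ge>M. \<forall>t\<in>{T..b}. gap (X m) (Y m) (X n) (Y n) t < \<epsilon>"
    if T: "T \<le> T2" and \<epsilon>: "0 < \<epsilon>" for T b \<epsilon>
  proof -
    obtain K where K: "0 < K" and cmpK: "\<And>t0 v y w z t. trapped \<rho> T t0 v y \<Longrightarrow> trapped \<rho> T t0 w z \<Longrightarrow>
       t \<in> {T..b} \<Longrightarrow> gap v y w z t \<le> K * exp (- c * (T - t0))"
    proof -
      have "T \<le> T0" using T by (simp add: T2_def)
      from cmp[OF this, of b] show thesis using that by blast
    qed
    \<comment> \<open>The first bound gives -n < T; the second makes K * exp (- c (T + n)) smaller
      than \<epsilon>.\<close>
    obtain M :: nat where M: "real M > max (- T) ((ln (K / \<epsilon>) - c * T) / c)"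
      using reals_Archimedean2 by blast
    have small: "gap (X m) (Y m) (X n) (Y n) t < \<epsilon>" if "M \<le> n" "n \<le> m" "t \<in> {T..b}" for m n t
    proof -
      have n: "- T < real n" "ln (K / \<epsilon>) - c * T < c * real n"
        using M that \<rho>(3) by (auto simp: field_simps intro: less_le_trans)
      have "trapped \<rho> T (- real n) (X k) (Y k)" if "n \<le> k" for k
        using ef_sol_mono[OF XY(1)[of k], of "- real n"] n T that
        by (auto simp: trapped_def intro!: En0 near)
      then have "gap (X m) (Y m) (X n) (Y n) t \<le> K * exp (- c * (T - (- real n)))"
        using that by (intro cmpK) auto
      also have "\<dots> < K * exp (- ln (K / \<epsilon>))"
        using K n by (intro mult_strict_left_mono) (auto simp: algebra_simps)
      also have "\<dots> = \<epsilon>" using K \<epsilon> by (simp add: exp_minus)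
      finally show ?thesis .
    qed
    have sym: "gap (X m) (Y m) (X n) (Y n) t = gap (X n) (Y n) (X m) (Y m) t" for m n t
      by (simp add: gap_def power2_commute)
    show ?thesis
    proof (intro exI[of _ M] allI impI ballI)
      fix m n t assume "M \<le> m" "M \<le> n" "t \<in> {T..b}"
      then show "gap (X m) (Y m) (X n) (Y n) t < \<epsilon>"
        using small[of n m t] small[of m n t] sym[of m n t] by (cases "n \<le> m") auto
    qed
  qed
  define v where "v t = lim (\<lambda>n. X n t)" for t
  define y where "y t = lim (\<lambda>n. Y n t)" for t
  have ulim: "uniform_limit {T..b} X v sequentially" "uniform_limit {T..b} Y y sequentially"
    if T: "T \<le> T2" for T b
  proof -
    have "uniformly_Cauchy_on {T..b} X \<and> uniformly_Cauchy_on {T..b} Y"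
      unfolding uniformly_Cauchy_on_def
    proof (intro conjI allI impI)
      fix e :: real assume e: "0 < e"
      then obtain M where M: "\<forall>m\<ge>M. \<forall>n\<ge>M. \<forall>t\<in>{T..b}. gap (X m) (Y m) (X n) (Y n) t < e\<^sup>2"
        using gap_small[OF T, of "e\<^sup>2" b] by auto
      have "\<bar>X m t - X n t\<bar> < e \<and> \<bar>Y m t - Y n t\<bar> < e" if "t \<in> {T..b}" "M \<le> m" "M \<le> n" for t m n
      proof -
        have "gap (X m) (Y m) (X n) (Y n) t < e\<^sup>2" using M that by blast
        then have "(X m t - X n t)\<^sup>2 < e\<^sup>2" "(Y m t - Y n t)\<^sup>2 < e\<^sup>2"
          unfolding gap_def using zero_le_power2[of "X m t - X n t"] zero_le_power2[of "Y m t - Y n t"] by linarith+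
        then show ?thesis using e by (metis less_imp_le power2_abs power2_less_imp_less)
      qed
      then show "\<exists>M. \<forall>x\<in>{T..b}. \<forall>m\<ge>M. \<forall>n\<ge>M. dist (X m x) (X n x) < e"
        "\<exists>M. \<forall>x\<in>{T..b}. \<forall>m\<ge>M. \<forall>n\<ge>M. dist (Y m x) (Y n x) < e"
        unfolding dist_real_def by blast+
    qed
    then have "uniformly_convergent_on {T..b} X" "uniformly_convergent_on {T..b} Y"
      by (auto intro: Cauchy_uniformly_convergent)
    then show "uniform_limit {T..b} X v sequentially" "uniform_limit {T..b} Y y sequentially"
      unfolding v_def y_def by (simp_all add: uniformly_convergent_uniform_limit_iff)
  qed
  have lim: "(\<lambda>n. X n t) \<longlonglongrightarrow> v t" "(\<lambda>n. Y n t) \<longlonglongrightarrow> y t" for t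
    by (rule tendsto_uniform_limitI[OF ulim(1)[of "min T2 t" t]], simp, simp)
      (rule tendsto_uniform_limitI[OF ulim(2)[of "min T2 t" t]], simp, simp)
  have late: "\<forall>\<^sub>F n in sequentially. - real n \<le> t" for t
    using eventually_ge_at_top[of "nat \<lceil>- t\<rceil>"] by eventually_elim linarith
  have v0: "0 \<le> v t" for t
  proof (rule tendsto_lowerbound[OF lim(1)])
    show "\<forall>\<^sub>F n in sequentially. 0 \<le> X n t"
      using late[of t] by eventually_elim (auto intro: pos less_imp_le)
  qed simp
  have Env: "En t (v t) (y t) \<le> pot A" for t
  proof (rule tendsto_upperbound)
    have "\<forall>\<^sub>F n in sequentially. 0 \<le> X n t"
      using late[of t] by eventually_elim (auto intro: pos less_imp_le)
    then show "(\<lambda>n. En t (X n t) (Y n t)) \<longlonglongrightarrow> En t (v t) (y t)"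
      unfolding En_def pot_def using p1 v0[of t]
      by (intro tendsto_intros tendsto_powr' lim) auto
    show "\<forall>\<^sub>F n in sequentially. En t (X n t) (Y n t) \<le> pot A"
      using late[of t] by eventually_elim (rule En)
  qed auto
  \<comment> \<open>The limit of positive functions is only nonnegative a priori; energy at most
    \<open>pot A\<close> < 0 excludes zero.\<close>
  have vpos: "0 < v t" for t
  proof -
    have "v t \<noteq> 0"
    proof
      assume "v t = 0"
      then have "En t (v t) (y t) = (y t)\<^sup>2 / 2" by (simp add: En_def pot_def)
      then show False using Env[of t] pot_A_neg zero_le_power2[of "y t"] by linarith
    qed
    then show ?thesis using v0[of t] by simp
  qed
  have der: "(v has_real_derivative y t) (at t)" "(y has_real_derivative ef_rhs t (v t) (y t)) (at t)" for t
  proof -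
    define \<alpha> where "\<alpha> = min T2 (t - 1)"
    define \<beta> where "\<beta> = t + 1"
    define n0 where "n0 = nat \<lceil>1 - \<alpha>\<rceil>"
    have n0: "- real n < x \<and> - real n \<le> x" if "n0 \<le> n" "x \<in> {\<alpha><..<\<beta>}" for n x
      using that by (auto simp: n0_def)
    have t: "t \<in> {\<alpha><..<\<beta>}" by (auto simp: \<alpha>_def \<beta>_def)
    have uX: "uniform_limit {\<alpha><..<\<beta>} X v sequentially" and uY: "uniform_limit {\<alpha><..<\<beta>} Y y sequentially"
      using ulim[of \<alpha> \<beta>] by (auto simp: \<alpha>_def intro: uniform_limit_on_subset)
    show "(v has_real_derivative y t) (at t)"
      by (rule deriv_uniform_limit[OF t _ uY lim(1), of n0])
        (use XY(1) n0 in \<open>auto simp: ef_sol_def\<close>)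
    \<comment> \<open>A Lipschitz constant of the nonlinear part on the common range (0, Vmax
      \<beta>]; it turns uniform convergence of the solutions into that of their second
      derivatives.\<close>
    define M where "M = L + exp (2 * \<beta>) + p * Vmax \<beta> powr (p - 1)"
    have M0: "0 \<le> M" using L_pos p1 by (simp add: M_def)
    have Vb: "0 < u \<and> u \<le> Vmax \<beta>" if "0 < u" "En x u z \<le> pot A" "x \<in> {\<alpha><..<\<beta>}" for u x z
      using En_bounds(1)[of u x z] Vmax_mono[of x \<beta>] that pot_A_neg by auto
    have "uniform_limit {\<alpha><..<\<beta>} (\<lambda>n x. (L + exp (2 * x)) * X n x - X n x powr p)
        (\<lambda>x. (L + exp (2 * x)) * v x - v x powr p) sequentially"
    proof (rule metric_uniform_limit_imp_uniform_limit)
      show "uniform_limit {\<alpha><..<\<beta>} (\<lambda>n x. M * X n x) (\<lambda>x. M * v x) sequentially"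
        using uX by (rule bounded_linear.uniform_limit[OF bounded_linear_mult_right])
      show "\<forall>\<^sub>F n in sequentially. \<forall>x\<in>{\<alpha><..<\<beta>}.
          dist ((L + exp (2 * x)) * X n x - X n x powr p) ((L + exp (2 * x)) * v x - v x powr p)
          \<le> dist (M * X n x) (M * v x)"
        using eventually_ge_at_top[of n0]
      proof eventually_elim
        case (elim n)
        show ?case
        proof
          fix x assume x: "x \<in> {\<alpha><..<\<beta>}"
          have nx: "- real n \<le> x" using n0[OF elim x] by simp
          have "dist (M * X n x) (M * v x) = M * \<bar>X n x - v x\<bar>"
            using M0 by (simp add: dist_real_def abs_mult flip: right_diff_distrib)
          then show "dist ((L + exp (2 * x)) * X n x - X n x powr p) ((L + exp (2 * x)) * v x - v x powr p)
            \<le> dist (M * X n x) (M * v x)"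
            unfolding dist_real_def M_def
            using ef_rhs_diff[of x \<beta> "X n x" "v x"] x Vb[OF pos[OF nx] En[OF nx] x] Vb[OF vpos Env x] by auto
        qed
      qed
    qed
    from uniform_limit_add[OF bounded_linear.uniform_limit[OF bounded_linear_mult_right[of "- a"] uY] this]
    have u': "uniform_limit {\<alpha><..<\<beta>} (\<lambda>n x. ef_rhs x (X n x) (Y n x)) (\<lambda>x. ef_rhs x (v x) (y x)) sequentially"
      by (simp add: ef_rhs_def algebra_simps)
    show "(y has_real_derivative ef_rhs t (v t) (y t)) (at t)"
      by (rule deriv_uniform_limit[OF t _ u' lim(2), of n0])
        (use XY(1) n0 in \<open>auto simp: ef_sol_def\<close>)
  qed
  show thesis
  proof (rule that[OF _ Env])
    show "ef_sol t0 v y" for t0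
      unfolding ef_sol_def using der vpos
      by (auto intro!: continuous_at_imp_continuous_on DERIV_isCont)
  qed
qed

text \<open>From energy at most \<open>pot A\<close>, y^2 / 2 + (pot v - pot A) <= e^(2t) v^2 / 2.
  The right side tends to 0 at -infinity, and both summands on the left are nonnegative.\<close>

lemma singular_ef_sol_limit:
  assumes sol: "\<And>t0. ef_sol t0 v y" and En: "\<And>t. En t (v t) (y t) \<le> pot A"
  shows "(v \<longlongrightarrow> A) at_bot" "(y \<longlongrightarrow> 0) at_bot"
proof -
  have bound: "(y t)\<^sup>2 / 2 + (pot (v t) - pot A) \<le> exp (2 * t) * (Vmax 0)\<^sup>2 / 2" if "t \<le> 0" for t
  proof -
    have "0 < v t" using sol ef_sol_pos by blast
    moreover have "v t \<le> Vmax 0"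
      using En_bounds(1)[of "v t" t "y t"] Vmax_mono[OF that] En[of t] pot_A_neg \<open>0 < v t\<close> by simp
    ultimately have "exp (2 * t) * (v t)\<^sup>2 \<le> exp (2 * t) * (Vmax 0)\<^sup>2"
      by (intro mult_left_mono power_mono) auto
    then show ?thesis using En[of t] unfolding En_def by linarith
  qed
  have pA: "pot A \<le> pot (v t)" for t using sol ef_sol_pos pot_A_le by (meson less_imp_le order_refl)
  have small: "\<forall>\<^sub>F t in at_bot. (y t)\<^sup>2 / 2 + (pot (v t) - pot A) < \<epsilon>" if "0 < \<epsilon>" for \<epsilon>
  proof -
    have m: "0 < \<epsilon> / (Vmax 0)\<^sup>2" using that Vmax_pos[of 0] by simp
    obtain T where T: "T \<le> 0" "\<And>t. t \<le> T \<Longrightarrow> exp (2 * t) \<le> \<epsilon> / (Vmax 0)\<^sup>2"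
      using exp_small[OF m] by blast
    show ?thesis
      using eventually_le_at_bot[of T]
    proof eventually_elim
      case (elim t)
      have "exp (2 * t) * (Vmax 0)\<^sup>2 \<le> \<epsilon> / (Vmax 0)\<^sup>2 * (Vmax 0)\<^sup>2"
        using T(2)[OF elim] by (intro mult_right_mono) auto
      also have "\<dots> = \<epsilon>" using Vmax_pos[of 0] by simp
      finally show ?case using bound[of t] elim T(1) that by linarith
    qed
  qed
  show "(y \<longlongrightarrow> 0) at_bot"
  proof (rule tendstoI)
    fix e :: real assume e: "0 < e"
    then have "0 < e\<^sup>2 / 2" by simp
    from small[OF this] show "\<forall>\<^sub>F t in at_bot. dist (y t) 0 < e"
    proof eventually_elim
      case (elim t)
      then have "(y t)\<^sup>2 < e\<^sup>2" using pA[of t] by simp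
      then have "\<bar>y t\<bar> < e" using e by (metis less_imp_le power2_abs power2_less_imp_less)
      then show ?case by (simp add: dist_real_def)
    qed
  qed
  show "(v \<longlongrightarrow> A) at_bot"
  proof (rule tendstoI)
    fix e :: real assume e: "0 < e"
    define \<rho> where "\<rho> = min e (A / 2)"
    have \<rho>: "0 < \<rho>" "\<rho> < A" "\<rho> \<le> e" using e A_pos by (auto simp: \<rho>_def)
    obtain \<delta> where \<delta>: "0 < \<delta>" "\<And>v. 0 \<le> v \<Longrightarrow> pot v < pot A + \<delta> \<Longrightarrow> \<bar>v - A\<bar> < \<rho>"
      using pot_well[OF \<rho>(1,2)] by blast
    from small[OF \<delta>(1)] show "\<forall>\<^sub>F t in at_bot. dist (v t) A < e"
    proof eventually_elim
      case (elim t)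
      have "pot (v t) < pot A + \<delta>" using elim zero_le_power2[of "y t"] by linarith
      then show ?case using \<delta>(2)[of "v t"] sol[of t] ef_sol_pos[of t v y t] \<rho>(3) by (simp add: dist_real_def)
    qed
  qed
qed

subsection \<open>The radial equation\<close>

definition G :: "real \<Rightarrow> real" where "G u = u powr (p + 1) / (p + 1) - u\<^sup>2 / 2"

text \<open>Unlike \<open>radial_ode\<close>, this names the derivative and includes positivity, so
  that statements can refer to u'.\<close>

definition radial_sol :: "(real \<Rightarrow> real) \<Rightarrow> (real \<Rightarrow> real) \<Rightarrow> bool" where
  "radial_sol u u' \<longleftrightarrow> (\<forall>s>0. 0 < u s \<and> (u has_real_derivative u' s) (at s) \<and>
     (u' has_real_derivative - ((real N - 1) / s) * u' s - fnl p (u s)) (at s))"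

lemma G_deriv: "0 < u \<Longrightarrow> (G has_real_derivative fnl p u) (at u)"
  unfolding G_def fnl_def using powr_plus1_deriv[of "\<lambda>v. v" 1 u] p1
  by (auto intro!: derivative_eq_intros)

lemma fnl_pos: "1 < u \<Longrightarrow> 0 < fnl p u"
  using powr_less_mono[of 1 p u] p1 by (simp add: fnl_def)

lemma fnl_neg: "0 < u \<Longrightarrow> u < 1 \<Longrightarrow> fnl p u < 0"
  using powr_less_mono'[of u 1 p] p1 by (simp add: fnl_def)

lemma G_cont: "continuous_on {0..} G"
  unfolding G_def using p1 by (intro continuous_intros continuous_on_powr') auto

lemma G_increasing:
  assumes "1 \<le> v" "v < w" shows "G v < G w"
proof (rule DERIV_pos_imp_increasing_open[OF assms(2)])
  fix x assume "v < x" "x < w"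
  then show "\<exists>z. (G has_real_derivative z) (at x) \<and> z > 0"
    using G_deriv[of x] fnl_pos[of x] assms by (intro exI[of _ "fnl p x"]) auto
qed (use assms in \<open>auto intro: continuous_on_subset[OF G_cont]\<close>)

lemma G_decreasing:
  assumes "0 \<le> v" "v < w" "w \<le> 1" shows "G w < G v"
proof (rule DERIV_neg_imp_decreasing_open[OF assms(2)])
  fix x assume "v < x" "x < w"
  then show "\<exists>z. (G has_real_derivative z) (at x) \<and> z < 0"
    using G_deriv[of x] fnl_neg[of x] assms by (intro exI[of _ "fnl p x"]) auto
qed (use assms in \<open>auto intro: continuous_on_subset[OF G_cont]\<close>)

lemma H_deriv:
  assumes "radial_sol u u'" "0 < s"
  shows "((\<lambda>s. (u' s)\<^sup>2 / 2 + G (u s)) has_real_derivative - ((real N - 1) / s) * (u' s)\<^sup>2) (at s)"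
proof -
  have *: "0 < u s" "(u has_real_derivative u' s) (at s)"
    "(u' has_real_derivative - ((real N - 1) / s) * u' s - fnl p (u s)) (at s)"
    using assms by (auto simp: radial_sol_def)
  have "((\<lambda>s. (u' s)\<^sup>2 / 2) has_real_derivative u' s * (- ((real N - 1) / s) * u' s - fnl p (u s))) (at s)"
    using *(3) by (auto intro!: derivative_eq_intros)
  from DERIV_add[OF this DERIV_chain2[OF G_deriv[OF *(1)] *(2)]] show ?thesis
    by (rule DERIV_cong) (simp add: algebra_simps power2_eq_square)
qed

text \<open>The divergence form of the radial equation.\<close>

lemma flux_deriv:
  assumes "radial_sol u u'" "0 < s"
  shows "((\<lambda>s. s ^ (N - 1) * u' s) has_real_derivative - (s ^ (N - 1)) * fnl p (u s)) (at s)"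
proof -
  have *: "(u' has_real_derivative - ((real N - 1) / s) * u' s - fnl p (u s)) (at s)"
    using assms by (auto simp: radial_sol_def)
  obtain m where m: "N = Suc (Suc m)" using N3 that[of "N - 2"] by linarith
  have "((\<lambda>s. s ^ (N - 1)) has_real_derivative (real N - 1) * s ^ (N - 2)) (at s)"
    using DERIV_pow[of "N - 1" s] by (simp add: m)
  from DERIV_mult[OF this *] show ?thesis
  proof (rule DERIV_cong)
    have "s ^ (N - 1) = s * s ^ (N - 2)" by (simp add: m)
    moreover have "(real N - 1) / s * u' s * (s * s ^ (N - 2)) = (real N - 1) * s ^ (N - 2) * u' s"
      using assms(2) by simp
    ultimately show "(real N - 1) * s ^ (N - 2) * u' s + (- ((real N - 1) / s) * u' s - fnl p (u s)) * s ^ (N - 1)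
        = - (s ^ (N - 1)) * fnl p (u s)"
      by (simp add: left_diff_distrib)
  qed
qed

lemma power_N_deriv: "((\<lambda>s::real. s ^ N / real N) has_real_derivative s ^ (N - 1)) (at s)"
  using N3 by (auto intro!: derivative_eq_intros)

section \<open>Change of variables and bounds for regular solutions\<close>

definition ef_v :: "(real \<Rightarrow> real) \<Rightarrow> real \<Rightarrow> real" where
  "ef_v u t = exp (\<theta> * t) * u (exp t)"

definition ef_y :: "(real \<Rightarrow> real) \<Rightarrow> (real \<Rightarrow> real) \<Rightarrow> real \<Rightarrow> real" where
  "ef_y u u' t = exp (\<theta> * t) * (\<theta> * u (exp t) + exp t * u' (exp t))"

text \<open>The scaling identity behind both changes of variables: it turns v^p into s^(\<theta> +
  2) u^p.\<close>

lemma \<theta>_p: "\<theta> * p = \<theta> + 2"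
  using p1 by (simp add: \<theta>_def field_simps)

lemma radial_to_ef:
  assumes "radial_sol u u'"
  shows "ef_sol t0 (ef_v u) (ef_y u u')"
proof -
  have *: "0 < u (exp t)" "(u has_real_derivative u' (exp t)) (at (exp t))"
    "(u' has_real_derivative - ((real N - 1) / exp t) * u' (exp t) - fnl p (u (exp t))) (at (exp t))" for t
    using assms by (auto simp: radial_sol_def)
  have du: "((\<lambda>t. u (exp t)) has_real_derivative u' (exp t) * exp t) (at t)" for t
    using DERIV_chain2[of u _ exp, OF *(2) DERIV_exp] .
  have du': "((\<lambda>t. u' (exp t)) has_real_derivative
      (- ((real N - 1) / exp t) * u' (exp t) - fnl p (u (exp t))) * exp t) (at t)" for t
    using DERIV_chain2[of u' _ exp, OF *(3) DERIV_exp] .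
  have dexp: "((\<lambda>t. exp (\<theta> * t)) has_real_derivative \<theta> * exp (\<theta> * t)) (at t)" for t
    by (auto intro!: derivative_eq_intros)
  have dv: "(ef_v u has_real_derivative ef_y u u' t) (at t)" for t
    unfolding ef_v_def by (rule DERIV_cong[OF DERIV_mult[OF dexp du]]) (simp add: ef_y_def algebra_simps)
  have dy: "(ef_y u u' has_real_derivative ef_rhs t (ef_v u t) (ef_y u u' t)) (at t)" for t
  proof -
    have vp: "ef_v u t powr p = exp (\<theta> * t) * exp t * exp t * u (exp t) powr p"
    proof -
      have "ef_v u t powr p = exp (p * (\<theta> * t)) * u (exp t) powr p"
        unfolding ef_v_def using *(1)[of t] by (simp add: powr_mult exp_powr_real mult.commute)
      also have "p * (\<theta> * t) = (\<theta> * p) * t" by (simp add: mult_ac)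
      also have "\<dots> = \<theta> * t + t + t" unfolding \<theta>_p by (simp add: algebra_simps)
      finally show ?thesis by (simp only: exp_add)
    qed
    define D where "D = (- ((real N - 1) / exp t) * u' (exp t) - fnl p (u (exp t))) * exp t"
    have eD: "exp t * D = - (real N - 1) * (exp t * u' (exp t)) + exp t * exp t * u (exp t)
        - exp t * exp t * u (exp t) powr p"
      by (simp add: D_def fnl_def field_simps)
    have "(ef_y u u' has_real_derivative
        \<theta> * exp (\<theta> * t) * (\<theta> * u (exp t) + exp t * u' (exp t)) +
        (\<theta> * (u' (exp t) * exp t) + (exp t * u' (exp t) + D * exp t)) * exp (\<theta> * t)) (at t)"
      unfolding ef_y_def D_def
      by (rule DERIV_mult[OF dexp DERIV_add[OF DERIV_cmult[OF du] DERIV_mult[OF DERIV_exp du']]])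
    then show ?thesis
    proof (rule DERIV_cong)
      show "\<theta> * exp (\<theta> * t) * (\<theta> * u (exp t) + exp t * u' (exp t)) +
        (\<theta> * (u' (exp t) * exp t) + (exp t * u' (exp t) + D * exp t)) * exp (\<theta> * t)
        = ef_rhs t (ef_v u t) (ef_y u u' t)"
      proof -
        \<comment> \<open>After these substitutions the claim is polynomial: q, E, U, U', e, W, n
          stand for \<theta>, exp (\<theta> t), u, u', exp t, u^p, N.\<close>
        have alg: "q * E * (q * U + e * U') + (q * (U' * e) + (e * U' +
            (- (n - 1) * (e * U') + e * e * U - e * e * W))) * E
          = - (n - 2 - 2 * q) * (E * (q * U + e * U')) + (q * (n - 2 - q) + e * e) * (E * U) - E * e * e * W"
          for q E U U' e W n :: real
          by algebra
        have "exp (2 * t) = exp t * exp t" by (simp only: mult_2 exp_add)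
        then show ?thesis
          unfolding mult.commute[of D] eD ef_rhs_def vp
          unfolding ef_v_def ef_y_def a_def L_def by (simp only: alg)
      qed
    qed
  qed
  show ?thesis
  proof -
    have "0 < ef_v u t" for t using *(1) by (simp add: ef_v_def)
    then show ?thesis
      unfolding ef_sol_def using dv dy by (auto intro!: continuous_at_imp_continuous_on DERIV_isCont)
  qed
qed

text \<open>The energy u'^2 / 2 + G u starts at G \<gamma> and decreases, which bounds u by
  \<gamma>. The bounds - u <= f(u) <= u^p then control the flux s^(N-1) u', and integrating the
  lower bound on u' gives the lower bound on u.\<close>

lemma ivp_estimates:
  assumes ivp: "ivp_sol N p \<gamma> u" and \<gamma>: "1 < \<gamma>"
  obtains u' where "radial_sol u u'"
    "\<And>s. 0 < s \<Longrightarrow> u s \<le> \<gamma>"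
    "\<And>s. 0 < s \<Longrightarrow> \<gamma> - \<gamma> powr p * s\<^sup>2 / (2 * real N) \<le> u s"
    "\<And>s. 0 < s \<Longrightarrow> - (\<gamma> powr p * s / real N) \<le> u' s"
    "\<And>s. 0 < s \<Longrightarrow> u' s \<le> \<gamma> * s / real N"
proof -
  obtain u' where rad: "radial_sol u u'"
    using ivp unfolding ivp_sol_def radial_ode_def radial_sol_def by force
  have cont: "continuous_on {0..} u" and u0: "u 0 = \<gamma>"
    and d0: "(u has_real_derivative 0) (at 0 within {0..})" using ivp by (auto simp: ivp_sol_def)
  have pos: "0 < u s" and du: "(u has_real_derivative u' s) (at s)" if "0 < s" for s
    using rad that by (auto simp: radial_sol_def)
  \<comment> \<open>\<open>ivp_sol\<close> does not say that u' is continuous at 0. The mean value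
    theorem on [0, h] still supplies points arbitrarily close to 0 with small u', which suffices for
    monotone quantities.\<close>
  have slope: "\<exists>\<sigma>. 0 < \<sigma> \<and> \<sigma> < s \<and> \<bar>u' \<sigma>\<bar> < \<epsilon>" if "0 < s" "0 < \<epsilon>" for s \<epsilon>
  proof -
    have "((\<lambda>h. (u h - u 0) / (h - 0)) \<longlongrightarrow> 0) (at 0 within {0..})"
      using d0 by (simp add: has_field_derivative_iff)
    then have "\<forall>\<^sub>F h in at 0 within {0..}. dist ((u h - u 0) / (h - 0)) 0 < \<epsilon>"
      using \<open>0 < \<epsilon>\<close> by (rule tendstoD)
    then obtain d where d: "0 < d" "\<And>h. 0 \<le> h \<Longrightarrow> h \<noteq> 0 \<Longrightarrow> h < d \<Longrightarrow> \<bar>(u h - u 0) / h\<bar> < \<epsilon>"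
      unfolding eventually_at by (auto simp: dist_real_def)
    define h where "h = min (s / 2) (d / 2)"
    have h: "0 < h" "h < s" "h < d" using d that by (auto simp: h_def)
    obtain z where z: "0 < z" "z < h" "u h - u 0 = u' z * (h - 0)"
    proof (rule mvt[of 0 h u "\<lambda>x k. u' x * k"])
      show "continuous_on {0..h} u" by (rule continuous_on_subset[OF cont]) auto
      show "(u has_derivative (\<lambda>k. u' x * k)) (at x)" if "0 < x" for x
        using du[OF that] by (simp add: has_field_derivative_def)
    qed (use h in auto)
    then have "(u h - u 0) / h = u' z" using h by simp
    then show ?thesis using d(2)[of h] h z by (intro exI[of _ z]) auto
  qed
  have ub: "u s \<le> \<gamma>" if s: "0 < s" for s
  proof (rule ccontr)
    assume "\<not> ?thesis"
    then have G: "G \<gamma> < G (u s)" using G_increasing \<gamma> by simp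
    define \<eta> where "\<eta> = (G (u s) - G \<gamma>) / 2"
    have \<eta>: "0 < \<eta>" using G by (simp add: \<eta>_def)
    have "continuous_on {0..} (\<lambda>s. G (u s))"
      by (rule continuous_on_compose2[OF G_cont cont]) (use pos u0 \<gamma> in \<open>auto simp: le_less\<close>)
    then obtain d where d: "0 < d" "\<And>x. 0 \<le> x \<Longrightarrow> x < d \<Longrightarrow> \<bar>G (u x) - G \<gamma>\<bar> < \<eta>"
      using \<eta> u0 unfolding continuous_on_iff by (force simp: dist_real_def)
    obtain \<sigma> where \<sigma>: "0 < \<sigma>" "\<sigma> < min s d" "\<bar>u' \<sigma>\<bar> < sqrt (2 * \<eta>)"
      using slope[of "min s d" "sqrt (2 * \<eta>)"] s d \<eta> by auto
    have "(u' \<sigma>)\<^sup>2 < 2 * \<eta>" using \<sigma>(3) \<eta> by (metis real_sqrt_abs real_sqrt_less_iff)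
    moreover have "G (u \<sigma>) < G \<gamma> + \<eta>" using d(2)[of \<sigma>] \<sigma> by auto
    moreover have "(u' s)\<^sup>2 / 2 + G (u s) \<le> (u' \<sigma>)\<^sup>2 / 2 + G (u \<sigma>)"
    proof (rule DERIV_nonpos_imp_nonincreasing[of \<sigma> s])
      fix x assume "\<sigma> \<le> x" "x \<le> s"
      then have "0 < x" using \<sigma> by simp
      moreover from this have "- ((real N - 1) / x) * (u' x)\<^sup>2 \<le> 0" using N3 by simp
      ultimately show "\<exists>y. ((\<lambda>s. (u' s)\<^sup>2 / 2 + G (u s)) has_real_derivative y) (at x) \<and> y \<le> 0"
        using H_deriv[OF rad] by blast
    qed (use \<sigma> in auto)
    ultimately show False using zero_le_power2[of "u' s"] unfolding \<eta>_def by (simp add: field_simps)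
  qed
  have flux: "\<exists>\<sigma>. 0 < \<sigma> \<and> \<sigma> < s \<and> \<bar>\<sigma> ^ (N - 1) * u' \<sigma>\<bar> < \<epsilon> \<and> \<sigma> ^ N / real N < \<epsilon>"
    if s: "0 < s" and \<epsilon>: "0 < \<epsilon>" for s \<epsilon>
  proof -
    obtain \<sigma> where \<sigma>: "0 < \<sigma>" "\<sigma> < Min {s, 1, \<epsilon>}" "\<bar>u' \<sigma>\<bar> < \<epsilon>"
      using slope[of "Min {s, 1, \<epsilon>}" \<epsilon>] s \<epsilon> by auto
    have "\<sigma> ^ (N - 1) \<le> 1" "\<sigma> ^ N \<le> \<sigma>"
      using \<sigma> N3 power_decreasing[of 1 N \<sigma>] by (auto intro: power_le_one)
    moreover from this have "\<bar>\<sigma> ^ (N - 1) * u' \<sigma>\<bar> \<le> 1 * \<bar>u' \<sigma>\<bar>"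
      unfolding abs_mult using \<sigma> by (intro mult_right_mono) auto
    moreover have "\<sigma> ^ N / real N \<le> \<sigma> ^ N" using \<sigma> N3 by (simp add: field_simps)
    ultimately show ?thesis using \<sigma> by (intro exI[of _ \<sigma>]) auto
  qed
  have powp: "u s powr p \<le> \<gamma> powr p" if "0 < s" for s
    using ub pos that p1 by (intro powr_mono2) (auto simp: less_imp_le)
  \<comment> \<open>The sign k = 1 or k = -1 gives the lower or the upper bound on u'. The sum k
    s^(N-1) u' + c s^N / N is nondecreasing and, at points near 0, almost nonnegative.\<close>
  have flux_mono: "0 \<le> s ^ (N - 1) * (k * u' s) + c * (s ^ N / real N)"
    if s: "0 < s" and c: "0 \<le> c" and k: "\<bar>k\<bar> = 1" and kc: "\<And>\<sigma>. 0 < \<sigma> \<Longrightarrow> k * fnl p (u \<sigma>) \<le> c" for s k c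
  proof (rule field_le_epsilon)
    fix e :: real assume e: "0 < e"
    define \<epsilon> where "\<epsilon> = e / (1 + c)"
    obtain \<sigma> where \<sigma>: "0 < \<sigma>" "\<sigma> < s" "\<bar>\<sigma> ^ (N - 1) * u' \<sigma>\<bar> < \<epsilon>" "\<sigma> ^ N / real N < \<epsilon>"
      using flux[of s \<epsilon>] s e c by (auto simp: \<epsilon>_def)
    have "- \<epsilon> \<le> \<sigma> ^ (N - 1) * (k * u' \<sigma>)"
    proof -
      have "\<bar>\<sigma> ^ (N - 1) * (k * u' \<sigma>)\<bar> = \<bar>\<sigma> ^ (N - 1) * u' \<sigma>\<bar>" using k by (simp add: abs_mult)
      then show ?thesis using \<sigma>(3) by linarith
    qed
    moreover have "0 \<le> c * (\<sigma> ^ N / real N)" using c \<sigma> by simp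
    ultimately have "- \<epsilon> \<le> k * (\<sigma> ^ (N - 1) * u' \<sigma>) + c * (\<sigma> ^ N / real N)" by (simp add: mult_ac)
    also have "\<dots> \<le> k * (s ^ (N - 1) * u' s) + c * (s ^ N / real N)"
    proof (rule DERIV_nonneg_imp_nondecreasing[of \<sigma> s])
      fix x assume "\<sigma> \<le> x" "x \<le> s"
      then have x: "0 < x" using \<sigma> by simp
      have "((\<lambda>s. k * (s ^ (N - 1) * u' s) + c * (s ^ N / real N)) has_real_derivative
         k * (- (x ^ (N - 1)) * fnl p (u x)) + c * x ^ (N - 1)) (at x)"
        by (intro DERIV_add DERIV_cmult flux_deriv[OF rad x] power_N_deriv)
      moreover have "0 \<le> k * (- (x ^ (N - 1)) * fnl p (u x)) + c * x ^ (N - 1)"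
      proof -
        have "0 \<le> x ^ (N - 1) * (c - k * fnl p (u x))" using kc[OF x] x by simp
        then show ?thesis by (simp add: algebra_simps)
      qed
      ultimately show "\<exists>y. ((\<lambda>s. k * (s ^ (N - 1) * u' s) + c * (s ^ N / real N)) has_real_derivative y) (at x)
          \<and> 0 \<le> y" by blast
    qed (use \<sigma> in auto)
    finally have "0 \<le> s ^ (N - 1) * (k * u' s) + c * (s ^ N / real N) + \<epsilon>" by (simp add: mult_ac)
    moreover have "\<epsilon> \<le> e" using e c by (simp add: \<epsilon>_def field_simps)
    ultimately show "0 \<le> s ^ (N - 1) * (k * u' s) + c * (s ^ N / real N) + e" by linarith
  qed
  have divide: "0 \<le> x + c * s / real N" if "0 \<le> s ^ (N - 1) * x + c * (s ^ N / real N)" "0 < s" for s x c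
  proof -
    have "s ^ N = s ^ (N - 1) * s" using N3 power_minus_mult[of N s] by simp
    then have "s ^ (N - 1) * x + c * (s ^ N / real N) = s ^ (N - 1) * (x + c * s / real N)"
      by (simp add: algebra_simps)
    then show ?thesis using that zero_less_power[OF that(2), of "N - 1"]
      by (metis mult_pos_neg not_le)
  qed
  have lower: "- (\<gamma> powr p * s / real N) \<le> u' s" if "0 < s" for s
  proof -
    have "1 * fnl p (u \<sigma>) \<le> \<gamma> powr p" if "0 < \<sigma>" for \<sigma>
      using pos[OF that] powp[OF that] by (simp add: fnl_def)
    then have "0 \<le> s ^ (N - 1) * (1 * u' s) + \<gamma> powr p * (s ^ N / real N)"
      by (intro flux_mono[OF that]) auto
    from divide[OF this that] show ?thesis by simp
  qed
  have upper: "u' s \<le> \<gamma> * s / real N" if "0 < s" for s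
  proof -
    have "- 1 * fnl p (u \<sigma>) \<le> \<gamma>" if "0 < \<sigma>" for \<sigma>
    proof -
      have "- 1 * fnl p (u \<sigma>) \<le> u \<sigma>" by (simp add: fnl_def)
      then show ?thesis using ub[OF that] by linarith
    qed
    then have "0 \<le> s ^ (N - 1) * (- 1 * u' s) + \<gamma> * (s ^ N / real N)"
      using \<gamma> by (intro flux_mono[OF that]) auto
    from divide[OF this that] show ?thesis by simp
  qed
  have low: "\<gamma> - \<gamma> powr p * s\<^sup>2 / (2 * real N) \<le> u s" if s: "0 < s" for s
  proof -
    have "u 0 + \<gamma> powr p / real N * (0\<^sup>2 / 2) \<le> u s + \<gamma> powr p / real N * (s\<^sup>2 / 2)"
    proof (rule DERIV_nonneg_imp_increasing_open[of 0 s])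
      fix x assume x: "0 < x" "x < s"
      have "((\<lambda>s. u s + \<gamma> powr p / real N * (s\<^sup>2 / 2)) has_real_derivative u' x + \<gamma> powr p / real N * x) (at x)"
        using du[OF x(1)] N3 by (auto intro!: derivative_eq_intros)
      moreover have "0 \<le> u' x + \<gamma> powr p / real N * x" using lower[OF x(1)] by simp
      ultimately show "\<exists>y. ((\<lambda>s. u s + \<gamma> powr p / real N * (s\<^sup>2 / 2)) has_real_derivative y) (at x) \<and> 0 \<le> y"
        by blast
    next
      show "continuous_on {0..s} (\<lambda>s. u s + \<gamma> powr p / real N * (s\<^sup>2 / 2))"
        by (intro continuous_intros continuous_on_subset[OF cont]) auto
    qed (use s in auto)
    then show ?thesis using u0 by (simp add: field_simps)
  qed
  show thesis by (rule that[OF rad ub low lower upper])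
qed

subsection \<open>Solutions with large initial value\<close>

text \<open>At the time \<open>t_esc \<gamma>\<close> the solution still has \<open>u \<ge> \<gamma> / 2\<close>, and \<open>y \<ge> \<theta> / 4 * \<gamma> * exp (\<theta> * t)\<close>
  up to that time makes the energy drop by an amount that does not depend on \<open>\<gamma>\<close>.\<close>

definition esc :: real where "esc = min 1 (\<theta> / 4) * real N"

definition t_esc :: "real \<Rightarrow> real" where "t_esc \<gamma> = (ln esc - (p - 1) * ln \<gamma>) / 2"

lemma esc_pos: "0 < esc"
  using \<theta>_pos N3 by (simp add: esc_def)

lemma exp_t_esc: "0 < \<gamma> \<Longrightarrow> exp (2 * t_esc \<gamma>) = esc * \<gamma> powr (1 - p)"
proof -
  assume "0 < \<gamma>"
  moreover have "2 * t_esc \<gamma> = ln esc + (1 - p) * ln \<gamma>" by (simp add: t_esc_def left_diff_distrib)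
  ultimately show ?thesis using esc_pos by (simp add: exp_add powr_def)
qed

lemma t_esc_at_bot: "filterlim t_esc at_bot at_top"
proof -
  have "filterlim (\<lambda>\<gamma>. - ln esc / 2 + (p - 1) / 2 * ln \<gamma>) at_top at_top"
    using p1 by (intro filterlim_tendsto_add_at_top[OF tendsto_const]
        filterlim_tendsto_pos_mult_at_top[OF tendsto_const] ln_at_top) auto
  then have "filterlim (\<lambda>\<gamma>. - (- ln esc / 2 + (p - 1) / 2 * ln \<gamma>)) at_bot at_top"
    by (simp only: filterlim_uminus_at_bot minus_minus)
  moreover have "t_esc = (\<lambda>\<gamma>. - (- ln esc / 2 + (p - 1) / 2 * ln \<gamma>))"
    by (rule ext) (simp add: t_esc_def field_simps)
  ultimately show ?thesis by simp
qed

section \<open>Energy loss of regular solutions\<close>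

lemma antimono_limit_at_bot:
  fixes f :: "real \<Rightarrow> real"
  assumes lim: "(f \<longlongrightarrow> l) at_bot" and mono: "\<And>x y. x \<le> y \<Longrightarrow> y \<le> t \<Longrightarrow> f y \<le> f x"
  shows "f t \<le> l"
  by (rule tendsto_lowerbound[OF lim]) (auto intro: eventually_mono[OF eventually_le_at_bot[of t]] mono)

lemma exp_mult_at_bot: "0 < c \<Longrightarrow> ((\<lambda>t::real. exp (c * t)) \<longlongrightarrow> 0) at_bot"
  by (rule filterlim_compose[OF exp_at_bot])
    (rule filterlim_tendsto_pos_mult_at_bot[OF tendsto_const _ filterlim_ident])

text \<open>Since v and y vanish at -infinity, so does the energy. Integrating E' <= - a y^2 with
  the exponential lower bound on y yields the loss up to \<open>t_esc \<gamma>\<close>.\<close>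

lemma ivp_energy:
  assumes ivp: "ivp_sol N p \<gamma> u" and \<gamma>: "1 < \<gamma>"
  obtains y where "\<And>t0. ef_sol t0 (ef_v u) y" "\<And>t. En t (ef_v u t) (y t) \<le> 0"
    "En (t_esc \<gamma>) (ef_v u (t_esc \<gamma>)) (y (t_esc \<gamma>)) \<le> - (a * \<theta> / 32 * esc powr \<theta>)"
proof -
  obtain u' where rad: "radial_sol u u'"
    and ub: "\<And>s. 0 < s \<Longrightarrow> u s \<le> \<gamma>"
    and lb: "\<And>s. 0 < s \<Longrightarrow> \<gamma> - \<gamma> powr p * s\<^sup>2 / (2 * real N) \<le> u s"
    and dlb: "\<And>s. 0 < s \<Longrightarrow> - (\<gamma> powr p * s / real N) \<le> u' s"
    and dub: "\<And>s. 0 < s \<Longrightarrow> u' s \<le> \<gamma> * s / real N"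
    using ivp_estimates[OF assms] by metis
  define v where "v = ef_v u"
  define y where "y = ef_y u u'"
  have sol: "ef_sol t0 v y" for t0 unfolding v_def y_def by (rule radial_to_ef[OF rad])
  have vpos: "0 < v t" for t using sol ef_sol_pos by blast
  define C where "C = max (\<gamma> powr p) \<gamma> / real N"
  have du: "\<bar>u' s\<bar> \<le> C * s" if "0 < s" for s
  proof -
    have "\<gamma> powr p * s / real N \<le> C * s" "\<gamma> * s / real N \<le> C * s"
      using that N3 by (simp_all add: C_def divide_right_mono)
    then show ?thesis using dlb[OF that] dub[OF that] by linarith
  qed
  have vlim: "(v \<longlongrightarrow> 0) at_bot"
  proof (rule Lim_null_comparison)
    show "((\<lambda>t. exp (\<theta> * t) * \<gamma>) \<longlongrightarrow> 0) at_bot"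
      using exp_mult_at_bot[OF \<theta>_pos] by (rule tendsto_mult_left_zero)
    have "norm (v t) \<le> exp (\<theta> * t) * \<gamma>" for t
      using vpos[of t] ub[of "exp t"] by (simp add: v_def ef_v_def)
    then show "\<forall>\<^sub>F t in at_bot. norm (v t) \<le> exp (\<theta> * t) * \<gamma>" by simp
  qed
  have ylim: "(y \<longlongrightarrow> 0) at_bot"
  proof (rule Lim_null_comparison)
    have "((\<lambda>t. exp (\<theta> * t) * (\<theta> * \<gamma> + C * exp (2 * t))) \<longlongrightarrow> 0 * (\<theta> * \<gamma> + C * 0)) at_bot"
      by (intro tendsto_mult tendsto_add tendsto_const exp_mult_at_bot \<theta>_pos) simp
    then show "((\<lambda>t. exp (\<theta> * t) * (\<theta> * \<gamma> + C * exp (2 * t))) \<longlongrightarrow> 0) at_bot" by simp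
    have "norm (y t) \<le> exp (\<theta> * t) * (\<theta> * \<gamma> + C * exp (2 * t))" for t
    proof -
      have "\<bar>exp t * u' (exp t)\<bar> \<le> exp t * (C * exp t)"
        unfolding abs_mult using du[of "exp t"] by (intro mult_mono) auto
      also have "\<dots> = C * exp (2 * t)" unfolding exp_double by (simp only: power2_eq_square mult_ac)
      finally have 1: "\<bar>exp t * u' (exp t)\<bar> \<le> C * exp (2 * t)" .
      have "0 < u (exp t)" using rad by (simp add: radial_sol_def)
      then have "\<bar>\<theta> * u (exp t)\<bar> \<le> \<theta> * \<gamma>" using ub[of "exp t"] \<theta>_pos by simp
      then have "\<bar>\<theta> * u (exp t) + exp t * u' (exp t)\<bar> \<le> \<theta> * \<gamma> + C * exp (2 * t)" using 1 by linarith
      then show ?thesis by (simp add: y_def ef_y_def abs_mult)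
    qed
    then show "\<forall>\<^sub>F t in at_bot. norm (y t) \<le> exp (\<theta> * t) * (\<theta> * \<gamma> + C * exp (2 * t))" by simp
  qed
  have Elim: "((\<lambda>t. En t (v t) (y t)) \<longlongrightarrow> 0) at_bot"
  proof -
    have "((\<lambda>t. v t powr (p + 1)) \<longlongrightarrow> 0 powr (p + 1)) at_bot"
      using p1 vpos by (intro tendsto_powr' vlim tendsto_const) (auto intro!: always_eventually less_imp_le)
    then have "((\<lambda>t. (y t)\<^sup>2 / 2 + (v t powr (p + 1) / (p + 1) - L * (v t)\<^sup>2 / 2) - exp (2 * t) * (v t)\<^sup>2 / 2)
        \<longlongrightarrow> 0\<^sup>2 / 2 + (0 powr (p + 1) / (p + 1) - L * 0\<^sup>2 / 2) - 0 * 0\<^sup>2 / 2) at_bot"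
      using p1 by (intro tendsto_add tendsto_diff tendsto_divide tendsto_mult tendsto_power
          tendsto_const vlim ylim exp_mult_at_bot) auto
    then show ?thesis by (simp add: En_def pot_def)
  qed
  have E0: "En t (v t) (y t) \<le> 0" for t
    by (rule antimono_limit_at_bot[OF Elim]) (use ef_sol_En_antimono[OF sol order_refl] in blast)
  \<comment> \<open>k * exp (2 \<theta> t) is the integral of a (\<theta>/4 * \<gamma> * exp
    (\<theta> t))^2 from -infinity to t, so \<open>D\<close> is nonincreasing up to
    \<open>t_esc \<gamma>\<close>.\<close>
  define k where "k = a * (\<theta> / 4)\<^sup>2 * \<gamma>\<^sup>2 / (2 * \<theta>)"
  define D where "D t = En t (v t) (y t) + k * exp (2 * \<theta> * t)" for t
  \<comment> \<open>Up to this time \<gamma>^p s^2 / N <= min 1 (\<theta>/4) * \<gamma>. Hence u >=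
    \<gamma>/2 and s u' >= - \<theta> \<gamma> / 4, which leaves \<theta> u + s u' >= \<theta>
    \<gamma> / 4.\<close>
  have ylow: "\<theta> / 4 * \<gamma> * exp (\<theta> * t) \<le> y t" if t: "t \<le> t_esc \<gamma>" for t
  proof -
    define s where "s = exp t"
    have s: "0 < s" by (simp add: s_def)
    have "s\<^sup>2 = exp (2 * t)" by (simp add: s_def exp_double)
    also have "\<dots> \<le> exp (2 * t_esc \<gamma>)" using t by simp
    also have "\<dots> = esc * \<gamma> powr (1 - p)" using \<gamma> exp_t_esc by simp
    finally have "\<gamma> powr p * s\<^sup>2 \<le> \<gamma> powr p * (esc * \<gamma> powr (1 - p))" by (intro mult_left_mono) auto
    also have "\<dots> = esc * (\<gamma> powr p * \<gamma> powr (1 - p))" by simp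
    also have "\<dots> = esc * \<gamma>" using \<gamma> by (simp flip: powr_add)
    finally have "\<gamma> powr p * s\<^sup>2 / real N \<le> min 1 (\<theta> / 4) * \<gamma>"
      using N3 by (simp add: esc_def field_simps)
    moreover have "min 1 (\<theta> / 4) * \<gamma> \<le> 1 * \<gamma>" "min 1 (\<theta> / 4) * \<gamma> \<le> \<theta> / 4 * \<gamma>"
      using \<gamma> by (intro mult_right_mono; simp)+
    ultimately have 1: "\<gamma> powr p * s\<^sup>2 / real N \<le> \<gamma>" "\<gamma> powr p * s\<^sup>2 / real N \<le> \<theta> / 4 * \<gamma>" by linarith+
    have "\<gamma> / 2 \<le> u s" using lb[OF s] 1(1) by simp
    then have 2: "\<theta> * (\<gamma> / 2) \<le> \<theta> * u s" using \<theta>_pos by simp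
    have "s * - (\<gamma> powr p * s / real N) \<le> s * u' s" using dlb[OF s] s by (intro mult_left_mono) auto
    then have "- (\<theta> / 4 * \<gamma>) \<le> s * u' s" using 1(2) by (simp add: power2_eq_square mult_ac)
    then have "\<theta> / 4 * \<gamma> \<le> \<theta> * u s + s * u' s" using 2 by simp
    then have "exp (\<theta> * t) * (\<theta> / 4 * \<gamma>) \<le> exp (\<theta> * t) * (\<theta> * u s + s * u' s)" by (rule mult_left_mono) simp
    then show ?thesis by (simp add: y_def ef_y_def s_def mult_ac)
  qed
  have "D (t_esc \<gamma>) \<le> 0"
  proof (rule antimono_limit_at_bot[where f = D])
    have "(D \<longlongrightarrow> 0 + k * 0) at_bot"
      unfolding D_def using \<theta>_pos
      by (intro tendsto_add tendsto_mult tendsto_const Elim exp_mult_at_bot) auto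
    then show "(D \<longlongrightarrow> 0) at_bot" by simp
    fix t1 t2 assume t12: "t1 \<le> t2" "t2 \<le> t_esc \<gamma>"
    show "D t2 \<le> D t1"
    proof (rule DERIV_nonpos_imp_nonincreasing[OF t12(1)])
      fix t assume t: "t1 \<le> t" "t \<le> t2"
      have "((\<lambda>t. En t (v t) (y t)) has_real_derivative - a * (y t)\<^sup>2 - exp (2 * t) * (v t)\<^sup>2) (at t)"
        using sol[of "t - 1"] vpos by (intro ef_En_deriv) (auto simp: ef_sol_def)
      moreover have "((\<lambda>t. k * exp (2 * \<theta> * t)) has_real_derivative 2 * \<theta> * k * exp (2 * \<theta> * t)) (at t)"
        by (auto intro!: derivative_eq_intros)
      ultimately have "(D has_real_derivative
          - a * (y t)\<^sup>2 - exp (2 * t) * (v t)\<^sup>2 + 2 * \<theta> * k * exp (2 * \<theta> * t)) (at t)"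
        unfolding D_def by (rule DERIV_add)
      moreover have "2 * \<theta> * k * exp (2 * \<theta> * t) \<le> a * (y t)\<^sup>2 + exp (2 * t) * (v t)\<^sup>2"
      proof -
        have "2 * \<theta> * k * exp (2 * \<theta> * t) = a * (\<theta> / 4 * \<gamma> * exp (\<theta> * t))\<^sup>2"
        proof -
          have "exp (2 * \<theta> * t) = (exp (\<theta> * t))\<^sup>2" using exp_double[of "\<theta> * t"] by (simp only: mult.assoc)
          moreover have "2 * \<theta> * k = a * (\<theta> / 4)\<^sup>2 * \<gamma>\<^sup>2" using \<theta>_pos by (simp add: k_def)
          ultimately show ?thesis by (simp only: power_mult_distrib mult.assoc)
        qed
        also have "\<dots> \<le> a * (y t)\<^sup>2"
          using ylow[of t] t t12 a_pos \<theta>_pos \<gamma> by (intro mult_left_mono power_mono) auto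
        also have "\<dots> \<le> a * (y t)\<^sup>2 + exp (2 * t) * (v t)\<^sup>2" by simp
        finally show ?thesis .
      qed
      then have "- a * (y t)\<^sup>2 - exp (2 * t) * (v t)\<^sup>2 + 2 * \<theta> * k * exp (2 * \<theta> * t) \<le> 0"
        by simp
      ultimately show "\<exists>z. (D has_real_derivative z) (at t) \<and> z \<le> 0" by blast
    qed
  qed
  \<comment> \<open>Since (1 - p) \<theta> = -2, the exponential contributes \<gamma>^(-2), which
    cancels the \<gamma>^2 in k.\<close>
  moreover have "k * exp (2 * \<theta> * t_esc \<gamma>) = a * \<theta> / 32 * esc powr \<theta>"
  proof -
    have "exp (2 * \<theta> * t_esc \<gamma>) = exp (2 * t_esc \<gamma>) powr \<theta>" by (simp add: exp_powr_real mult_ac)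
    also have "\<dots> = esc powr \<theta> * \<gamma> powr ((1 - p) * \<theta>)"
      using \<gamma> esc_pos by (simp add: exp_t_esc powr_mult powr_powr)
    also have "(1 - p) * \<theta> = - 2" using p1 by (simp add: \<theta>_def field_simps)
    also have "\<gamma> powr - 2 = 1 / \<gamma>\<^sup>2" using \<gamma> by (simp add: powr_minus powr_numeral field_simps)
    finally show ?thesis using \<gamma> \<theta>_pos by (simp add: k_def field_simps power2_eq_square)
  qed
  ultimately have "En (t_esc \<gamma>) (v (t_esc \<gamma>)) (y (t_esc \<gamma>)) \<le> - (a * \<theta> / 32 * esc powr \<theta>)"
    unfolding D_def by linarith
  then show thesis using that sol E0 unfolding v_def by blast
qed

text \<open>\<open>E + \<epsilon> * y * F(v)\<close>, \<open>F v = v powr p - L * v\<close>, is a strict Lyapunov function up to \<open>exp (4 * t)\<close>: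
  it forces the solution to come close to the rest point \<open>(A, 0)\<close> after a bounded time.\<close>

definition F :: "real \<Rightarrow> real" where "F v = v powr p - L * v"

text \<open>On v > 0 the function F v = v (v^(p-1) - L) vanishes only at A; the lower bound m keeps
  v away from its other zero, 0.\<close>

lemma F_near_A:
  assumes "0 < m" "0 < \<rho>" "\<rho> < A"
  obtains \<eta> where "0 < \<eta>" "\<And>v. m \<le> v \<Longrightarrow> \<bar>F v\<bar> < \<eta> \<Longrightarrow> \<bar>v - A\<bar> < \<rho>"
proof
  define \<eta> where "\<eta> = m * min ((A + \<rho>) powr (p - 1) - L) (L - (A - \<rho>) powr (p - 1))"
  have "L < (A + \<rho>) powr (p - 1)" "(A - \<rho>) powr (p - 1) < L"
    using assms p1 A_pos powr_less_mono2[of "p - 1" A "A + \<rho>"] powr_less_mono2[of "p - 1" "A - \<rho>" A]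
    by (auto simp: A_powr)
  then show "0 < \<eta>" using assms by (simp add: \<eta>_def)
  fix v assume v: "m \<le> v" "\<bar>F v\<bar> < \<eta>"
  have Fv: "F v = v * (v powr (p - 1) - L)" using v assms by (simp add: F_def powr_p algebra_simps)
  show "\<bar>v - A\<bar> < \<rho>"
  proof (rule ccontr)
    assume "\<not> ?thesis"
    then consider "A + \<rho> \<le> v" | "v \<le> A - \<rho>" by linarith
    then have "min ((A + \<rho>) powr (p - 1) - L) (L - (A - \<rho>) powr (p - 1)) \<le> \<bar>v powr (p - 1) - L\<bar>"
    proof cases
      case 1
      then have "(A + \<rho>) powr (p - 1) \<le> v powr (p - 1)" using p1 A_pos assms by (intro powr_mono2) auto
      then show ?thesis by linarith
    next
      case 2
      then have "v powr (p - 1) \<le> (A - \<rho>) powr (p - 1)" using p1 v assms by (intro powr_mono2) auto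
      then show ?thesis by linarith
    qed
    then have "\<eta> \<le> v * \<bar>v powr (p - 1) - L\<bar>"
      unfolding \<eta>_def using v assms \<open>0 < \<eta>\<close>[unfolded \<eta>_def] by (intro mult_mono) (auto simp: zero_less_mult_iff)
    also have "\<dots> = \<bar>F v\<bar>" using Fv v assms by (simp add: abs_mult)
    finally show False using v by simp
  qed
qed

text \<open>While the solution stays outside the target, y^2 + F(v)^2 >= \<eta> and the Lyapunov
  function falls at a fixed rate. It is bounded, so this cannot last for a time D.\<close>

lemma approach:
  assumes \<delta>0: "0 < \<delta>0" and \<delta>: "0 < \<delta>"
  obtains D T where "0 < D" "T \<le> 0"
    "\<And>t1 v y. ef_sol t1 v y \<Longrightarrow> En t1 (v t1) (y t1) \<le> - \<delta>0 \<Longrightarrow> t1 + D \<le> T \<Longrightarrow>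
      \<exists>t\<in>{t1..t1 + D}. (y t)\<^sup>2 / 2 + pot (v t) < pot A + \<delta>"
proof -
  define M where "M = Vmax 0"
  have M: "0 < M" using Vmax_pos by (simp add: M_def)
  \<comment> \<open>Energy at most - \<delta>0 at times t <= 0 forces v^2 >= 2 \<delta>0 / (L +
    1).\<close>
  define m where "m = sqrt (2 * \<delta>0 / (L + 1))"
  have m: "0 < m" using \<delta>0 L_pos by (simp add: m_def)
  have "isCont pot A"
    using pot_deriv[OF A_pos] by (rule DERIV_isCont)
  then obtain \<rho>' where \<rho>': "0 < \<rho>'" "\<And>x. \<bar>x - A\<bar> < \<rho>' \<Longrightarrow> \<bar>pot x - pot A\<bar> < \<delta> / 2"
    unfolding continuous_at_eps_delta using half_gt_zero[OF \<delta>] by (metis dist_real_def)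
  define \<rho> where "\<rho> = min \<rho>' (A / 2)"
  have \<rho>: "0 < \<rho>" "\<rho> < A" "\<rho> \<le> \<rho>'" using \<rho>'(1) A_pos by (auto simp: \<rho>_def)
  obtain \<eta>' where \<eta>': "0 < \<eta>'" "\<And>v. m \<le> v \<Longrightarrow> \<bar>F v\<bar> < \<eta>' \<Longrightarrow> \<bar>v - A\<bar> < \<rho>"
    using F_near_A[OF m \<rho>(1,2)] by blast
  define \<eta> where "\<eta> = min \<delta> (\<eta>'\<^sup>2)"
  have \<eta>: "0 < \<eta>" using \<delta> \<eta>' by (simp add: \<eta>_def)
  have near: "y\<^sup>2 / 2 + pot v < pot A + \<delta>" if "m \<le> v" "y\<^sup>2 + (F v)\<^sup>2 < \<eta>" for v y
  proof -
    have "y\<^sup>2 < \<delta>" "(F v)\<^sup>2 < \<eta>'\<^sup>2" using that(2) zero_le_power2[of y] zero_le_power2[of "F v"]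
      unfolding \<eta>_def by linarith+
    then have "\<bar>F v\<bar> < \<eta>'" using \<eta>'(1) by (metis less_imp_le power2_abs power2_less_imp_less)
    then have "\<bar>pot v - pot A\<bar> < \<delta> / 2" using \<eta>'(2) that(1) \<rho>(3) \<rho>'(2) by force
    then show ?thesis using \<open>y\<^sup>2 < \<delta>\<close> by linarith
  qed
  define B where "B = p * M powr (p - 1) + L"
  have B: "0 < B" using p1 L_pos by (simp add: B_def add_nonneg_pos)
  \<comment> \<open>With this choice the y^2 terms produced by \<epsilon> * y * F(v) use up exactly
    half of the damping.\<close>
  define \<epsilon> where "\<epsilon> = a / (2 * (B + a\<^sup>2))"
  have Ba: "0 < B + a\<^sup>2" using B by (simp add: add_pos_nonneg)
  have \<epsilon>: "0 < \<epsilon>" "\<epsilon> * (B + a\<^sup>2) = a / 2"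
  proof -
    have "a / (2 * S) * S = a / 2" if "0 < S" for S using that by simp
    then show "\<epsilon> * (B + a\<^sup>2) = a / 2" unfolding \<epsilon>_def using Ba by blast
  qed (use a_pos Ba in \<open>auto simp: \<epsilon>_def\<close>)
  define c where "c = min (a / 2) (\<epsilon> / 2)"
  have c: "0 < c" using a_pos \<epsilon> by (simp add: c_def)
  define F0 where "F0 = M powr p + L * M"
  define Y0 where "Y0 = sqrt ((L + 1) * M\<^sup>2)"
  define B2 where "B2 = (L + 1) * M\<^sup>2 + \<epsilon> * Y0 * F0"
  have B2: "0 < B2" using M L_pos \<epsilon> by (auto simp: B2_def Y0_def F0_def intro!: add_pos_nonneg)
  \<comment> \<open>B2 bounds both the range of the energy and the cross term, so the Lyapunov
    function varies by at most 2 B2. The decay rate is c \<eta> / 2; the extra 1 makes the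
    contradiction strict.\<close>
  define D where "D = 4 * B2 / (c * \<eta>) + 1"
  have D: "0 < D" using B2 c \<eta> by (simp add: D_def add_pos_pos)
  have q: "0 < min 1 (c * \<eta> / (2 * \<epsilon> * M\<^sup>2))" using c \<eta> \<epsilon> M by simp
  obtain T where T: "T \<le> 0" "\<And>t. t \<le> T \<Longrightarrow> exp (2 * t) \<le> min 1 (c * \<eta> / (2 * \<epsilon> * M\<^sup>2))"
    using exp_small[OF q] by blast
  have exp4: "\<epsilon> * (exp (2 * t) * M)\<^sup>2 \<le> c * \<eta> / 2" if "t \<le> T" for t
  proof -
    have "exp (2 * t) * exp (2 * t) \<le> 1 * (c * \<eta> / (2 * \<epsilon> * M\<^sup>2))"
      using T(2)[OF that] by (intro mult_mono) auto
    then have "\<epsilon> * M\<^sup>2 * (exp (2 * t) * exp (2 * t)) \<le> \<epsilon> * M\<^sup>2 * (c * \<eta> / (2 * \<epsilon> * M\<^sup>2))"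
      using \<epsilon> by (intro mult_left_mono) auto
    also have "\<dots> = c * \<eta> / 2" using \<epsilon> M by simp
    finally show ?thesis by (simp add: power2_eq_square mult_ac)
  qed
  show thesis
  proof (rule that[OF D T(1)], rule ccontr)
    fix t1 v y
    assume sol: "ef_sol t1 v y" and E1: "En t1 (v t1) (y t1) \<le> - \<delta>0" and t1: "t1 + D \<le> T"
      and far: "\<not> (\<exists>t\<in>{t1..t1 + D}. (y t)\<^sup>2 / 2 + pot (v t) < pot A + \<delta>)"
    have bds: "0 < v t" "v t \<le> M" "m \<le> v t" "(y t)\<^sup>2 \<le> (L + 1) * M\<^sup>2"
      "- ((L + 1) * M\<^sup>2) \<le> En t (v t) (y t)" "En t (v t) (y t) \<le> 0" if t: "t1 \<le> t" "t \<le> t1 + D" for t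
    proof -
      have t0: "t \<le> 0" using t t1 T(1) by linarith
      show v: "0 < v t" using sol t(1) by (rule ef_sol_pos)
      have E: "En t (v t) (y t) \<le> - \<delta>0" using ef_sol_En_antimono[OF sol order_refl t(1)] E1 by simp
      then show E0: "En t (v t) (y t) \<le> 0" using \<delta>0 by simp
      show vM: "v t \<le> M" using En_bounds(1)[OF v E0] Vmax_mono[OF t0] by (simp add: M_def)
      have L1: "L + exp (2 * t) \<le> L + 1" using t0 by simp
      have "(y t)\<^sup>2 \<le> (L + exp (2 * t)) * (v t)\<^sup>2" using En_bounds(2)[OF v E0] .
      also have "\<dots> \<le> (L + 1) * M\<^sup>2" using L1 vM v L_pos by (intro mult_mono power_mono) auto
      finally show "(y t)\<^sup>2 \<le> (L + 1) * M\<^sup>2" .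
      have "0 \<le> v t powr (p + 1) / (p + 1)" using p1 by simp
      then have lowE: "- ((L + exp (2 * t)) * (v t)\<^sup>2 / 2) \<le> En t (v t) (y t)"
      proof -
        have "- ((x + z) / 2) \<le> Y / 2 + (w - x / 2) - z / 2" if "0 \<le> w" "0 \<le> Y" for x z Y w :: real
          using that by (simp add: field_simps)
        from this[OF \<open>0 \<le> v t powr (p + 1) / (p + 1)\<close> zero_le_power2[of "y t"]] show ?thesis
          unfolding En_def pot_def distrib_right .
      qed
      have "(L + exp (2 * t)) * (v t)\<^sup>2 \<le> (L + 1) * (v t)\<^sup>2" using L1 by (intro mult_right_mono) auto
      then have "2 * \<delta>0 / (L + 1) \<le> (v t)\<^sup>2" using lowE E L_pos by (simp add: field_simps)
      then show "m \<le> v t" unfolding m_def using v by (intro real_le_lsqrt) auto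
      have "(L + exp (2 * t)) * (v t)\<^sup>2 \<le> (L + 1) * M\<^sup>2" using L1 vM v L_pos by (intro mult_mono power_mono) auto
      moreover have "0 \<le> (L + 1) * M\<^sup>2" using L_pos by simp
      ultimately show "- ((L + 1) * M\<^sup>2) \<le> En t (v t) (y t)" using lowE by linarith
    qed
    \<comment> \<open>The linear term encodes the decay rate: the decay c \<eta>, reduced by at most
      c \<eta> / 2 from the e^(4t) error, still makes Z nonincreasing.\<close>
    define Z where "Z t = En t (v t) (y t) + \<epsilon> * (y t * F (v t)) + c * \<eta> / 2 * t" for t
    have cross: "\<bar>\<epsilon> * (y t * F (v t))\<bar> \<le> \<epsilon> * Y0 * F0" if t: "t1 \<le> t" "t \<le> t1 + D" for t
    proof -
      have "\<bar>y t\<bar> \<le> Y0" unfolding Y0_def using bds(4)[OF t] by (metis real_sqrt_abs real_sqrt_le_iff)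
      moreover have "\<bar>F (v t)\<bar> \<le> F0"
      proof -
        have "v t powr p \<le> M powr p" using bds(1,2)[OF t] p1 by (intro powr_mono2) auto
        moreover have "L * v t \<le> L * M" using bds(2)[OF t] L_pos by simp
        moreover have "0 \<le> L * v t" using bds(1)[OF t] L_pos by simp
        ultimately show ?thesis unfolding F_def F0_def using powr_ge_zero[of "v t" p] by linarith
      qed
      ultimately have "\<bar>y t\<bar> * \<bar>F (v t)\<bar> \<le> Y0 * F0" by (intro mult_mono) auto
      then have "\<epsilon> * (\<bar>y t\<bar> * \<bar>F (v t)\<bar>) \<le> \<epsilon> * (Y0 * F0)" using \<epsilon> by (intro mult_left_mono) auto
      then show ?thesis using \<epsilon> by (simp add: abs_mult mult_ac)
    qed
    have "Z (t1 + D) \<le> Z t1"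
    proof (rule DERIV_nonpos_imp_decreasing_open[of t1 "t1 + D" Z])
      have vc: "continuous_on {t1..t1 + D} v" and yc: "continuous_on {t1..t1 + D} y"
        using sol by (auto simp: ef_sol_def intro: continuous_on_subset)
      have "continuous_on {t1..t1 + D} (\<lambda>t. v t powr q)" if "0 < q" for q
        using bds(1) that by (intro continuous_on_powr' vc continuous_on_const) (auto simp: less_imp_le)
      then show "continuous_on {t1..t1 + D} Z"
        unfolding Z_def En_def pot_def F_def using p1
        by (intro continuous_on_add continuous_on_diff continuous_on_mult continuous_on_divide
            continuous_on_power continuous_on_const continuous_on_id continuous_on_exp vc yc) auto
      fix t assume "t1 < t" "t < t1 + D"
      then have t: "t1 \<le> t" "t \<le> t1 + D" and tT: "t \<le> T" and der: "(v has_real_derivative y t) (at t)"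
          "(y has_real_derivative ef_rhs t (v t) (y t)) (at t)"
        using sol t1 by (auto simp: ef_sol_def)
      define f where "f = F (v t)"
      define g where "g = exp (2 * t) * v t"
      define F' where "F' = p * v t powr (p - 1) - L"
      have rhs: "ef_rhs t (v t) (y t) = - a * y t - f + g"
        by (simp add: ef_rhs_def f_def g_def F_def algebra_simps)
      have "((\<lambda>t. F (v t)) has_real_derivative F' * y t) (at t)"
        unfolding F_def F'_def
        by (rule DERIV_cong[OF DERIV_diff[OF powr_comp_deriv[OF der(1) bds(1)[OF t]] DERIV_cmult[OF der(1)]]])
          (simp add: algebra_simps)
      from DERIV_mult[OF der(2) this] have "((\<lambda>t. y t * F (v t)) has_real_derivative
          (- a * y t - f + g) * f + F' * y t * y t) (at t)" by (simp add: rhs f_def)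
      moreover have "((\<lambda>t. c * \<eta> / 2 * t) has_real_derivative c * \<eta> / 2) (at t)"
        by (auto intro!: derivative_eq_intros)
      ultimately have "(Z has_real_derivative - a * (y t)\<^sup>2 - exp (2 * t) * (v t)\<^sup>2
          + \<epsilon> * ((- a * y t - f + g) * f + F' * y t * y t) + c * \<eta> / 2) (at t)"
        unfolding Z_def by (intro DERIV_add ef_En_deriv bds(1)[OF t] der DERIV_cmult)
      moreover have "- a * (y t)\<^sup>2 - exp (2 * t) * (v t)\<^sup>2
          + \<epsilon> * ((- a * y t - f + g) * f + F' * y t * y t) + c * \<eta> / 2 \<le> 0"
      proof -
        have 0: "0 \<le> exp (2 * t) * (v t)\<^sup>2" by simp
        have F'B: "F' \<le> B"
        proof -
          have "p * v t powr (p - 1) \<le> p * M powr (p - 1)"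
            using bds(1,2)[OF t] p1 by (intro mult_left_mono powr_mono2) auto
          then show ?thesis unfolding F'_def B_def using L_pos by linarith
        qed
        have "0 \<le> (a * y t + f / 2)\<^sup>2" by simp
        then have 1: "- a * y t * f \<le> a\<^sup>2 * (y t)\<^sup>2 + f\<^sup>2 / 4"
          by (simp add: power2_eq_square algebra_simps)
        have "0 \<le> (g - f / 2)\<^sup>2" by simp
        then have 2: "g * f \<le> g\<^sup>2 + f\<^sup>2 / 4" by (simp add: power2_eq_square algebra_simps)
        have 3: "F' * y t * y t \<le> B * (y t)\<^sup>2"
          using mult_right_mono[OF F'B, of "(y t)\<^sup>2"] by (simp add: power2_eq_square mult.assoc)
        have "(- a * y t - f + g) * f + F' * y t * y t = - a * y t * f + g * f + F' * y t * y t - f\<^sup>2"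
          by (simp add: power2_eq_square algebra_simps)
        also have "\<dots> \<le> (B + a\<^sup>2) * (y t)\<^sup>2 - f\<^sup>2 / 2 + g\<^sup>2"
          using 1 2 3 unfolding distrib_right by linarith
        finally have "\<epsilon> * ((- a * y t - f + g) * f + F' * y t * y t)
            \<le> \<epsilon> * ((B + a\<^sup>2) * (y t)\<^sup>2 - f\<^sup>2 / 2 + g\<^sup>2)" using \<epsilon> by (intro mult_left_mono) auto
        also have "\<dots> = \<epsilon> * (B + a\<^sup>2) * (y t)\<^sup>2 - \<epsilon> / 2 * f\<^sup>2 + \<epsilon> * g\<^sup>2" by (simp add: algebra_simps)
        also have "\<dots> = a / 2 * (y t)\<^sup>2 - \<epsilon> / 2 * f\<^sup>2 + \<epsilon> * g\<^sup>2" by (simp only: \<epsilon>(2))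
        finally have 4: "\<epsilon> * ((- a * y t - f + g) * f + F' * y t * y t)
            \<le> a / 2 * (y t)\<^sup>2 - \<epsilon> / 2 * f\<^sup>2 + \<epsilon> * g\<^sup>2" .
        have "g\<^sup>2 \<le> (exp (2 * t) * M)\<^sup>2"
          unfolding g_def using bds(1,2)[OF t] by (intro power_mono mult_left_mono) auto
        then have "\<epsilon> * g\<^sup>2 \<le> \<epsilon> * (exp (2 * t) * M)\<^sup>2" using \<epsilon> by (intro mult_left_mono) auto
        then have 5: "\<epsilon> * g\<^sup>2 \<le> c * \<eta> / 2" using exp4[OF tT] by linarith
        have "\<not> (y t)\<^sup>2 + f\<^sup>2 < \<eta>" using near[OF bds(3)[OF t], of "y t"] far t unfolding f_def by fastforce
        then have "c * \<eta> \<le> c * ((y t)\<^sup>2 + f\<^sup>2)" using c by (intro mult_left_mono) auto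
        also have "\<dots> \<le> a / 2 * (y t)\<^sup>2 + \<epsilon> / 2 * f\<^sup>2"
          unfolding distrib_left by (intro add_mono mult_right_mono) (auto simp: c_def)
        finally show ?thesis using 0 4 5 by linarith
      qed
      ultimately show "\<exists>z. (Z has_real_derivative z) (at t) \<and> z \<le> 0" by blast
    qed (use D in auto)
    then have "c * \<eta> / 2 * D \<le> 2 * B2"
      using cross[of t1] cross[of "t1 + D"] bds(5,6)[of t1] bds(5,6)[of "t1 + D"] D L_pos
      unfolding Z_def B2_def distrib_left by (simp add: abs_le_iff)
    moreover have "c * \<eta> / 2 * D = 2 * B2 + c * \<eta> / 2" using c \<eta> by (simp add: D_def field_simps)
    ultimately show False using mult_pos_pos[OF c \<eta>] by linarith
  qed
qed

subsection \<open>Oscillation, critical points and convergence\<close>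

definition un_v :: "(real \<Rightarrow> real) \<Rightarrow> real \<Rightarrow> real" where
  "un_v v s = s powr (- \<theta>) * v (ln s)"

definition un_y :: "(real \<Rightarrow> real) \<Rightarrow> (real \<Rightarrow> real) \<Rightarrow> real \<Rightarrow> real" where
  "un_y v y s = s powr (- \<theta>) * (y (ln s) - \<theta> * v (ln s)) / s"

text \<open>The chain rule with t = ln s; \<theta> p = \<theta> + 2 again matches the powers of
  s.\<close>

lemma ef_to_radial:
  assumes sol: "\<And>t0. ef_sol t0 v y"
  shows "radial_sol (un_v v) (un_y v y)"
  unfolding radial_sol_def
proof (intro allI impI conjI)
  fix s :: real assume s: "0 < s"
  have der: "0 < v (ln s)" "(v has_real_derivative y (ln s)) (at (ln s))"
    "(y has_real_derivative ef_rhs (ln s) (v (ln s)) (y (ln s))) (at (ln s))"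
    using sol[of "ln s - 1"] by (auto simp: ef_sol_def)
  define q where "q = s powr (- \<theta>)"
  have dq: "((\<lambda>s. s powr (- \<theta>)) has_real_derivative - \<theta> * q / s) (at s)"
    using has_real_derivative_powr[OF s, of "- \<theta>"] s by (simp add: q_def powr_diff)
  have dv: "((\<lambda>s. v (ln s)) has_real_derivative y (ln s) * (1 / s)) (at s)"
    using DERIV_chain2[of v _ ln, OF der(2) DERIV_ln_divide[OF s]] .
  have dy: "((\<lambda>s. y (ln s)) has_real_derivative ef_rhs (ln s) (v (ln s)) (y (ln s)) * (1 / s)) (at s)"
    using DERIV_chain2[of y _ ln, OF der(3) DERIV_ln_divide[OF s]] .
  show "0 < un_v v s" using s der(1) by (simp add: un_v_def)
  show "(un_v v has_real_derivative un_y v y s) (at s)"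
    unfolding un_v_def
    by (rule DERIV_cong[OF DERIV_mult[OF dq dv]]) (use s in \<open>simp add: un_y_def q_def field_simps\<close>)
  define V where "V = v (ln s)"
  define Y where "Y = y (ln s)"
  have "un_v v s powr p = q powr p * V powr p"
    using der(1) by (simp add: un_v_def q_def V_def powr_mult)
  also have "q powr p = s powr (- (\<theta> * p))" by (simp add: q_def powr_powr)
  also have "\<dots> = q / s\<^sup>2"
    using s unfolding \<theta>_p by (simp add: q_def powr_diff powr_numeral)
  finally have up: "un_v v s powr p = q / s\<^sup>2 * V powr p" .
  have e2: "exp (2 * ln s) = s\<^sup>2" using s by (simp add: exp_double)
  define R where "R = ef_rhs (ln s) V Y"
  have R: "R = - a * Y + (L + s\<^sup>2) * V - V powr p" by (simp add: R_def ef_rhs_def e2)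
  have "(un_y v y has_real_derivative ((- \<theta> * q / s * (Y - \<theta> * V) + (R * (1 / s) - \<theta> * (Y * (1 / s))) * q) * s
      - q * (Y - \<theta> * V) * 1) / (s * s)) (at s)"
    unfolding un_y_def V_def Y_def R_def q_def
    by (rule DERIV_divide[OF DERIV_mult[OF dq[unfolded q_def] DERIV_diff[OF dy DERIV_cmult[OF dv]]] DERIV_ident])
      (use s in auto)
  then show "(un_y v y has_real_derivative - ((real N - 1) / s) * un_y v y s - fnl p (un_v v s)) (at s)"
  proof (rule DERIV_cong)
    have "((- \<theta> * q / s * (Y - \<theta> * V) + (R * (1 / s) - \<theta> * (Y * (1 / s))) * q) * s
      - q * (Y - \<theta> * V) * 1) / (s * s) = q / s\<^sup>2 * (R - \<theta> * (Y - \<theta> * V) - \<theta> * Y - (Y - \<theta> * V))"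
      using s by (simp add: field_simps power2_eq_square)
    also have "R - \<theta> * (Y - \<theta> * V) - \<theta> * Y - (Y - \<theta> * V)
        = - (real N - 1) * (Y - \<theta> * V) + s\<^sup>2 * V - V powr p"
      by (simp add: R a_def L_def algebra_simps)
    also have "q / s\<^sup>2 * (- (real N - 1) * (Y - \<theta> * V) + s\<^sup>2 * V - V powr p)
        = - ((real N - 1) / s) * (q * (Y - \<theta> * V) / s) - (- (q * V) + q / s\<^sup>2 * V powr p)"
      using s by (simp add: field_simps power2_eq_square)
    finally show "((- \<theta> * q / s * (Y - \<theta> * V) + (R * (1 / s) - \<theta> * (Y * (1 / s))) * q) * s
      - q * (Y - \<theta> * V) * 1) / (s * s) = - ((real N - 1) / s) * un_y v y s - fnl p (un_v v s)"
      unfolding fnl_def up by (simp add: un_v_def un_y_def q_def V_def Y_def)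
  qed
qed

text \<open>\<open>s ^ (2 * N - 2) * H s\<close> is nondecreasing and nonnegative, so once it vanishes it has vanished before.\<close>

lemma no_rest_point:
  assumes rad: "radial_sol u u'" and lim: "filterlim u at_top (at_right 0)" and s0: "0 < s0"
  shows "\<not> (u s0 = 1 \<and> u' s0 = 0)"
proof
  assume rest: "u s0 = 1 \<and> u' s0 = 0"
  define H where "H s = (u' s)\<^sup>2 / 2 + G (u s) - G 1" for s
  have Hpos: "G 1 \<le> G (u s)" if "0 < s" for s
  proof -
    have "0 < u s" using rad that by (simp add: radial_sol_def)
    then show ?thesis using G_increasing[of 1 "u s"] G_decreasing[of "u s" 1]
      by (cases "u s" "1 :: real" rule: linorder_cases) auto
  qed
  have u1: "u s = 1" if s: "0 < s" "s < s0" for s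
  proof -
    have "s ^ (2 * N - 2) * H s \<le> s0 ^ (2 * N - 2) * H s0"
    proof (rule DERIV_nonneg_imp_nondecreasing[of s s0 "\<lambda>s. s ^ (2 * N - 2) * H s"])
      fix x assume "s \<le> x" "x \<le> s0"
      then have x: "0 < x" using s by simp
      have "((\<lambda>s. s ^ (2 * N - 2)) has_real_derivative (2 * real N - 2) * x ^ (2 * N - 3)) (at x)"
        using DERIV_pow[of "2 * N - 2" x] N3 by (simp add: of_nat_diff numeral_3_eq_3 numeral_2_eq_2)
      moreover have "(H has_real_derivative - ((real N - 1) / x) * (u' x)\<^sup>2 - 0) (at x)"
        unfolding H_def by (intro DERIV_diff H_deriv[OF rad x] DERIV_const)
      ultimately have "((\<lambda>s. s ^ (2 * N - 2) * H s) has_real_derivative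
          (2 * real N - 2) * x ^ (2 * N - 3) * H x + (- ((real N - 1) / x) * (u' x)\<^sup>2 - 0) * x ^ (2 * N - 2)) (at x)"
        by (rule DERIV_mult)
      \<comment> \<open>The weight s^(2N-2) is chosen so that the u'^2 part of its derivative
        exactly cancels the friction term.\<close>
      moreover have "(2 * real N - 2) * x ^ (2 * N - 3) * H x + (- ((real N - 1) / x) * (u' x)\<^sup>2 - 0) * x ^ (2 * N - 2)
          = (2 * real N - 2) * x ^ (2 * N - 3) * (G (u x) - G 1)"
      proof -
        have "2 * N - 2 = Suc (2 * N - 3)" using N3 by simp
        then have "x ^ (2 * N - 2) = x * x ^ (2 * N - 3)" by simp
        then show ?thesis using x by (simp add: H_def field_simps)
      qed
      moreover have "0 \<le> (2 * real N - 2) * x ^ (2 * N - 3) * (G (u x) - G 1)"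
        using x N3 Hpos[OF x] by (intro mult_nonneg_nonneg) auto
      ultimately show "\<exists>y. ((\<lambda>s. s ^ (2 * N - 2) * H s) has_real_derivative y) (at x) \<and> 0 \<le> y" by auto
    qed (use s in auto)
    also have "\<dots> = 0" using rest by (simp add: H_def)
    finally have "H s \<le> 0" using zero_less_power[OF s(1)] by (metis mult_pos_pos not_le)
    then have "G (u s) \<le> G 1" using zero_le_power2[of "u' s"] unfolding H_def by linarith
    moreover have "0 < u s" using rad s by (simp add: radial_sol_def)
    ultimately show ?thesis using G_increasing[of 1 "u s"] G_decreasing[of "u s" 1] by force
  qed
  have "\<forall>\<^sub>F s in at_right 0. 1 < u s" using lim by (simp add: filterlim_at_top_dense)
  moreover have "\<forall>\<^sub>F s in at_right 0. u s = 1"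
    using eventually_at_right_real[OF s0] by eventually_elim (use u1 in auto)
  ultimately have "\<forall>\<^sub>F s in at_right (0 :: real). False" by eventually_elim simp
  then show False by (simp add: trivial_limit_at_right_real)
qed

text \<open>A bound linear in 1 - u that is uniform up to u = 1, as Riccati's equation for 1 - u
  requires. With x = (p - 1)(1 - u), u^(p-1) <= exp (- x) <= 1/(1 + x), and 1 + x <= p.\<close>

lemma one_minus_powr_ge:
  assumes "0 < u" "u \<le> 1"
  shows "(p - 1) / p * (1 - u) \<le> 1 - u powr (p - 1)"
proof -
  define x where "x = (p - 1) * (1 - u)"
  have x: "0 \<le> x" "x \<le> p - 1" using assms p1 by (auto simp: x_def mult_left_le)
  have "u powr (p - 1) \<le> exp (- x)"
  proof -
    have "(p - 1) * ln u \<le> (p - 1) * (u - 1)" using ln_le_minus_one[OF assms(1)] p1 by (intro mult_left_mono) auto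
    also have "\<dots> = - x" by (simp add: x_def algebra_simps)
    finally show ?thesis using assms by (simp add: powr_def)
  qed
  also have "\<dots> \<le> 1 / (1 + x)"
    using exp_ge_add_one_self[of x] x(1) by (simp add: exp_minus field_simps)
  finally have "x / (1 + x) \<le> 1 - u powr (p - 1)" using x(1) by (simp add: field_simps)
  moreover have "x / p \<le> x / (1 + x)" using x p1 by (intro divide_left_mono) auto
  ultimately show ?thesis by (simp add: x_def)
qed

text \<open>Case \<open>u \<le> 1\<close>: either \<open>u\<close> becomes increasing and Riccati's equation applies to \<open>1 - u\<close>, or it stays
  decreasing and \<open>s\<^sup>N * u\<close> is bounded, against the lower bound that the energy provides.\<close>

lemma oscillation:
  assumes rad: "radial_sol u u'" and rest: "\<And>s. 0 < s \<Longrightarrow> \<not> (u s = 1 \<and> u' s = 0)"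
    and \<delta>: "0 < \<delta>" and low: "\<And>s. 1 \<le> s \<Longrightarrow> \<delta> \<le> s ^ N * (u s)\<^sup>2"
  shows "\<exists>s1>T. u s1 < 1" "\<exists>s2>T. 1 < u s2"
proof -
  define T' where "T' = max T 1"
  have pos: "0 < u s" and du: "(u has_real_derivative u' s) (at s)"
    and du': "(u' has_real_derivative - ((real N - 1) / s) * u' s - fnl p (u s)) (at s)" if "0 < s" for s
    using rad that by (auto simp: radial_sol_def)
  have min: "u' s = 0" if "0 < s" "0 < d" "\<And>x. \<bar>s - x\<bar> < d \<Longrightarrow> u s \<le> u x" for s d
    using DERIV_local_min[OF du[OF that(1)] that(2)] that(3) by blast
  have max: "u' s = 0" if "0 < s" "0 < d" "\<And>x. \<bar>s - x\<bar> < d \<Longrightarrow> u x \<le> u s" for s d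
    using DERIV_local_max[OF du[OF that(1)] that(2)] that(3) by blast
  show "\<exists>s1>T. u s1 < 1"
  proof (rule ccontr)
    assume "\<not> ?thesis"
    then have ge: "1 \<le> u s" if "T' < s" for s using that by (force simp: T'_def)
    \<comment> \<open>If u >= 1 touches 1, this is a local minimum, so u = 1 and u' = 0 there, which
      \<open>rest\<close> excludes.\<close>
    have gt: "1 < u s" if s: "T' < s" for s
    proof (rule ccontr)
      assume "\<not> ?thesis"
      then have u1: "u s = 1" using ge[OF s] by simp
      have "u' s = 0"
        by (rule min[of s "s - T'"]) (use s ge u1 in \<open>auto simp: T'_def abs_if split: if_splits\<close>)
      then show False using rest[of s] u1 s by (auto simp: T'_def)
    qed
    show False
    proof (rule riccati_blowup[of T' "\<lambda>s. u s - 1" u' "real N - 1" "\<lambda>s. fnl p (u s) / (u s - 1)" "p - 1"])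
      fix s assume s: "T' < s"
      then have s0: "0 < s" by (simp add: T'_def)
      show "0 < u s - 1" using gt[OF s] by simp
      show "((\<lambda>s. u s - 1) has_real_derivative u' s) (at s)"
        using du[OF s0] by (auto intro!: derivative_eq_intros)
      show "(u' has_real_derivative - ((real N - 1) / s) * u' s - fnl p (u s) / (u s - 1) * (u s - 1)) (at s)"
        using du'[OF s0] gt[OF s] by simp
      \<comment> \<open>The mean value form of u^p - 1 gives f(u) >= (p - 1)(u - 1), hence the lower
        bound on the coefficient.\<close>
      obtain \<xi> where \<xi>: "min (u s) 1 \<le> \<xi>" "u s powr p - 1 powr p = p * \<xi> powr (p - 1) * (u s - 1)"
        using powr_mean_value[of "u s" 1 p] pos[OF s0] by auto
      have "1 \<le> \<xi> powr (p - 1)" using \<xi>(1) gt[OF s] p1 by (intro ge_one_powr_ge_zero) auto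
      then have "p * 1 * (u s - 1) \<le> p * \<xi> powr (p - 1) * (u s - 1)"
        using gt[OF s] p1 by (intro mult_right_mono mult_left_mono) auto
      then have "(p - 1) * (u s - 1) \<le> fnl p (u s)" using \<xi>(2) by (simp add: fnl_def algebra_simps)
      then show "p - 1 \<le> fnl p (u s) / (u s - 1)" using gt[OF s] by (simp add: field_simps)
    qed (use p1 in auto)
  qed
  show "\<exists>s2>T. 1 < u s2"
  proof (rule ccontr)
    assume "\<not> ?thesis"
    then have le: "u s \<le> 1" if "T' < s" for s using that by (force simp: T'_def)
    have lt: "u s < 1" if s: "T' < s" for s
    proof (rule ccontr)
      assume "\<not> ?thesis"
      then have u1: "u s = 1" using le[OF s] by simp
      have "u' s = 0"
        by (rule max[of s "s - T'"]) (use s le u1 in \<open>auto simp: T'_def abs_if split: if_splits\<close>)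
      then show False using rest[of s] u1 s by (auto simp: T'_def)
    qed
    have fl: "- fnl p (u s) = u s * (1 - u s powr (p - 1))" if "0 < s" for s
      using pos[OF that] by (simp add: fnl_def powr_p algebra_simps)
    show False
    proof (cases "\<exists>s2>T'. 0 < u' s2")
      case True
      then obtain s2 where s2: "T' < s2" "0 < u' s2" by blast
      \<comment> \<open>For u < 1, f(u) < 0, so the flux s^(N-1) u' increases and u' stays positive
        once it is positive.\<close>
      have inc: "0 < u' s" if s: "s2 \<le> s" for s
      proof -
        have "s2 ^ (N - 1) * u' s2 \<le> s ^ (N - 1) * u' s"
        proof (rule DERIV_nonneg_imp_nondecreasing[OF s])
          fix x assume x: "s2 \<le> x" "x \<le> s"
          then have x0: "0 < x" "T' < x" using s2 by (auto simp: T'_def)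
          have "0 \<le> - (x ^ (N - 1)) * fnl p (u x)"
            using fnl_neg[OF pos[OF x0(1)] lt[OF x0(2)]] x0 by (simp add: mult_nonneg_nonpos)
          then show "\<exists>y. ((\<lambda>s. s ^ (N - 1) * u' s) has_real_derivative y) (at x) \<and> 0 \<le> y"
            using flux_deriv[OF rad x0(1)] by blast
        qed
        moreover have "0 < s2 ^ (N - 1) * u' s2" using s2 by (simp add: T'_def)
        ultimately have "0 < s ^ (N - 1) * u' s" by linarith
        then show ?thesis using s s2 by (simp add: zero_less_mult_iff T'_def)
      qed
      have ug: "u s2 \<le> u s" if "s2 \<le> s" for s
      proof (rule DERIV_nonneg_imp_nondecreasing[OF that])
        fix x assume "s2 \<le> x" "x \<le> s"
        then show "\<exists>y. (u has_real_derivative y) (at x) \<and> 0 \<le> y"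
          using du[of x] inc[of x] s2 by (intro exI[of _ "u' x"]) (auto simp: T'_def)
      qed
      show False
      proof (rule riccati_blowup[of s2 "\<lambda>s. 1 - u s" "\<lambda>s. - u' s" "real N - 1"
            "\<lambda>s. - fnl p (u s) / (1 - u s)" "u s2 * ((p - 1) / p)"])
        fix s assume s: "s2 < s"
        then have s0: "0 < s" "T' < s" using s2 by (auto simp: T'_def)
        show "0 < 1 - u s" using lt[OF s0(2)] by simp
        show "((\<lambda>s. 1 - u s) has_real_derivative - u' s) (at s)"
          using du[OF s0(1)] by (auto intro!: derivative_eq_intros)
        have "((\<lambda>s. - u' s) has_real_derivative - (- ((real N - 1) / s) * u' s - fnl p (u s))) (at s)"
          by (rule DERIV_minus[OF du'[OF s0(1)]])
        then show "((\<lambda>s. - u' s) has_real_derivative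
            - ((real N - 1) / s) * - u' s - - fnl p (u s) / (1 - u s) * (1 - u s)) (at s)"
          by (rule DERIV_cong) (use lt[OF s0(2)] in simp)
        have "u s2 * ((p - 1) / p * (1 - u s)) \<le> u s * (1 - u s powr (p - 1))"
          using ug[of s] s one_minus_powr_ge[OF pos[OF s0(1)]] lt[OF s0(2)] pos[of s2] pos[OF s0(1)] p1 s2
          by (intro mult_mono) (auto simp: T'_def)
        then show "u s2 * ((p - 1) / p) \<le> - fnl p (u s) / (1 - u s)"
          using lt[OF s0(2)] unfolding fl[OF s0(1)] by (simp add: pos_le_divide_eq mult.assoc)
      qed (use p1 pos[of s2] s2 in \<open>auto simp: T'_def\<close>)
    next
      case False
      then have dec: "u' s \<le> 0" if "T' < s" for s using that by force
      define s1 where "s1 = T' + 1"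
      have s1: "T' < s1" "1 \<le> s1" by (auto simp: s1_def T'_def)
      have ul: "u s \<le> u s1" if "s1 \<le> s" for s
      proof (rule DERIV_nonpos_imp_nonincreasing[OF that])
        fix x assume "s1 \<le> x" "x \<le> s"
        then show "\<exists>y. (u has_real_derivative y) (at x) \<and> y \<le> 0"
          using du[of x] dec[of x] s1 by (intro exI[of _ "u' x"]) auto
      qed
      define k where "k = 1 - u s1 powr (p - 1)"
      have k: "0 < k"
        using powr_less_mono2[of "p - 1" "u s1" 1] pos[of s1] lt[OF s1(1)] p1 s1 by (simp add: k_def)
      \<comment> \<open>Here - f(u) >= k u and u' <= 0, so the flux grows at least as fast as k u
        s^N / N. Since the flux is nonpositive, K nondecreasing bounds s^N u.\<close>
      define K where "K s = s ^ (N - 1) * u' s - k * (u s * (s ^ N / real N))" for s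
      have Kmono: "K s1 \<le> K s" if "s1 \<le> s" for s
      proof (rule DERIV_nonneg_imp_nondecreasing[OF that])
        fix x assume x: "s1 \<le> x" "x \<le> s"
        then have x0: "0 < x" "T' < x" using s1 by auto
        have "(K has_real_derivative - (x ^ (N - 1)) * fnl p (u x)
            - k * (u' x * (x ^ N / real N) + x ^ (N - 1) * u x)) (at x)"
          unfolding K_def
          by (intro DERIV_diff flux_deriv[OF rad x0(1)] DERIV_cmult DERIV_mult du[OF x0(1)] power_N_deriv)
        moreover have "0 \<le> - (x ^ (N - 1)) * fnl p (u x) - k * (u' x * (x ^ N / real N) + x ^ (N - 1) * u x)"
        proof -
          have "u x powr (p - 1) \<le> u s1 powr (p - 1)"
            using ul[of x] x pos[OF x0(1)] p1 by (intro powr_mono2) auto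
          then have "u x * k \<le> - fnl p (u x)"
            unfolding fl[OF x0(1)] k_def using pos[OF x0(1)] by (intro mult_left_mono) auto
          then have "x ^ (N - 1) * (u x * k) \<le> x ^ (N - 1) * - fnl p (u x)"
            using x0 by (intro mult_left_mono) auto
          moreover have "k * (u' x * (x ^ N / real N)) \<le> 0"
            using k dec[OF x0(2)] x0 by (intro mult_nonneg_nonpos mult_nonpos_nonneg) auto
          ultimately show ?thesis by (simp add: algebra_simps)
        qed
        ultimately show "\<exists>y. (K has_real_derivative y) (at x) \<and> 0 \<le> y" by blast
      qed
      define C where "C = - K s1 * real N / k"
      have bound: "s ^ N * u s \<le> C" if s: "s1 \<le> s" for s
      proof -
        have "s ^ (N - 1) * u' s \<le> 0" using dec[of s] s s1 by (intro mult_nonneg_nonpos) auto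
        then have "k * (u s * (s ^ N / real N)) \<le> - K s1" using Kmono[OF s] by (simp add: K_def)
        then show ?thesis using k N3 by (simp add: C_def field_simps)
      qed
      have C0: "0 < C"
        using bound[of s1] pos[of s1] s1 zero_less_power[of s1 N] by (smt (verit) mult_pos_pos)
      \<comment> \<open>At this point s^N u <= C and s^N u^2 >= \<delta> give \<delta> s^N <= C^2,
        while s^N >= s > C^2 / \<delta>.\<close>
      define s where "s = max s1 (C\<^sup>2 / \<delta> + 1)"
      have s: "s1 \<le> s" "1 \<le> s" "C\<^sup>2 / \<delta> < s" using s1 by (auto simp: s_def)
      have sN: "s \<le> s ^ N" using s(2) N3 by (intro self_le_power) auto
      have "\<delta> * s ^ N \<le> s ^ N * (u s)\<^sup>2 * s ^ N" using low[OF s(2)] s by (intro mult_right_mono) auto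
      also have "\<dots> = (s ^ N * u s)\<^sup>2" by (simp add: power2_eq_square)
      also have "\<dots> \<le> C\<^sup>2" using bound[OF s(1)] pos[of s] s by (intro power_mono) auto
      finally have "s ^ N \<le> C\<^sup>2 / \<delta>" using \<delta> by (simp add: field_simps)
      then show False using sN s(3) by linarith
    qed
  qed
qed

text \<open>At a zero of u' the value u is not 1, so u'' = - f(u) is nonzero and the zero is
  isolated. No zeros lie near 0, hence finitely many below each bound; a maximum above 1 between two
  values below 1 supplies arbitrarily large ones.\<close>

lemma critical_points:
  assumes rad: "radial_sol u u'" and rest: "\<And>s. 0 < s \<Longrightarrow> \<not> (u s = 1 \<and> u' s = 0)"
    and near0: "0 < s0" "\<And>s. 0 < s \<Longrightarrow> s < s0 \<Longrightarrow> u' s \<noteq> 0"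
    and osc: "\<And>T. \<exists>s1>T. u s1 < 1" "\<And>T. \<exists>s2>T. 1 < u s2"
  shows "\<exists>sc :: nat \<Rightarrow> real. strict_mono sc \<and> sc 0 > 0 \<and> filterlim sc at_top sequentially \<and>
     {s. 0 < s \<and> u' s = 0} = range sc"
proof (rule enumerate_discrete)
  have pos: "0 < u s" and du: "(u has_real_derivative u' s) (at s)"
    and du': "(u' has_real_derivative - ((real N - 1) / s) * u' s - fnl p (u s)) (at s)" if "0 < s" for s
    using rad that by (auto simp: radial_sol_def)
  show "finite ({s. 0 < s \<and> u' s = 0} \<inter> {..b})" for b
  proof (rule ccontr)
    let ?Z = "{s. 0 < s \<and> u' s = 0} \<inter> {..b}"
    assume "infinite ?Z"
    moreover have "?Z \<subseteq> {s0..b}" using near0(2) by (auto simp: not_less[symmetric])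
    ultimately obtain x where x: "x \<in> {s0..b}" "x islimpt ?Z"
      using compact_eq_Bolzano_Weierstrass[THEN iffD1, OF compact_Icc] by blast
    have x0: "0 < x" using x near0(1) by auto
    have "\<forall>\<^sub>F h in at x. u' h \<noteq> 0"
    proof (cases "u' x = 0")
      case False
      have "(u' \<longlongrightarrow> u' x) (at x)" using DERIV_isCont[OF du'[OF x0]] by (simp add: isCont_def)
      then show ?thesis using False by (rule tendsto_imp_eventually_ne)
    next
      case True
      then have "u x \<noteq> 1" using rest[OF x0] by blast
      then have "fnl p (u x) \<noteq> 0"
        using fnl_pos[of "u x"] fnl_neg[of "u x"] pos[OF x0] by (cases "u x < 1") auto
      moreover have "((\<lambda>h. (u' h - u' x) / (h - x)) \<longlongrightarrow> - fnl p (u x)) (at x)"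
        using du'[OF x0] True by (simp add: has_field_derivative_iff)
      ultimately have "\<forall>\<^sub>F h in at x. (u' h - u' x) / (h - x) \<noteq> 0"
        by (metis tendsto_imp_eventually_ne neg_equal_0_iff_equal)
      then show ?thesis by eventually_elim (use True in auto)
    qed
    then have "\<forall>\<^sub>F h in at x. h \<notin> ?Z" by eventually_elim auto
    then show False using x(2) by (simp add: islimpt_iff_eventually)
  qed
  show "\<exists>z\<in>{s. 0 < s \<and> u' s = 0}. T < z" for T
  proof -
    obtain s1 where s1: "max T 0 < s1" "u s1 < 1" using osc(1) by blast
    obtain s2 where s2: "s1 < s2" "1 < u s2" using osc(2) by blast
    obtain s3 where s3: "s2 < s3" "u s3 < 1" using osc(1) by blast
    have "continuous_on {s1..s3} u"
    proof (intro continuous_at_imp_continuous_on ballI)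
      show "isCont u x" if "x \<in> {s1..s3}" for x
        using DERIV_isCont[OF du[of x]] that s1 by auto
    qed
    then obtain x where x: "x \<in> {s1..s3}" "\<And>y. y \<in> {s1..s3} \<Longrightarrow> u y \<le> u x"
      using continuous_attains_sup[of "{s1..s3}" u] s2 s3 by auto
    have "1 < u x" using x(2)[of s2] s2 s3 by auto
    then have xs: "s1 < x" "x < s3" using x(1) s1 s3 by (auto simp: le_less)
    have "u' x = 0"
    proof (rule DERIV_local_max[OF du])
      show "0 < min (x - s1) (s3 - x)" using xs by simp
      show "\<forall>y. \<bar>x - y\<bar> < min (x - s1) (s3 - x) \<longrightarrow> u y \<le> u x"
        using x(2) by (auto simp: abs_if split: if_splits)
    qed (use xs s1 in auto)
    then show ?thesis using xs s1 by (intro bexI[of _ x]) auto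
  qed
qed auto

section \<open>The singular solution near 0 and for large s, and the limit of large initial
  values\<close>

lemma un_v_at_top:
  assumes "(v \<longlongrightarrow> A) at_bot"
  shows "filterlim (un_v v) at_top (at_right 0)"
proof -
  have "filterlim (\<lambda>s. - \<theta> * ln s) at_top (at_right (0 :: real))"
    using filterlim_tendsto_pos_mult_at_bot[OF tendsto_const \<theta>_pos ln_at_0]
    by (simp add: filterlim_uminus_at_top)
  then have "filterlim (\<lambda>s. exp (- \<theta> * ln s)) at_top (at_right (0 :: real))"
    by (rule filterlim_compose[OF exp_at_top])
  moreover have "((\<lambda>s. v (ln s)) \<longlongrightarrow> A) (at_right 0)"
    using assms ln_at_0 by (rule filterlim_compose)
  ultimately have "filterlim (\<lambda>s. v (ln s) * exp (- \<theta> * ln s)) at_top (at_right 0)"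
    using A_pos filterlim_tendsto_pos_mult_at_top by blast
  then show ?thesis
  proof (rule filterlim_mono_eventually)
    show "\<forall>\<^sub>F s in at_right 0. v (ln s) * exp (- \<theta> * ln s) = un_v v s"
      using eventually_at_right_less[of 0] by eventually_elim (simp add: un_v_def powr_def)
  qed auto
qed

lemma un_y_neg_near_0:
  assumes "(v \<longlongrightarrow> A) at_bot" "(y \<longlongrightarrow> 0) at_bot"
  obtains s0 where "0 < s0" "\<And>s. 0 < s \<Longrightarrow> s < s0 \<Longrightarrow> un_y v y s \<noteq> 0"
proof -
  have "((\<lambda>t. y t - \<theta> * v t) \<longlongrightarrow> 0 - \<theta> * A) at_bot" by (intro tendsto_intros assms)
  then have "\<forall>\<^sub>F t in at_bot. y t - \<theta> * v t < 0"
    by (rule order_tendstoD(2)) (use \<theta>_pos A_pos in simp)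
  then obtain T where T: "\<And>t. t \<le> T \<Longrightarrow> y t - \<theta> * v t < 0" by (auto simp: eventually_at_bot_linorder)
  show thesis
  proof (rule that[of "exp T"])
    fix s assume s: "0 < s" "s < exp T"
    then have "ln s \<le> T" by (metis less_imp_le ln_exp ln_less_cancel_iff exp_gt_zero)
    then show "un_y v y s \<noteq> 0" using T[of "ln s"] s by (auto simp: un_y_def)
  qed simp
qed

text \<open>Negative energy gives (L + s^2) v^2 >= - 2 pot A with v = s^\<theta> u. For s >= 1 the
  power s^(2 + 2 \<theta>) is at most s^N, since a > 0.\<close>

lemma energy_lower_bound:
  assumes sol: "\<And>t0. ef_sol t0 v y" and En: "\<And>t. En t (v t) (y t) \<le> pot A" and s: "1 \<le> s"
  shows "- 2 * pot A / (L + 1) \<le> s ^ N * (un_v v s)\<^sup>2"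
proof -
  have s0: "0 < s" using s by simp
  have v0: "0 < v (ln s)" using sol ef_sol_pos by blast
  have vs: "v (ln s) = s powr \<theta> * un_v v s" using s0 by (simp add: un_v_def powr_minus)
  have "- pot A \<le> (L + exp (2 * ln s)) * (v (ln s))\<^sup>2 / 2"
  proof -
    have "0 \<le> v (ln s) powr (p + 1) / (p + 1)" using p1 by simp
    moreover have "- P \<le> (x + z) / 2"
      if "0 \<le> w" "Y / 2 + (w - x / 2) - z / 2 \<le> P" "0 \<le> Y" for P x z w Y :: real
      using that by (simp add: field_simps)
    ultimately show ?thesis
      using En[of "ln s"] zero_le_power2[of "y (ln s)"] unfolding En_def pot_def[of "v (ln s)"] distrib_right by blast
  qed
  also have "exp (2 * ln s) = s\<^sup>2" using s0 by (simp add: exp_double)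
  finally have "- 2 * pot A \<le> (L + s\<^sup>2) * (v (ln s))\<^sup>2" by simp
  also have "\<dots> \<le> ((L + 1) * s\<^sup>2) * (v (ln s))\<^sup>2"
  proof -
    have "1 \<le> s\<^sup>2" using s by simp
    then have "L * 1 \<le> L * s\<^sup>2" using L_pos by (intro mult_left_mono) auto
    then show ?thesis by (intro mult_right_mono) (auto simp: distrib_right)
  qed
  also have "\<dots> = (L + 1) * (s\<^sup>2 * (s powr \<theta>)\<^sup>2 * (un_v v s)\<^sup>2)"
    by (simp add: vs power_mult_distrib)
  also have "\<dots> \<le> (L + 1) * (s ^ N * (un_v v s)\<^sup>2)"
  proof -
    have "s\<^sup>2 * (s powr \<theta>)\<^sup>2 = s powr (2 + 2 * \<theta>)"
    proof -
      have "s powr (2 + 2 * \<theta>) = s powr 2 * (s powr \<theta> * s powr \<theta>)"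
        by (simp only: mult_2[of \<theta>] powr_add)
      then show ?thesis using s0 by (simp add: powr_numeral power2_eq_square)
    qed
    also have "\<dots> \<le> s powr (real N)" using s a_pos by (intro powr_mono) (auto simp: a_def)
    also have "\<dots> = s ^ N" using s0 by (simp add: powr_realpow)
    finally show ?thesis using L_pos by (intro mult_left_mono mult_right_mono) auto
  qed
  finally show ?thesis using L_pos by (simp add: field_simps)
qed

text \<open>The regular solution is trapped from a time t0 <= \<open>t_esc \<gamma>\<close> + D
  onwards, and the singular one is near A at all times up to T. As \<gamma> grows, t0 tends to
  -infinity and \<open>comparison\<close> makes the gap vanish.\<close>

lemma convergence:
  assumes sol: "\<And>t0. ef_sol t0 v y" and En: "\<And>t. En t (v t) (y t) \<le> pot A"
    and ivp: "\<And>\<gamma>. 0 < \<gamma> \<Longrightarrow> ivp_sol N p \<gamma> (U \<gamma>)" and lo: "0 < lo" "lo \<le> hi"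
  shows "uniform_limit {lo..hi} U (un_v v) at_top"
proof (rule uniform_limitI)
  fix e :: real assume e: "0 < e"
  obtain \<rho> T0 c where \<rho>: "0 < \<rho>" "\<rho> < A" "0 < c" "T0 \<le> 0" and
    cmp: "\<And>T b. T \<le> T0 \<Longrightarrow> \<exists>K>0. \<forall>t0 v y w z t. trapped \<rho> T t0 v y \<longrightarrow> trapped \<rho> T t0 w z \<longrightarrow> t \<in> {T..b} \<longrightarrow>
       gap v y w z t \<le> K * exp (- c * (T - t0))"
    by (rule comparison) blast
  obtain \<delta> T1 where \<delta>: "0 < \<delta>" and
    trap: "\<And>t0 v y t. ef_sol t0 v y \<Longrightarrow> En t0 (v t0) (y t0) \<le> 0 \<Longrightarrow>
       (y t0)\<^sup>2 / 2 + pot (v t0) < pot A + \<delta> \<Longrightarrow> t0 \<le> t \<Longrightarrow> t \<le> T1 \<Longrightarrow> \<bar>v t - A\<bar> < \<rho>"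
    using trapping[OF \<rho>(1,2)] by metis
  define \<delta>0 where "\<delta>0 = a * \<theta> / 32 * esc powr \<theta>"
  have \<delta>0: "0 < \<delta>0" using a_pos \<theta>_pos esc_pos by (simp add: \<delta>0_def)
  obtain D T2 where D: "0 < D" and
    appr: "\<And>t1 v y. ef_sol t1 v y \<Longrightarrow> En t1 (v t1) (y t1) \<le> - \<delta>0 \<Longrightarrow> t1 + D \<le> T2 \<Longrightarrow>
      \<exists>t\<in>{t1..t1 + D}. (y t)\<^sup>2 / 2 + pot (v t) < pot A + \<delta>"
    using approach[OF \<delta>0 \<delta>] by metis
  have "\<forall>\<^sub>F t in at_bot. dist (v t) A < \<rho>"
    using singular_ef_sol_limit(1)[OF sol En] \<rho>(1) by (rule tendstoD)
  then obtain T3 where T3: "\<And>t. t \<le> T3 \<Longrightarrow> \<bar>v t - A\<bar> < \<rho>"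
    by (auto simp: eventually_at_bot_linorder dist_real_def)
  define T where "T = Min {T0, T1, T2, T3, ln lo}"
  have T: "T \<le> T0" "T \<le> T1" "T \<le> T2" "T \<le> T3" "T \<le> ln lo" by (auto simp: T_def)
  obtain K where K: "0 < K" and cmpK: "\<And>t0 v y w z t. trapped \<rho> T t0 v y \<Longrightarrow> trapped \<rho> T t0 w z \<Longrightarrow>
       t \<in> {T..ln hi} \<Longrightarrow> gap v y w z t \<le> K * exp (- c * (T - t0))"
    using cmp[OF T(1), of "ln hi"] by blast
  \<comment> \<open>Returning from v to u multiplies the error by s^(- \<theta>), which on [lo, hi]
    is largest at lo.\<close>
  define e' where "e' = e * lo powr \<theta>"
  have e': "0 < e'" using e lo by (simp add: e'_def)
  \<comment> \<open>If \<open>t_esc \<gamma>\<close> <= T4, trapping begins before T and c (T - t0)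
    >= ln (K / e'^2) + 1, so the squared error drops strictly below e'^2.\<close>
  define T4 where "T4 = min (T - D) (T - D - (ln (K / e'\<^sup>2) + 1) / c)"
  have "\<forall>\<^sub>F \<gamma> in at_top. t_esc \<gamma> \<le> T4"
    using t_esc_at_bot by (simp add: filterlim_at_bot)
  then show "\<forall>\<^sub>F \<gamma> in at_top. \<forall>s\<in>{lo..hi}. dist (U \<gamma> s) (un_v v s) < e"
    using eventually_gt_at_top[of 1]
  proof eventually_elim
    case (elim \<gamma>)
    have "ivp_sol N p \<gamma> (U \<gamma>)" using ivp elim by simp
    then obtain x where x: "\<And>t0. ef_sol t0 (ef_v (U \<gamma>)) x" "\<And>t. En t (ef_v (U \<gamma>) t) (x t) \<le> 0"
      "En (t_esc \<gamma>) (ef_v (U \<gamma>) (t_esc \<gamma>)) (x (t_esc \<gamma>)) \<le> - \<delta>0"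
      using ivp_energy[of \<gamma> "U \<gamma>"] elim unfolding \<delta>0_def by metis
    have tD: "t_esc \<gamma> + D \<le> T" using elim by (simp add: T4_def)
    obtain t0 where t0: "t0 \<in> {t_esc \<gamma>..t_esc \<gamma> + D}" "(x t0)\<^sup>2 / 2 + pot (ef_v (U \<gamma>) t0) < pot A + \<delta>"
      using appr[OF x(1,3)] tD T(3) by fastforce
    have "trapped \<rho> T t0 (ef_v (U \<gamma>)) x"
      using x(1,2) t0 tD T(2) trap[OF x(1,2) t0(2)] by (auto simp: trapped_def)
    moreover have "trapped \<rho> T t0 v y"
      using sol En[of t0] pot_A_neg t0 tD T(4) T3 by (auto simp: trapped_def)
    ultimately have g: "gap (ef_v (U \<gamma>)) x v y t \<le> K * exp (- c * (T - t0))" if "t \<in> {T..ln hi}" for t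
      using cmpK that by blast
    have small: "K * exp (- c * (T - t0)) < e'\<^sup>2"
    proof -
      have "T - t0 \<ge> T - D - t_esc \<gamma>" using t0 by auto
      moreover have "t_esc \<gamma> \<le> T - D - (ln (K / e'\<^sup>2) + 1) / c" using elim by (simp add: T4_def)
      ultimately have "(ln (K / e'\<^sup>2) + 1) / c \<le> T - t0" by linarith
      then have "ln (K / e'\<^sup>2) + 1 \<le> c * (T - t0)" using \<rho>(3) by (simp add: field_simps)
      then have "K * exp (- c * (T - t0)) < K * exp (- ln (K / e'\<^sup>2))"
        using K by (intro mult_strict_left_mono) auto
      also have "\<dots> = e'\<^sup>2" using K e' by (simp add: exp_minus)
      finally show ?thesis .
    qed
    show ?case
    proof
      fix s assume s: "s \<in> {lo..hi}"
      then have s0: "0 < s" using lo by simp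
      have "ln lo \<le> ln s" "ln s \<le> ln hi" using s s0 lo by simp_all
      then have ls: "ln s \<in> {T..ln hi}" unfolding atLeastAtMost_iff using T(5) by linarith
      have "(ef_v (U \<gamma>) (ln s) - v (ln s))\<^sup>2 < e'\<^sup>2"
        using g[OF ls] small zero_le_power2[of "x (ln s) - y (ln s)"] unfolding gap_def by linarith
      then have d: "\<bar>ef_v (U \<gamma>) (ln s) - v (ln s)\<bar> < e'"
        using e' by (metis less_imp_le power2_abs power2_less_imp_less)
      have "U \<gamma> s - un_v v s = s powr (- \<theta>) * (ef_v (U \<gamma>) (ln s) - v (ln s))"
        using s0 by (simp add: un_v_def ef_v_def powr_def right_diff_distrib flip: mult.assoc exp_add)
      then have "dist (U \<gamma> s) (un_v v s) = s powr (- \<theta>) * \<bar>ef_v (U \<gamma>) (ln s) - v (ln s)\<bar>"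
        by (simp add: dist_real_def abs_mult)
      also have "\<dots> \<le> lo powr (- \<theta>) * \<bar>ef_v (U \<gamma>) (ln s) - v (ln s)\<bar>"
        using s lo \<theta>_pos by (intro mult_right_mono powr_mono2') auto
      also have "\<dots> < lo powr (- \<theta>) * e'" using d lo by (intro mult_strict_left_mono) auto
      also have "\<dots> = e" using lo by (simp add: e'_def powr_minus)
      finally show "dist (U \<gamma> s) (un_v v s) < e" .
    qed
  qed
qed

end

theorem theorem1p1:
  fixes N :: nat and p :: real
  assumes "N \<ge> 3" and "p > (real N + 2) / (real N - 2)"
  shows "\<exists>us :: real \<Rightarrow> real.
           (\<forall>s>0. us s > 0) \<and> radial_ode N p us \<and>
           filterlim us at_top (at_right 0) \<and>
           (\<forall>T. \<exists>s1>T. \<exists>s2>T. us s1 < 1 \<and> us s2 > 1) \<and>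
           (\<exists>sc :: nat \<Rightarrow> real. strict_mono sc \<and> sc 0 > 0 \<and>
              filterlim sc at_top sequentially \<and>
              {s. s > 0 \<and> deriv us s = 0} = range sc) \<and>
           (\<forall>U :: real \<Rightarrow> real \<Rightarrow> real. (\<forall>\<gamma>>0. ivp_sol N p \<gamma> (U \<gamma>)) \<longrightarrow>
              (\<forall>a b. 0 < a \<and> a \<le> b \<longrightarrow> uniform_limit {a..b} U us at_top))"
proof -
  interpret supercritical N p by unfold_locales fact+
  obtain v y where sol: "\<And>t0. ef_sol t0 v y" and En: "\<And>t. En t (v t) (y t) \<le> pot A"
    using singular_ef_sol by blast
  have rad: "radial_sol (un_v v) (un_y v y)" using sol by (rule ef_to_radial)
  have lim: "filterlim (un_v v) at_top (at_right 0)"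
    using singular_ef_sol_limit(1)[OF sol En] by (rule un_v_at_top)
  have rest: "\<not> (un_v v s = 1 \<and> un_y v y s = 0)" if "0 < s" for s
    using no_rest_point[OF rad lim that] .
  have \<delta>: "0 < - 2 * pot A / (L + 1)" using pot_A_neg L_pos by (simp add: field_simps)
  note osc = oscillation[OF rad rest \<delta> energy_lower_bound[OF sol En]]
  obtain s0 where s0: "0 < s0" "\<And>s. 0 < s \<Longrightarrow> s < s0 \<Longrightarrow> un_y v y s \<noteq> 0"
    using un_y_neg_near_0[OF singular_ef_sol_limit[OF sol En]] by blast
  have "deriv (un_v v) s = un_y v y s" if "0 < s" for s
    using rad that by (intro DERIV_imp_deriv) (auto simp: radial_sol_def)
  then have "{s. s > 0 \<and> deriv (un_v v) s = 0} = {s. 0 < s \<and> un_y v y s = 0}" by auto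
  moreover have "radial_ode N p (un_v v)"
    using rad unfolding radial_ode_def radial_sol_def by blast
  moreover have "\<forall>s>0. un_v v s > 0" using rad by (simp add: radial_sol_def)
  moreover have "\<exists>s1>T. \<exists>s2>T. un_v v s1 < 1 \<and> un_v v s2 > 1" for T
    using osc[of T] by blast
  ultimately show ?thesis
    using lim critical_points[OF rad rest s0 osc] convergence[OF sol En]
    by (intro exI[of _ "un_v v"]) auto
qed

end
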